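(* Let $U\subset\mathbb{C}$ be a simply connected domain and $\Phi=\sum_{i=1}^rA_i\chi_i$ a piecewise analytic function on $U$ with canonical data $(M_i,A_i)_{i=1}^r$, and assume $\Phi\in\Sigma(U)$. Choose analytic $f_i$ on $U$ with $f_i'=A_i$. Assume: (i) for all $j<k<l$, the one-dimensional Hausdorff measure of $\partial M_j\cap\partial M_k\cap\partial M_l$ is $0$; (ii) for every $p\in U$ with $i(p)>1$ and every $k\in I(p)$, one has $0\notin V_k(p)$. Then for every $p\in U$ there is a neighborhood of $p$ in which $\Phi=2\,\partial_z\phi_p$ a.e., where $\phi_p(z)=\max_{j\in I(p)}\Re\big(f_j(z)-f_j(p)\big)$.
   Context: A function $\Phi\in L^1_{loc}(U)$ is piecewise analytic with canonical data $(M_i,A_i)_{i=1}^r$ if $A_1,\dots,A_r$ are pairwise distinct analytic functions on $U$, $M_i=U\setminus\operatorname{supp}(\Phi-A_i)$ (supports in the distribution sense), $U\setminus\bigcup_iM_i$ has Lebesgue measure zero, $\chi_i$ is the characteristic function of $M_i$. $\Sigma(U)$ is the set of distributions $f$ on $U$ with $\partial f/\partial\bar z\ge0$ (a positive measure). For $p\in U$, $I(p)=\{j: p\in\overline{M_j}\}$ and $i(p)=|I(p)|$. For $k\in I(p)$ with $i(p)>1$, $V_k(p)=\big\{\sum_{j\in I(p)\setminus\{k\}}\theta_j(f_k'(p)-f_j'(p)) : \theta_j\ge0,\ \sum_j\theta_j>0\big\}$. $\partial_z=\frac12(\partial_x-i\partial_y)$ in the distribution sense. *)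

theory Defs
  imports "HOL-Analysis.Analysis"
begin

fun Ck_fun :: "nat \<Rightarrow> (complex \<Rightarrow> real) \<Rightarrow> bool" where
  "Ck_fun 0 f = continuous_on UNIV f"
| "Ck_fun (Suc n) f = ((\<forall>z. f differentiable (at z)) \<and> continuous_on UNIV f \<and>
      (\<forall>v. Ck_fun n (\<lambda>z. frechet_derivative f (at z) v)))"

definition smooth_fun :: "(complex \<Rightarrow> real) \<Rightarrow> bool" where
  "smooth_fun f \<longleftrightarrow> (\<forall>n. Ck_fun n f)"

definition tsupport :: "(complex \<Rightarrow> real) \<Rightarrow> complex set" where
  "tsupport f = closure {z. f z \<noteq> 0}"

definition test_fun :: "(complex \<Rightarrow> real) \<Rightarrow> complex set \<Rightarrow> bool" where
  "test_fun \<psi> W \<longleftrightarrow> smooth_fun \<psi> \<and> compact (tsupport \<psi>) \<and> tsupport \<psi> \<subseteq> W"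

definition dz :: "(complex \<Rightarrow> real) \<Rightarrow> complex \<Rightarrow> complex" where
  "dz \<psi> z = (complex_of_real (frechet_derivative \<psi> (at z) 1)
              - \<i> * complex_of_real (frechet_derivative \<psi> (at z) \<i>)) / 2"

definition dzbar :: "(complex \<Rightarrow> real) \<Rightarrow> complex \<Rightarrow> complex" where
  "dzbar \<psi> z = (complex_of_real (frechet_derivative \<psi> (at z) 1)
              + \<i> * complex_of_real (frechet_derivative \<psi> (at z) \<i>)) / 2"

definition loc_integrable :: "complex set \<Rightarrow> (complex \<Rightarrow> complex) \<Rightarrow> bool" where
  "loc_integrable U g \<longleftrightarrow> (\<forall>K. compact K \<and> K \<subseteq> U \<longrightarrow> set_integrable lebesgue K g)"

definition pair :: "(complex \<Rightarrow> complex) \<Rightarrow> (complex \<Rightarrow> real) \<Rightarrow> complex" where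
  "pair g \<psi> = (LINT z|lebesgue. g z * complex_of_real (\<psi> z))"

definition dist_supp :: "complex set \<Rightarrow> (complex \<Rightarrow> complex) \<Rightarrow> complex set" where
  "dist_supp U g = U - {x \<in> U. \<exists>W. open W \<and> x \<in> W \<and> W \<subseteq> U \<and>
                                 (\<forall>\<psi>. test_fun \<psi> W \<longrightarrow> pair g \<psi> = 0)}"

text \<open>Sigma(U): distributions f on U with d f / d zbar a positive measure, i.e.
  <d f/d zbar, psi> = - <f, d psi/d zbar> is real and nonnegative for every
  nonnegative test function psi.\<close>
definition Sigma_cls :: "complex set \<Rightarrow> (complex \<Rightarrow> complex) set" where
  "Sigma_cls U = {f. loc_integrable U f \<and>
     (\<forall>\<psi>. test_fun \<psi> U \<and> (\<forall>z. \<psi> z \<ge> 0) \<longrightarrow>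
        Im (- (LINT z|lebesgue. f z * dzbar \<psi> z)) = 0 \<and>
        Re (- (LINT z|lebesgue. f z * dzbar \<psi> z)) \<ge> 0)}"

definition two_dz_eq_on :: "complex set \<Rightarrow> (complex \<Rightarrow> real) \<Rightarrow> (complex \<Rightarrow> complex) \<Rightarrow> bool" where
  "two_dz_eq_on W \<phi> g \<longleftrightarrow> (\<forall>\<psi>. test_fun \<psi> W \<longrightarrow>
      - 2 * (LINT z|lebesgue. complex_of_real (\<phi> z) * dz \<psi> z) = pair g \<psi>)"

definition canonical_data ::
  "complex set \<Rightarrow> (complex \<Rightarrow> complex) \<Rightarrow> nat \<Rightarrow> (nat \<Rightarrow> complex \<Rightarrow> complex)
     \<Rightarrow> (nat \<Rightarrow> complex set) \<Rightarrow> bool" where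
  "canonical_data U \<Phi> r A M \<longleftrightarrow>
     loc_integrable U \<Phi> \<and>
     (\<forall>i\<in>{1..r}. A i analytic_on U) \<and>
     (\<forall>i\<in>{1..r}. \<forall>j\<in>{1..r}. i \<noteq> j \<longrightarrow> (\<exists>z\<in>U. A i z \<noteq> A j z)) \<and>
     (\<forall>i\<in>{1..r}. M i = U - dist_supp U (\<lambda>z. \<Phi> z - A i z)) \<and>
     (U - (\<Union>i\<in>{1..r}. M i)) \<in> null_sets lebesgue"

definition Iset :: "complex set \<Rightarrow> nat \<Rightarrow> (nat \<Rightarrow> complex set) \<Rightarrow> complex \<Rightarrow> nat set" where
  "Iset U r M p = {j \<in> {1..r}. p \<in> closure (M j)}"

definition Vset :: "nat set \<Rightarrow> (nat \<Rightarrow> complex \<Rightarrow> complex) \<Rightarrow> complex \<Rightarrow> nat \<Rightarrow> complex set" where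
  "Vset I f p k = {(\<Sum>j\<in>I - {k}. complex_of_real (\<theta> j) * (deriv (f k) p - deriv (f j) p)) | \<theta>.
        (\<forall>j\<in>I - {k}. \<theta> j \<ge> 0) \<and> (\<Sum>j\<in>I - {k}. \<theta> j) > 0}"

definition hausdorff1_pre :: "real \<Rightarrow> complex set \<Rightarrow> ennreal" where
  "hausdorff1_pre \<delta> E = (INF C \<in> {C :: nat \<Rightarrow> complex set. E \<subseteq> (\<Union>n. C n) \<and>
        (\<forall>n. bounded (C n) \<and> diameter (C n) \<le> \<delta>)}. (\<Sum>n. ennreal (diameter (C n))))"

definition hausdorff1 :: "complex set \<Rightarrow> ennreal" where
  "hausdorff1 E = (SUP \<delta> \<in> {0<..}. hausdorff1_pre \<delta> E)"

end

theory Submission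
  imports Defs "HOL-Complex_Analysis.Complex_Analysis"
begin

text \<open>
  Fix \<open>p\<close>. Condition (ii) says that the values \<open>A\<^sub>j(p)\<close>, \<open>j \<in> I(p)\<close>, are distinct vertices of a convex
  polygon, so for every \<open>k \<in> I(p)\<close> there is an open cone of directions \<open>v\<close> with
  \<open>Re ((A\<^sub>k - A\<^sub>j) v) > 0\<close> near \<open>p\<close> for all other \<open>j\<close>.

  Where only \<open>M\<^sub>j\<close> and \<open>M\<^sub>k\<close> meet, positivity of the measure \<open>\<partial>\<Phi>/\<partial>zbar\<close> forces the indicator of \<open>M\<^sub>k\<close> to
  be nondecreasing along \<open>v\<close>. By (i) almost every line in direction \<open>v\<close> avoids the points where three
  pieces meet, hence \<open>M\<^sub>k\<close> is invariant under translation along the cone near \<open>p\<close>.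

  Since \<open>\<partial>\<Phi>/\<partial>zbar\<close> is real, the mollifications of \<open>Re (\<Phi> dz)\<close> have potentials \<open>\<phi>\<close>. Up to a small error
  \<open>\<phi> - Re f\<^sub>k\<close> decreases along the cone of \<open>k\<close> and is constant along segments inside \<open>M\<^sub>k\<close>. Comparing the
  values near \<open>p\<close>, at a point of \<open>M\<^sub>k\<close>, and at points \<open>q\<^sub>k\<close> far out in the cones shows that
  \<open>Re (f\<^sub>k - f\<^sub>k(p))\<close> is the largest of the branches on \<open>M\<^sub>k\<close>. Integration by parts for the Lipschitz
  function \<open>max\<^sub>j Re (f\<^sub>j - f\<^sub>j(p))\<close> then gives the claim.
\<close>

section \<open>Smooth test functions\<close>

text \<open>\<open>Sigma_cls\<close> is probed only by real nonnegative test functions and returns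
  two facts: a sign and a vanishing imaginary part. The sign yields the translation invariance of
  the pieces, the reality yields the potentials; complex weights must first be split into real test
  functions. Condition (i) cannot keep triple points off a given line; it only makes their shadow
  across \<open>v\<close> null. So segments are moved slightly, which is harmless because the pieces
  are open and swallow every open set that they fill up to a null set. No limit of the potentials is
  taken. They depend on the mollification radius, hence on a tolerance \<open>\<eta>\<close>, but
  cancel: for \<open>z\<close> in \<open>M k\<close> the potential at \<open>z\<close> is bounded
  above through branch \<open>k\<close>, because the segment to \<open>q k\<close> stays in
  \<open>M k\<close>, and below through any branch \<open>j\<close>, because towards
  \<open>q j\<close> it grows at most like \<open>Re (f j)\<close> up to the tolerance. What
  survives compares only \<open>f j\<close> and \<open>f k\<close> at \<open>z\<close> and
  \<open>p\<close>, so \<open>\<eta>\<close> may tend to 0 afterwards. The maximum need not be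
  differentiable where branches tie, but almost every point lies in an open piece, on which it
  equals one branch.\<close>

primrec Ck_real :: "nat \<Rightarrow> (real \<Rightarrow> real) \<Rightarrow> bool" where
  "Ck_real 0 f \<longleftrightarrow> continuous_on UNIV f"
| "Ck_real (Suc n) f \<longleftrightarrow> (\<exists>f'. (\<forall>x. (f has_real_derivative f' x) (at x)) \<and> Ck_real n f')"

lemma Ck_real_continuous: "Ck_real n f \<Longrightarrow> continuous_on UNIV f"
  by (cases n) (auto intro!: continuous_at_imp_continuous_on intro: DERIV_isCont)

lemma Ck_real_SucD: "Ck_real (Suc n) f \<Longrightarrow> Ck_real n f"
proof (induction n arbitrary: f)
  case 0
  then show ?case using Ck_real_continuous[of "Suc 0" f] by simp
next
  case (Suc n)
  then show ?case using Ck_real.simps(2) by blast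
qed

lemma Ck_real_const: "Ck_real n (\<lambda>x. c)"
proof (induction n arbitrary: c)
  case (Suc n)
  show ?case using Suc[of 0] by (auto intro!: exI[of _ "\<lambda>x. 0"])
qed simp

lemma Ck_real_add:
  assumes "Ck_real n f" "Ck_real n g"
  shows "Ck_real n (\<lambda>x. f x + g x)"
  using assms
proof (induction n arbitrary: f g)
  case (Suc n)
  then obtain f' g' where "\<And>x. (f has_real_derivative f' x) (at x)" "Ck_real n f'"
    "\<And>x. (g has_real_derivative g' x) (at x)" "Ck_real n g'" by auto
  then show ?case using Suc.IH[of f' g']
    by (auto intro!: exI[of _ "\<lambda>x. f' x + g' x"] derivative_eq_intros)
qed (auto intro: continuous_intros)

lemma Ck_real_mult:
  assumes "Ck_real n f" "Ck_real n g"
  shows "Ck_real n (\<lambda>x. f x * g x)"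
  using assms
proof (induction n arbitrary: f g)
  case (Suc n)
  then obtain f' g' where *: "\<And>x. (f has_real_derivative f' x) (at x)" "Ck_real n f'"
    "\<And>x. (g has_real_derivative g' x) (at x)" "Ck_real n g'" by auto
  have "Ck_real n (\<lambda>x. f' x * g x + g' x * f x)"
    by (intro Ck_real_add Suc.IH * Suc.prems[THEN Ck_real_SucD])
  moreover have "((\<lambda>x. f x * g x) has_real_derivative f' x * g x + g' x * f x) (at x)" for x
    by (intro DERIV_mult *)
  ultimately show ?case by (auto intro!: exI[of _ "\<lambda>x. f' x * g x + g' x * f x"])
qed (auto intro: continuous_intros)

lemma Ck_real_affine:
  assumes "Ck_real n f"
  shows "Ck_real n (\<lambda>x. f (a * x + b))"
  using assms
proof (induction n arbitrary: f)
  case 0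
  then show ?case by (auto intro: continuous_on_compose2 intro!: continuous_intros)
next
  case (Suc n)
  then obtain f' where *: "\<And>x. (f has_real_derivative f' x) (at x)" "Ck_real n f'" by auto
  have "((\<lambda>x. f (a * x + b)) has_real_derivative a * f' (a * x + b)) (at x)" for x
  proof -
    have "((\<lambda>x. a * x + b) has_real_derivative a) (at x)"
      by (auto intro!: derivative_eq_intros)
    from DERIV_chain2[OF *(1) this] show ?thesis by (simp add: mult.commute)
  qed
  moreover have "Ck_real n (\<lambda>x. a * f' (a * x + b))"
    using * Suc.IH by (intro Ck_real_mult Ck_real_const) auto
  ultimately show ?case by (auto intro!: exI[of _ "\<lambda>x. a * f' (a * x + b)"])
qed

section \<open>Flat exponentials, bumps and smoothed steps\<close>

definition flat_exp :: "real poly \<Rightarrow> real \<Rightarrow> real" where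
  "flat_exp P x = (if x > 0 then poly P (1 / x) * exp (- (1 / x)) else 0)"

lemma poly_exp_decay: "((\<lambda>y. poly P y * exp (- y)) \<longlongrightarrow> 0) (at_top :: real filter)"
proof -
  have "((\<lambda>y. \<Sum>i\<le>degree P. coeff P i * (y ^ i / exp y)) \<longlongrightarrow> 0) (at_top :: real filter)"
    by (intro tendsto_null_sum tendsto_mult_right_zero tendsto_power_div_exp_0)
  then show ?thesis
    by (simp add: poly_altdef exp_minus field_simps sum_divide_distrib)
qed

text \<open>With \<open>y = 1/x\<close>, differentiating \<open>P(y) exp(-y)\<close> gives
  \<open>y^2 (P - P')(y) exp(-y)\<close>. Carrying the polynomial as a parameter makes the family
  closed under differentiation, so smoothness becomes a plain induction.\<close>

lemma flat_exp_derivative: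
  "(flat_exp P has_real_derivative flat_exp ([:0, 0, 1:] * (P - pderiv P)) x) (at x)"
proof -
  consider "x < 0" | "x > 0" | "x = 0" by linarith
  then show ?thesis
  proof cases
    case 1
    have "\<forall>\<^sub>F y in nhds x. (\<lambda>_. 0) y = flat_exp P y"
      using eventually_nhds_in_open[of "{..<0}" x] 1
      by (auto simp: flat_exp_def elim!: eventually_mono)
    then have "(flat_exp P has_real_derivative 0) (at x)"
      using DERIV_cong_ev[OF refl _ refl, of "\<lambda>_. 0" "flat_exp P" x] DERIV_const by blast
    with 1 show ?thesis by (simp add: flat_exp_def)
  next
    case 2
    have "((\<lambda>x. poly P (1 / x) * exp (- (1 / x))) has_real_derivative
        poly ([:0, 0, 1:] * (P - pderiv P)) (1 / x) * exp (- (1 / x))) (at x)"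
      using 2 by (auto intro!: derivative_eq_intros DERIV_chain2[OF poly_DERIV] simp: field_simps power2_eq_square)
    moreover have "\<forall>\<^sub>F y in nhds x. poly P (1 / y) * exp (- (1 / y)) = flat_exp P y"
      using eventually_nhds_in_open[of "{0<..}" x] 2
      by (auto simp: flat_exp_def elim!: eventually_mono)
    ultimately have "(flat_exp P has_real_derivative
        poly ([:0, 0, 1:] * (P - pderiv P)) (1 / x) * exp (- (1 / x))) (at x)"
      using DERIV_cong_ev[OF refl _ refl, of "\<lambda>x. poly P (1 / x) * exp (- (1 / x))" "flat_exp P" x] by blast
    then show ?thesis using 2 unfolding flat_exp_def[of "[:0, 0, 1:] * (P - pderiv P)"] by simp
  next
    case 3
    \<comment> \<open>At 0 the difference quotient is \<open>flat_exp P y / y\<close>; dividing by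
      \<open>y\<close> multiplies the polynomial in \<open>1/y\<close> by its variable, and
      exponential decay still wins.\<close>
    have "((\<lambda>y. poly ([:0, 1:] * P) (1 / y) * exp (- (1 / y))) \<longlongrightarrow> 0) (at_right 0)"
      using filterlim_compose[OF poly_exp_decay[of "[:0, 1:] * P"] filterlim_inverse_at_top_right]
      by (simp add: inverse_eq_divide del: mult_pCons_left)
    then have "((\<lambda>y. flat_exp P y / y) \<longlongrightarrow> 0) (at_right 0)"
      by (rule Lim_transform_eventually) (auto simp: flat_exp_def eventually_at_filter)
    moreover have "((\<lambda>y. flat_exp P y / y) \<longlongrightarrow> 0) (at_left 0)"
      by (rule Lim_transform_eventually[OF tendsto_const])
        (auto simp: flat_exp_def eventually_at_filter)
    ultimately have "((\<lambda>y. flat_exp P y / y) \<longlongrightarrow> 0) (at 0)"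
      by (simp add: filterlim_split_at)
    then show ?thesis using 3 by (simp add: DERIV_def flat_exp_def)
  qed
qed

lemma Ck_real_flat_exp: "Ck_real n (flat_exp P)"
proof (induction n arbitrary: P)
  case 0
  show ?case using flat_exp_derivative
    by (auto intro!: continuous_at_imp_continuous_on DERIV_isCont)
next
  case (Suc n)
  then show ?case using flat_exp_derivative by auto
qed

definition bump :: "real \<Rightarrow> real \<Rightarrow> real" where
  "bump e x = flat_exp 1 (x + e) * flat_exp 1 (e - x)"

lemma Ck_real_bump: "Ck_real n (bump e)"
  using Ck_real_mult[OF Ck_real_affine[OF Ck_real_flat_exp[of n 1], of 1 e]
      Ck_real_affine[OF Ck_real_flat_exp[of n 1], of "-1" e]]
  by (simp add: bump_def[abs_def])

lemma bump_nonneg: "bump e x \<ge> 0"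
  by (simp add: bump_def flat_exp_def)

lemma bump_pos_iff: "bump e x > 0 \<longleftrightarrow> \<bar>x\<bar> < e"
  by (auto simp: bump_def flat_exp_def)

lemma bump_eq_0_iff: "bump e x = 0 \<longleftrightarrow> \<bar>x\<bar> \<ge> e"
  using bump_pos_iff[of e x] bump_nonneg[of e x] by linarith

lemma bump_le_1: "bump e x \<le> 1"
  by (auto simp: bump_def flat_exp_def mult_le_one)

text \<open>The antiderivative of \<open>bump e\<close> that vanishes on the far left. A difference
  \<open>step e x - step e (x - t)\<close> with \<open>t >= 0\<close> is a nonnegative plateau of
  bounded support whose derivative is a difference of two bumps; both uses of positivity rest on
  such plateaus.\<close>

definition step :: "real \<Rightarrow> real \<Rightarrow> real" where
  "step e x = (if x \<ge> - e then integral {- e..x} (bump e) else 0)"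

lemma step_derivative: "(step e has_real_derivative bump e x) (at x)"
proof -
  have c: "continuous_on A (bump e)" for A
    using Ck_real_continuous[OF Ck_real_bump] continuous_on_subset by blast
  \<comment> \<open>Starting the integral strictly left of both \<open>-e\<close> and
    \<open>x\<close> removes the case distinction in \<open>step\<close> near \<open>x\<close>,
    since \<open>bump e\<close> vanishes on the added stretch.\<close>
  define a where "a = min (- e) x - 1"
  define b where "b = x + 1"
  have eq: "step e y = integral {a..y} (bump e)" if "y \<ge> a" for y
  proof (cases "y \<ge> - e")
    case True
    have "integral {a..- e} (bump e) = 0"
      by (subst Henstock_Kurzweil_Integration.integral_cong[of _ _ "\<lambda>_. 0"]) (auto simp: bump_eq_0_iff)
    moreover have "integral {a..- e} (bump e) + integral {- e..y} (bump e) = integral {a..y} (bump e)"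
      using True by (intro Henstock_Kurzweil_Integration.integral_combine integrable_continuous_real c) (auto simp: a_def)
    ultimately show ?thesis using True by (simp add: step_def)
  next
    case False
    have "integral {a..y} (bump e) = 0"
      using False by (subst Henstock_Kurzweil_Integration.integral_cong[of _ _ "\<lambda>_. 0"]) (auto simp: bump_eq_0_iff)
    with False show ?thesis by (simp add: step_def)
  qed
  have x: "x \<in> {a<..<b}" by (auto simp: a_def b_def)
  have "((\<lambda>y. integral {a..y} (bump e)) has_real_derivative bump e x) (at x within {a..b})"
    using x by (intro integral_has_real_derivative c) auto
  then have "((\<lambda>y. integral {a..y} (bump e)) has_real_derivative bump e x) (at x)"
    using x at_within_Icc_at by fastforce
  moreover have "\<forall>\<^sub>F y in nhds x. integral {a..y} (bump e) = step e y"
    using eventually_nhds_in_open[of "{a<..<b}" x] x eq by (auto elim!: eventually_mono)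
  ultimately show ?thesis by (simp add: DERIV_cong_ev[OF refl _ refl])
qed

lemma Ck_real_step: "Ck_real n (step e)"
proof (cases n)
  case 0
  then show ?thesis using step_derivative
    by (auto intro!: continuous_at_imp_continuous_on DERIV_isCont)
next
  case (Suc m)
  then show ?thesis using step_derivative[of e] Ck_real_bump[of m e] by auto
qed

lemma step_mono: "x \<le> y \<Longrightarrow> step e x \<le> step e y"
  using DERIV_nonneg_imp_nondecreasing[of x y "step e"] step_derivative bump_nonneg by blast

lemma step_left: "x \<le> - e \<Longrightarrow> step e x = 0"
  by (auto simp: step_def)

lemma step_right:
  assumes "e \<le> x" "e \<le> y"
  shows "step e x = step e y"
proof -
  have "\<exists>c. \<forall>x\<in>{e..}. step e x = c"
  proof (rule has_field_derivative_zero_constant)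
    fix x assume "x \<in> {e..}"
    then have "bump e x = 0" by (simp add: bump_eq_0_iff)
    then show "(step e has_real_derivative 0) (at x within {e..})"
      by (metis has_field_derivative_at_within step_derivative)
  qed simp
  then show ?thesis using assms by auto
qed

section \<open>Test functions on the plane\<close>

lemma Ck_fun_SucI:
  assumes "\<And>z. (f has_derivative D z) (at z)" "\<And>v. Ck_fun n (\<lambda>z. D z v)"
  shows "Ck_fun (Suc n) f"
proof -
  have "frechet_derivative f (at z) = D z" for z
    using frechet_derivative_at[OF assms(1)] by simp
  then show ?thesis
    using assms by (auto simp: differentiable_def intro!: continuous_at_imp_continuous_on has_derivative_continuous)
qed

lemma Ck_fun_SucE:
  assumes "Ck_fun (Suc n) f"
  obtains "\<And>z. (f has_derivative frechet_derivative f (at z)) (at z)"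
    "\<And>v. Ck_fun n (\<lambda>z. frechet_derivative f (at z) v)"
  using assms that frechet_derivative_works by auto

lemma Ck_fun_continuous: "Ck_fun n f \<Longrightarrow> continuous_on UNIV f"
  by (cases n) auto

lemma Ck_fun_SucD: "Ck_fun (Suc n) f \<Longrightarrow> Ck_fun n f"
proof (induction n arbitrary: f)
  case (Suc n)
  then show ?case using Ck_fun.simps(2) by blast
qed auto

lemma Ck_fun_add:
  assumes "Ck_fun n f" "Ck_fun n g"
  shows "Ck_fun n (\<lambda>z. f z + g z)"
  using assms
proof (induction n arbitrary: f g)
  case (Suc n)
  then show ?case
    by (elim Ck_fun_SucE, intro Ck_fun_SucI[of _ "\<lambda>z v. frechet_derivative f (at z) v + frechet_derivative g (at z) v"])
      (auto intro!: derivative_intros)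
qed (auto intro: continuous_intros)

lemma Ck_fun_mult:
  assumes "Ck_fun n f" "Ck_fun n g"
  shows "Ck_fun n (\<lambda>z. f z * g z)"
  using assms
proof (induction n arbitrary: f g)
  case (Suc n)
  note p = Suc.prems[THEN Ck_fun_SucD]
  show ?case using Suc.prems
    by (elim Ck_fun_SucE, intro Ck_fun_SucI[of _ "\<lambda>z v. f z * frechet_derivative g (at z) v + frechet_derivative f (at z) v * g z"])
      (auto intro!: has_derivative_mult Ck_fun_add Suc.IH p)
qed (auto intro: continuous_intros)

text \<open>The factor \<open>a\<close> closes the induction: the derivative in direction
  \<open>v\<close> has the same shape, with \<open>F'\<close> for \<open>F\<close> and
  \<open>a * Re (c * v)\<close> for \<open>a\<close>.\<close>

lemma Ck_fun_real_compose:
  assumes "Ck_real n F"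
  shows "Ck_fun n (\<lambda>z. a * F (Re (c * z) + d))"
  using assms
proof (induction n arbitrary: F a)
  case 0
  then show ?case by (auto intro!: continuous_intros intro: continuous_on_compose2)
next
  case (Suc n)
  then obtain F' where F': "\<And>x. (F has_real_derivative F' x) (at x)" "Ck_real n F'" by auto
  show ?case
  proof (rule Ck_fun_SucI)
    show "((\<lambda>z. a * F (Re (c * z) + d)) has_derivative (\<lambda>v. (a * Re (c * v)) * F' (Re (c * z) + d))) (at z)" for z
      by (rule derivative_eq_intros has_derivative_compose[OF _ has_field_derivative_imp_has_derivative[OF F'(1)]] refl
          | simp add: mult_ac)+
  qed (rule Suc.IH[OF F'(2)])
qed

lemma smooth_fun_add: "smooth_fun f \<Longrightarrow> smooth_fun g \<Longrightarrow> smooth_fun (\<lambda>z. f z + g z)"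
  by (simp add: smooth_fun_def Ck_fun_add)

lemma smooth_fun_mult: "smooth_fun f \<Longrightarrow> smooth_fun g \<Longrightarrow> smooth_fun (\<lambda>z. f z * g z)"
  by (simp add: smooth_fun_def Ck_fun_mult)

lemma smooth_fun_real_compose: "(\<And>n. Ck_real n F) \<Longrightarrow> smooth_fun (\<lambda>z. F (Re (c * z) + d))"
  unfolding smooth_fun_def using Ck_fun_real_compose[of _ F 1 c d] by simp

lemma smooth_fun_const: "smooth_fun (\<lambda>z. c)"
  using smooth_fun_real_compose[of "\<lambda>_. c"] by (simp add: Ck_real_const)

lemma smooth_fun_directional: "smooth_fun f \<Longrightarrow> smooth_fun (\<lambda>z. frechet_derivative f (at z) v)"
  unfolding smooth_fun_def using Ck_fun.simps(2)[of _ f] by blast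

lemma smooth_fun_has_derivative: "smooth_fun f \<Longrightarrow> (f has_derivative frechet_derivative f (at z)) (at z)"
  unfolding smooth_fun_def using Ck_fun_SucE[of 0 f] by blast

lemma smooth_fun_continuous: "smooth_fun f \<Longrightarrow> continuous_on A f"
  unfolding smooth_fun_def using Ck_fun_continuous[of 0 f] continuous_on_subset by blast

lemma tsupport_zero: "z \<notin> tsupport f \<Longrightarrow> f z = 0"
  unfolding tsupport_def using closure_subset[of "{z. f z \<noteq> 0}"] by auto

lemma frechet_derivative_zero_off_tsupport:
  assumes "z \<notin> tsupport f"
  shows "frechet_derivative f (at z) v = 0"
proof -
  have "((\<lambda>_. 0) has_derivative (\<lambda>_. 0)) (at z)" by simp
  moreover have "open (- tsupport f)" "z \<in> - tsupport f"
    using assms by (simp_all add: tsupport_def open_Compl)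
  ultimately have "(f has_derivative (\<lambda>_. 0)) (at z)"
    by (rule has_derivative_transform_within_open) (simp add: tsupport_zero)
  from frechet_derivative_at[OF this] show ?thesis by (simp add: fun_eq_iff)
qed

lemma tsupport_subset: "closed C \<Longrightarrow> (\<And>z. z \<notin> C \<Longrightarrow> f z = 0) \<Longrightarrow> tsupport f \<subseteq> C"
  unfolding tsupport_def by (rule closure_minimal) auto

lemma tsupport_directional: "tsupport (\<lambda>z. frechet_derivative f (at z) v) \<subseteq> tsupport f"
  by (rule tsupport_subset) (simp_all add: frechet_derivative_zero_off_tsupport, simp add: tsupport_def)

section \<open>Cut-offs multiplied by holomorphic weights\<close>

definition cut_mult :: "complex set \<Rightarrow> (complex \<Rightarrow> real) \<Rightarrow> (complex \<Rightarrow> complex) \<Rightarrow> complex \<Rightarrow> real" where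
  "cut_mult D \<eta> h z = (if z \<in> D then \<eta> z * Re (h z) else 0)"

text \<open>The derivative in direction \<open>v\<close> is a sum of two functions of the same kind,
  with data (derivative of \<open>\<eta>\<close>, \<open>h\<close>) and (\<open>\<eta>\<close>,
  \<open>v * deriv h\<close>). This is what the induction for smoothness needs. Off \<open>D\<close>
  the value 0 is differentiable because the support of \<open>\<eta>\<close> stays away.\<close>

lemma cut_mult_has_derivative:
  assumes "open D" "h holomorphic_on D" "smooth_fun \<eta>" "tsupport \<eta> \<subseteq> D"
  shows "(cut_mult D \<eta> h has_derivative
    (\<lambda>v. cut_mult D (\<lambda>z. frechet_derivative \<eta> (at z) v) h z + cut_mult D \<eta> (\<lambda>z. v * deriv h z) z)) (at z)"
proof (cases "z \<in> D")
  case True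
  have h: "(h has_derivative (\<lambda>v. v * deriv h z)) (at z)"
    using holomorphic_derivI[OF assms(2,1) True, of UNIV]
    by (simp add: has_field_derivative_def mult_commute_abs)
  have "((\<lambda>z. \<eta> z * Re (h z)) has_derivative
      (\<lambda>v. \<eta> z * Re (v * deriv h z) + frechet_derivative \<eta> (at z) v * Re (h z))) (at z)"
    by (intro has_derivative_mult smooth_fun_has_derivative[OF assms(3)] has_derivative_Re h)
  then have "(cut_mult D \<eta> h has_derivative
      (\<lambda>v. \<eta> z * Re (v * deriv h z) + frechet_derivative \<eta> (at z) v * Re (h z))) (at z)"
    by (rule has_derivative_transform_within_open[OF _ assms(1) True]) (simp add: cut_mult_def)
  then show ?thesis using True by (simp add: cut_mult_def add.commute)
next
  case False
  have "((\<lambda>_. 0) has_derivative (\<lambda>_. 0)) (at z)" by simp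
  moreover have "open (- tsupport \<eta>)" "z \<in> - tsupport \<eta>"
    using False assms(4) by (auto simp: tsupport_def open_Compl)
  ultimately have "(cut_mult D \<eta> h has_derivative (\<lambda>_. 0)) (at z)"
    by (rule has_derivative_transform_within_open) (simp add: cut_mult_def tsupport_zero)
  then show ?thesis using False by (simp add: cut_mult_def)
qed

lemma smooth_fun_cut_mult:
  assumes "open D" "h holomorphic_on D" "smooth_fun \<eta>" "tsupport \<eta> \<subseteq> D"
  shows "smooth_fun (cut_mult D \<eta> h)"
  unfolding smooth_fun_def
proof
  show "Ck_fun n (cut_mult D \<eta> h)" for n
    using assms
  proof (induction n arbitrary: \<eta> h)
    case 0
    show ?case using has_derivative_continuous[OF cut_mult_has_derivative[OF 0]]
      by (auto intro!: continuous_at_imp_continuous_on)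
  next
    case (Suc n)
    show ?case
    proof (rule Ck_fun_SucI[OF cut_mult_has_derivative[OF Suc.prems]], rule Ck_fun_add)
      fix v
      show "Ck_fun n (cut_mult D (\<lambda>z. frechet_derivative \<eta> (at z) v) h)"
        using Suc.prems tsupport_directional[of \<eta> v] by (intro Suc.IH smooth_fun_directional) auto
      show "Ck_fun n (cut_mult D \<eta> (\<lambda>z. v * deriv h z))"
        using Suc.prems by (intro Suc.IH holomorphic_intros) auto
    qed
  qed
qed

lemma test_fun_cut_mult:
  assumes "open D" "h holomorphic_on D" "test_fun \<eta> D"
  shows "test_fun (cut_mult D \<eta> h) D"
proof -
  have "tsupport (cut_mult D \<eta> h) \<subseteq> tsupport \<eta>"
    by (rule tsupport_subset) (auto simp: cut_mult_def tsupport_zero, simp add: tsupport_def)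
  then show ?thesis
    using assms smooth_fun_cut_mult[OF assms(1,2)] closed_Int_compact[of "tsupport (cut_mult D \<eta> h)" "tsupport \<eta>"]
    unfolding test_fun_def by (auto simp: Int_absorb2 tsupport_def)
qed

text \<open>The product rule for \<open>\<eta> h\<close> with the Cauchy-Riemann equation for
  \<open>h\<close>, written with real test functions only: since
  \<open>Re (- \<i> h) = Im h\<close>, the two cut-offs are the real and imaginary parts of
  \<open>\<eta> h\<close>.\<close>

lemma dzbar_cut_mult:
  assumes "open D" "h holomorphic_on D" "test_fun \<eta> D" "z \<in> D"
  shows "dzbar (cut_mult D \<eta> h) z + \<i> * dzbar (cut_mult D \<eta> (\<lambda>z. - \<i> * h z)) z = h z * dzbar \<eta> z"
proof -
  have 1: "frechet_derivative (cut_mult D \<eta> h) (at z) v =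
      frechet_derivative \<eta> (at z) v * Re (h z) + \<eta> z * Re (v * deriv h z)" for v
    using frechet_derivative_at[OF cut_mult_has_derivative[OF assms(1,2), of \<eta> z], symmetric] assms(3,4)
    by (simp add: test_fun_def cut_mult_def)
  have h': "(\<lambda>z. - \<i> * h z) holomorphic_on D" using assms(2) by (intro holomorphic_intros)
  have d: "deriv (\<lambda>z. - (\<i> * h z)) z = - (\<i> * deriv h z)"
    using deriv_cmult[of h z "- \<i>"] assms by (auto simp: holomorphic_on_imp_differentiable_at)
  have 2: "frechet_derivative (cut_mult D \<eta> (\<lambda>z. - \<i> * h z)) (at z) v =
      frechet_derivative \<eta> (at z) v * Im (h z) + \<eta> z * Im (v * deriv h z)" for v
    using frechet_derivative_at[OF cut_mult_has_derivative[OF assms(1) h', of \<eta> z], symmetric] assms(3,4)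
    by (simp add: test_fun_def cut_mult_def d)
  show ?thesis
    unfolding dzbar_def 1 2 by (simp add: complex_eq_iff field_simps)
qed

section \<open>Integration by parts\<close>

lemma integral_lebesgue_translate:
  fixes G :: "complex \<Rightarrow> 'a :: {banach, second_countable_topology}"
  assumes "continuous_on UNIV G"
  shows "(LINT z|lebesgue. G (a + z)) = (LINT z|lebesgue. G z)"
proof -
  have [measurable]: "G \<in> borel_measurable borel"
    using assms by (rule borel_measurable_continuous_onI)
  have "(LINT z|lborel. G z) = (LINT z|distr lborel borel ((+) a). G z)"
    by (simp add: lborel_distr_plus)
  also have "\<dots> = (LINT z|lborel. G (a + z))"
    by (rule integral_distr) auto
  finally show ?thesis by (simp add: integral_completion)
qed

lemma loc_integrable_mult:
  fixes g \<psi> :: "complex \<Rightarrow> complex"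
  assumes "loc_integrable U g" "compact K" "K \<subseteq> U"
    and \<psi>: "\<psi> \<in> borel_measurable lebesgue" "\<And>z. z \<in> K \<Longrightarrow> norm (\<psi> z) \<le> C" "\<And>z. z \<notin> K \<Longrightarrow> \<psi> z = 0"
  shows "integrable lebesgue (\<lambda>z. g z * \<psi> z)"
proof -
  have g: "integrable lebesgue (\<lambda>z. indicator K z *\<^sub>R g z)"
    using assms(1-3) by (auto simp: loc_integrable_def set_integrable_def)
  have eq: "g z * \<psi> z = (indicator K z *\<^sub>R g z) * \<psi> z" for z
    using \<psi>(3)[of z] by (cases "z \<in> K") auto
  show ?thesis
  proof (rule Bochner_Integration.integrable_bound)
    show "integrable lebesgue (\<lambda>z. C *\<^sub>R (indicator K z *\<^sub>R g z))"
      using g by (rule integrable_scaleR_right)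
    show "(\<lambda>z. g z * \<psi> z) \<in> borel_measurable lebesgue"
      unfolding eq using g \<psi>(1) by (intro borel_measurable_times) auto
    show "AE z in lebesgue. norm (g z * \<psi> z) \<le> norm (C *\<^sub>R (indicator K z *\<^sub>R g z))"
    proof (intro AE_I2)
      fix z
      show "norm (g z * \<psi> z) \<le> norm (C *\<^sub>R (indicator K z *\<^sub>R g z))"
      proof (cases "z \<in> K")
        case True
        with \<psi>(2)[of z] have "norm (g z) * norm (\<psi> z) \<le> norm (g z) * \<bar>C\<bar>"
          by (intro mult_left_mono) auto
        with True show ?thesis by (simp add: norm_mult mult.commute)
      qed (simp add: \<psi>(3))
    qed
  qed
qed

lemma continuous_loc_integrable:
  assumes "continuous_on U g"
  shows "loc_integrable U g"
  unfolding loc_integrable_def set_integrable_def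
proof safe
  fix K assume "compact K" "K \<subseteq> U"
  then have "integrable lborel (\<lambda>z. indicator K z *\<^sub>R g z)"
    using assms continuous_on_subset by (blast intro: borel_integrable_compact)
  then show "integrable lebesgue (\<lambda>z. indicator K z *\<^sub>R g z)"
    by (auto simp: integrable_completion)
qed

lemma continuous_lebesgue_measurable:
  fixes g :: "complex \<Rightarrow> 'a :: {second_countable_topology, real_normed_vector}"
  shows "continuous_on UNIV g \<Longrightarrow> g \<in> borel_measurable lebesgue"
  by (simp add: borel_measurable_continuous_onI measurable_completion)

lemma compact_support_bounded:
  fixes \<psi> :: "complex \<Rightarrow> 'a :: real_normed_vector"
  assumes "continuous_on UNIV \<psi>" "compact K" "\<And>z. z \<notin> K \<Longrightarrow> \<psi> z = 0"
  obtains C where "C > 0" "\<And>z. norm (\<psi> z) \<le> C"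
proof -
  have "compact (\<psi> ` K)"
    using assms continuous_on_subset by (blast intro: compact_continuous_image)
  then obtain C where "C > 0" "\<And>z. z \<in> K \<Longrightarrow> norm (\<psi> z) \<le> C"
    by (metis bounded_pos compact_imp_bounded imageI)
  then show ?thesis
    using assms(3) that[of C] by (metis less_imp_le norm_zero)
qed

lemma loc_integrable_mult_continuous:
  fixes g \<psi> :: "complex \<Rightarrow> complex"
  assumes "loc_integrable U g" "compact K" "K \<subseteq> U"
    and "continuous_on UNIV \<psi>" "\<And>z. z \<notin> K \<Longrightarrow> \<psi> z = 0"
  shows "integrable lebesgue (\<lambda>z. g z * \<psi> z)"
proof -
  obtain C where "\<And>z. norm (\<psi> z) \<le> C"
    using compact_support_bounded[OF assms(4,2,5)] by blast
  then show ?thesis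
    using assms by (intro loc_integrable_mult[OF assms(1-3), of \<psi> C] continuous_lebesgue_measurable) auto
qed

lemma test_fun_mono: "test_fun \<psi> W \<Longrightarrow> W \<subseteq> U \<Longrightarrow> test_fun \<psi> U"
  by (auto simp: test_fun_def)

lemma test_funI:
  assumes "smooth_fun \<psi>" "compact K" "K \<subseteq> W" "\<And>z. z \<notin> K \<Longrightarrow> \<psi> z = 0"
  shows "test_fun \<psi> W"
proof -
  have "tsupport \<psi> \<subseteq> K" using assms by (intro tsupport_subset compact_imp_closed)
  then show ?thesis
    using assms closed_Int_compact[of "tsupport \<psi>" K]
    by (auto simp: test_fun_def tsupport_def Int_absorb2)
qed

lemma test_fun_continuous:
  assumes "test_fun \<psi> W"
  shows "continuous_on A \<psi>" "continuous_on A (\<lambda>z. frechet_derivative \<psi> (at z) v)"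
    "continuous_on A (dzbar \<psi>)" "continuous_on A (dz \<psi>)"
proof -
  show 1: "continuous_on A \<psi>" "continuous_on A (\<lambda>z. frechet_derivative \<psi> (at z) v)" for v
    using assms by (auto simp: test_fun_def smooth_fun_continuous smooth_fun_directional)
  show "continuous_on A (dzbar \<psi>)" "continuous_on A (dz \<psi>)"
    unfolding dzbar_def[abs_def] dz_def[abs_def] by (intro continuous_intros 1; simp)+
qed

lemma test_fun_zero:
  assumes "z \<notin> tsupport \<psi>"
  shows "\<psi> z = 0" "frechet_derivative \<psi> (at z) v = 0" "dzbar \<psi> z = 0" "dz \<psi> z = 0"
  using assms by (auto simp: tsupport_zero frechet_derivative_zero_off_tsupport dzbar_def dz_def)

lemma test_fun_integrable:
  assumes "loc_integrable U g" "test_fun \<psi> U"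
  shows "integrable lebesgue (\<lambda>z. g z * complex_of_real (\<psi> z))"
    "integrable lebesgue (\<lambda>z. g z * complex_of_real (frechet_derivative \<psi> (at z) v))"
    "integrable lebesgue (\<lambda>z. g z * dzbar \<psi> z)" "integrable lebesgue (\<lambda>z. g z * dz \<psi> z)"
  using assms(2)
  by (auto intro!: loc_integrable_mult_continuous[OF assms(1), of "tsupport \<psi>"] continuous_intros
      test_fun_continuous[OF assms(2)] simp: test_fun_zero) (auto simp: test_fun_def)

lemma frechet_derivative_split:
  assumes "smooth_fun \<psi>"
  shows "frechet_derivative \<psi> (at z) v =
    Re v * frechet_derivative \<psi> (at z) 1 + Im v * frechet_derivative \<psi> (at z) \<i>"
proof -
  have l: "linear (frechet_derivative \<psi> (at z))"
    using smooth_fun_has_derivative[OF assms] has_derivative_linear by blast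
  have "v = Re v *\<^sub>R 1 + Im v *\<^sub>R \<i>" by (simp add: complex_eq_iff)
  then have "frechet_derivative \<psi> (at z) v = frechet_derivative \<psi> (at z) (Re v *\<^sub>R 1 + Im v *\<^sub>R \<i>)"
    by simp
  also have "\<dots> = Re v * frechet_derivative \<psi> (at z) 1 + Im v * frechet_derivative \<psi> (at z) \<i>"
    by (simp only: linear_add[OF l] linear_cmul[OF l] real_scaleR_def)
  finally show ?thesis .
qed

text \<open>The directional derivative is \<open>v * dz \<psi> + cnj v * dzbar \<psi>\<close>, and
  for real \<open>\<psi>\<close> the two terms are conjugate. This converts statements about
  \<open>dzbar\<close> into monotonicity along \<open>v\<close>.\<close>

lemma frechet_derivative_dzbar:
  assumes "smooth_fun \<psi>"
  shows "frechet_derivative \<psi> (at z) v = 2 * Re (cnj v * dzbar \<psi> z)"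
  by (subst frechet_derivative_split[OF assms]) (simp add: dzbar_def)

lemma test_fun_lipschitz:
  assumes "test_fun \<psi> W"
  shows "\<exists>L\<ge>0. \<forall>x y. \<bar>\<psi> x - \<psi> y\<bar> \<le> L * norm (x - y)"
proof -
  have K: "compact (tsupport \<psi>)" and s: "smooth_fun \<psi>" using assms by (auto simp: test_fun_def)
  obtain C1 where C1: "C1 > 0" "\<And>z. \<bar>frechet_derivative \<psi> (at z) 1\<bar> \<le> C1"
    using compact_support_bounded[OF test_fun_continuous(2)[OF assms] K] test_fun_zero(2)
    by (metis real_norm_def)
  obtain C2 where C2: "C2 > 0" "\<And>z. \<bar>frechet_derivative \<psi> (at z) \<i>\<bar> \<le> C2"
    using compact_support_bounded[OF test_fun_continuous(2)[OF assms] K] test_fun_zero(2)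
    by (metis real_norm_def)
  have "norm (\<psi> x - \<psi> y) \<le> (C1 + C2) * norm (x - y)" for x y
  proof (rule differentiable_bound[of UNIV])
    show "(\<psi> has_derivative frechet_derivative \<psi> (at z)) (at z within UNIV)" for z
      using smooth_fun_has_derivative[OF s] by simp
    show "onorm (frechet_derivative \<psi> (at z)) \<le> C1 + C2" for z
    proof (rule onorm_le)
      fix v
      have "\<bar>Re v * frechet_derivative \<psi> (at z) 1 + Im v * frechet_derivative \<psi> (at z) \<i>\<bar>
        \<le> \<bar>Re v\<bar> * \<bar>frechet_derivative \<psi> (at z) 1\<bar> + \<bar>Im v\<bar> * \<bar>frechet_derivative \<psi> (at z) \<i>\<bar>"
        by (metis abs_mult abs_triangle_ineq)
      also have "\<dots> \<le> norm v * C1 + norm v * C2"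
        using C1 C2 by (intro add_mono mult_mono abs_Re_le_cmod abs_Im_le_cmod) auto
      finally show "norm (frechet_derivative \<psi> (at z) v) \<le> (C1 + C2) * norm v"
        by (subst frechet_derivative_split[OF s]) (simp add: algebra_simps)
    qed
  qed auto
  with C1 C2 show ?thesis by (intro exI[of _ "C1 + C2"]) auto
qed

text \<open>Translation invariance makes the integral of every difference quotient vanish, so dominated
  convergence yields integration by parts already for Lipschitz functions.\<close>

lemma integral_directional_derivative_zero:
  fixes G G' :: "complex \<Rightarrow> real"
  assumes lip: "\<And>x y. \<bar>G x - G y\<bar> \<le> L * norm (x - y)"
    and K: "bounded K" "\<And>z. z \<notin> K \<Longrightarrow> G z = 0"
    and G': "G' \<in> borel_measurable lebesgue"
    and der: "AE z in lebesgue. \<exists>D. (G has_derivative D) (at z) \<and> D v = G' z"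
  shows "(LINT z|lebesgue. G' z) = 0"
proof -
  obtain R where R: "K \<subseteq> cball 0 R"
    using K(1) by (force simp: bounded_iff subset_iff)
  have "L-lipschitz_on UNIV G" if "L \<ge> 0"
    using lip that by (intro lipschitz_onI) (auto simp: dist_norm)
  moreover have "L \<ge> 0" using lip[of 0 1] by (smt (verit) mult_nonneg_nonneg norm_minus_commute norm_one diff_zero mult_cancel_left2)
  ultimately have c: "continuous_on UNIV G" using lipschitz_on_continuous_on by blast
  \<comment> \<open>All difference quotients below use steps \<open>v / (n + 1)\<close>, of length
    at most \<open>norm v\<close>, so this disc contains all their supports and carries the
    dominating function.\<close>
  define S where "S = cball (0 :: complex) (R + norm v)"
  have S: "compact S" by (simp add: S_def)
  have iG: "integrable lebesgue (\<lambda>z. G (a + z))" if "norm a \<le> norm v" for a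
  proof -
    have cc: "continuous_on UNIV (\<lambda>z. G (a + z))"
      by (intro continuous_on_compose2[OF c] continuous_intros) auto
    have "G (a + z) = 0" if "z \<notin> S" for z
    proof -
      have "norm z > R + norm v" using that by (auto simp: S_def)
      moreover have "norm z \<le> norm (a + z) + norm a" using norm_triangle_ineq4[of "a + z" a] by simp
      ultimately have "a + z \<notin> cball 0 R" using \<open>norm a \<le> norm v\<close> by auto
      with R K(2) show ?thesis by blast
    qed
    then have "(\<lambda>z. G (a + z)) = (\<lambda>z. indicator S z *\<^sub>R G (a + z))"
      by (auto simp: fun_eq_iff indicator_def of_bool_def)
    moreover have "integrable lborel (\<lambda>z. indicator S z *\<^sub>R G (a + z))"
      using cc S by (intro borel_integrable_compact) (auto intro: continuous_on_subset)
    moreover have "(\<lambda>z. G (a + z)) \<in> borel_measurable lborel"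
      using cc by (simp add: borel_measurable_continuous_onI)
    ultimately show ?thesis by (simp add: integrable_completion)
  qed
  define s where "s n z = (G (complex_of_real (1 / real (Suc n)) * v + z) - G z) * real (Suc n)" for n z
  have nv: "norm (complex_of_real (1 / real (Suc n)) * v) \<le> norm v" for n
    unfolding norm_mult norm_of_real by (rule mult_left_le_one_le) auto
  have int_s: "(LINT z|lebesgue. s n z) = 0" for n
    unfolding s_def using iG[OF nv[of n]] iG[of 0] integral_lebesgue_translate[OF c] by simp
  have zero: "s n z = 0" if "z \<notin> S" for n z
  proof -
    let ?a = "complex_of_real (1 / real (Suc n)) * v"
    have "norm z > R + norm v" using that by (auto simp: S_def)
    moreover have "norm z \<le> norm (?a + z) + norm ?a" using norm_triangle_ineq4[of "?a + z" ?a] by simp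
    ultimately have "?a + z \<notin> cball 0 R" "z \<notin> cball 0 R"
      using nv[of n] norm_ge_zero[of v] unfolding mem_cball_0 by linarith+
    with R K(2) have "G (?a + z) = 0" "G z = 0" by blast+
    then show ?thesis by (simp add: s_def)
  qed
  have "(\<lambda>n. LINT z|lebesgue. s n z) \<longlonglongrightarrow> (LINT z|lebesgue. G' z)"
  proof (rule integral_dominated_convergence[where w = "\<lambda>z. (L * norm v) * indicator S z"])
    show "s n \<in> borel_measurable lebesgue" for n
      unfolding s_def using iG[OF nv[of n]] iG[of 0] by (intro borel_measurable_times borel_measurable_diff) auto
    have "emeasure lebesgue S < \<infinity>" unfolding S_def using emeasure_lborel_cball_finite by auto
    then show "integrable lebesgue (\<lambda>z. (L * norm v) * indicator S z)"
      by (simp add: S_def)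
    show "AE z in lebesgue. norm (s n z) \<le> (L * norm v) * indicator S z" for n
    proof (intro AE_I2)
      fix z
      have "\<bar>s n z\<bar> \<le> L * norm v"
      proof -
        have "\<bar>G (complex_of_real (1 / real (Suc n)) * v + z) - G z\<bar> \<le> L * (norm v / real (Suc n))"
          using lip[of "complex_of_real (1 / real (Suc n)) * v + z" z]
          unfolding add_diff_cancel_right' norm_mult norm_of_real by simp
        then have "\<bar>G (complex_of_real (1 / real (Suc n)) * v + z) - G z\<bar> * real (Suc n)
            \<le> L * (norm v / real (Suc n)) * real (Suc n)"
          by (rule mult_right_mono) simp
        then show ?thesis unfolding s_def abs_mult by simp
      qed
      then show "norm (s n z) \<le> (L * norm v) * indicator S z" using zero[of z n] by (auto simp: indicator_def)
    qed
    show "AE z in lebesgue. (\<lambda>n. s n z) \<longlonglongrightarrow> G' z"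
      using der
    proof eventually_elim
      case (elim z)
      then obtain D where D: "(G has_derivative D) (at z)" "D v = G' z" by blast
      have l: "linear D" using D(1) has_derivative_linear by blast
      have "((\<lambda>t. complex_of_real t * v + z) has_derivative (\<lambda>t. complex_of_real t * v)) (at 0)"
        by (auto intro!: derivative_eq_intros)
      then have "((\<lambda>t. G (complex_of_real t * v + z)) has_derivative (\<lambda>t. D (complex_of_real t * v))) (at 0)"
        by (rule has_derivative_compose) (simp add: D)
      moreover have "D (complex_of_real t * v) = G' z * t" for t
        using linear_cmul[OF l, of t v] D(2) by (simp add: scaleR_conv_of_real mult.commute)
      ultimately have "((\<lambda>t. G (complex_of_real t * v + z)) has_real_derivative G' z) (at 0)"
        by (simp add: has_field_derivative_def mult_commute_abs)
      then have "((\<lambda>h. (G (complex_of_real h * v + z) - G z) / h) \<longlongrightarrow> G' z) (at 0)"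
        by (simp add: DERIV_def)
      moreover have "filterlim (\<lambda>n. 1 / real (Suc n)) (at 0) sequentially"
        unfolding filterlim_at using LIMSEQ_Suc[OF lim_1_over_n] by (auto simp del: of_nat_Suc)
      ultimately have "(\<lambda>n. (G (complex_of_real (1 / real (Suc n)) * v + z) - G z) / (1 / real (Suc n))) \<longlonglongrightarrow> G' z"
        by (rule filterlim_compose)
      then show ?case by (simp add: s_def[abs_def])
    qed
  qed (use G' in auto)
  then show ?thesis by (simp add: int_s LIMSEQ_const_iff)
qed

lemma integral_test_fun_derivative_zero:
  assumes "test_fun \<psi> W"
  shows "(LINT z|lebesgue. frechet_derivative \<psi> (at z) v) = 0"
proof -
  obtain L where L: "L \<ge> 0" "\<And>x y. \<bar>\<psi> x - \<psi> y\<bar> \<le> L * norm (x - y)"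
    using test_fun_lipschitz[OF assms] by auto
  show ?thesis
  proof (rule integral_directional_derivative_zero[OF L(2)])
    show "bounded (tsupport \<psi>)" using assms by (auto simp: test_fun_def compact_imp_bounded)
    show "(\<lambda>z. frechet_derivative \<psi> (at z) v) \<in> borel_measurable lebesgue"
      using assms by (intro continuous_lebesgue_measurable test_fun_continuous)
    show "AE z in lebesgue. \<exists>D. (\<psi> has_derivative D) (at z) \<and> D v = frechet_derivative \<psi> (at z) v"
      using assms smooth_fun_has_derivative by (auto simp: test_fun_def)
  qed (simp add: test_fun_zero)
qed

lemma integral_dzbar_zero:
  assumes "test_fun \<psi> W"
  shows "(LINT z|lebesgue. dzbar \<psi> z) = 0"
proof -
  have i: "integrable lebesgue (\<lambda>z. complex_of_real (frechet_derivative \<psi> (at z) v))" for v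
    using test_fun_integrable(2)[of UNIV "\<lambda>_. 1" \<psi> v] assms continuous_loc_integrable[of UNIV "\<lambda>_. 1"]
    by (auto intro: test_fun_mono)
  show ?thesis
    unfolding dzbar_def using i integral_test_fun_derivative_zero[OF assms] by simp
qed

text \<open>Holomorphic functions have vanishing weak \<open>dzbar\<close>: the integrand is
  \<open>dzbar\<close> of the real part of \<open>h \<eta>\<close> plus \<open>\<i>\<close> times
  \<open>dzbar\<close> of its imaginary part, both of them test functions.\<close>

lemma integral_holomorphic_dzbar_zero:
  assumes "open D" "h holomorphic_on D" "test_fun \<eta> D"
  shows "(LINT z|lebesgue. h z * dzbar \<eta> z) = 0"
proof -
  have h': "(\<lambda>z. - \<i> * h z) holomorphic_on D" using assms(2) by (intro holomorphic_intros)
  note t = test_fun_cut_mult[OF assms] test_fun_cut_mult[OF assms(1) h' assms(3)]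
  have i: "integrable lebesgue (dzbar \<psi>)" if "test_fun \<psi> D" for \<psi>
    using test_fun_integrable(3)[of UNIV "\<lambda>_. 1" \<psi>] that continuous_loc_integrable[of UNIV "\<lambda>_. 1"]
    by (auto intro: test_fun_mono)
  have "h z * dzbar \<eta> z = dzbar (cut_mult D \<eta> h) z + \<i> * dzbar (cut_mult D \<eta> (\<lambda>z. - \<i> * h z)) z" for z
  proof (cases "z \<in> D")
    case False
    then have "z \<notin> tsupport \<psi>" if "test_fun \<psi> D" for \<psi> using that by (auto simp: test_fun_def)
    then have "dzbar \<psi> z = 0" if "test_fun \<psi> D" for \<psi> using that test_fun_zero(3) by blast
    with t assms(3) show ?thesis by (metis add.right_neutral mult_zero_right)
  qed (simp only: dzbar_cut_mult[OF assms])
  then show ?thesis using i[OF t(1)] i[OF t(2)] integral_dzbar_zero[OF t(1)] integral_dzbar_zero[OF t(2)] by simp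
qed

section \<open>Two adjacent pieces\<close>

text \<open>Dividing by \<open>v\<close> gives coordinates with \<open>Re\<close> along
  \<open>v\<close> and \<open>Im\<close> across it. For \<open>w = v\<close> one has
  \<open>Re (w / v) = 1\<close> and \<open>Im (w / v) = 0\<close>, so only the factor
  \<open>F\<close> is differentiated.\<close>

lemma product_derivative:
  fixes z0 v :: complex
  assumes "\<And>x. (F has_real_derivative F' x) (at x)" "\<And>x. (G has_real_derivative G' x) (at x)"
  shows "frechet_derivative (\<lambda>z. F (Re ((z - z0) / v)) * G (Im ((z - z0) / v))) (at z) w =
    F' (Re ((z - z0) / v)) * Re (w / v) * G (Im ((z - z0) / v)) +
    F (Re ((z - z0) / v)) * (G' (Im ((z - z0) / v)) * Im (w / v))"
proof -
  have d: "((\<lambda>z. (z - z0) / v) has_derivative (\<lambda>w. w / v)) (at z)"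
    unfolding divide_inverse by (auto intro!: derivative_eq_intros)
  have "((\<lambda>z. F (Re ((z - z0) / v))) has_derivative (\<lambda>w. F' (Re ((z - z0) / v)) * Re (w / v))) (at z)"
    by (rule has_derivative_compose[OF has_derivative_Re[OF d] has_field_derivative_imp_has_derivative[OF assms(1)]])
  moreover have "((\<lambda>z. G (Im ((z - z0) / v))) has_derivative (\<lambda>w. G' (Im ((z - z0) / v)) * Im (w / v))) (at z)"
    by (rule has_derivative_compose[OF has_derivative_Im[OF d] has_field_derivative_imp_has_derivative[OF assms(2)]])
  ultimately have "((\<lambda>z. F (Re ((z - z0) / v)) * G (Im ((z - z0) / v))) has_derivative
    (\<lambda>w. F (Re ((z - z0) / v)) * (G' (Im ((z - z0) / v)) * Im (w / v)) +
      F' (Re ((z - z0) / v)) * Re (w / v) * G (Im ((z - z0) / v)))) (at z)"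
    by (rule has_derivative_mult)
  from frechet_derivative_at[OF this, symmetric] show ?thesis by (simp add: add.commute)
qed

lemma smooth_fun_product:
  fixes z0 v :: complex
  assumes "\<And>n. Ck_real n F" "\<And>n. Ck_real n G"
  shows "smooth_fun (\<lambda>z. F (Re ((z - z0) / v)) * G (Im ((z - z0) / v)))"
proof -
  have 1: "Re ((z - z0) / v) = Re (1 / v * z) + (- Re (z0 / v))" for z
    by (simp add: diff_divide_distrib)
  have 2: "Im ((z - z0) / v) = Re (- \<i> / v * z) + (- Im (z0 / v))" for z
  proof -
    have "- \<i> / v * z = - \<i> * (z / v)" for z by simp
    moreover have "Re (- \<i> * w) = Im w" for w by simp
    ultimately have "Re (- \<i> / v * z) = Im (z / v)" for z by (simp only:)
    then show ?thesis by (simp only: diff_divide_distrib minus_complex.sel add_uminus_conv_diff)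
  qed
  show ?thesis
    unfolding 1 2 by (intro smooth_fun_mult smooth_fun_real_compose assms)
qed

lemma test_fun_product:
  fixes z0 v :: complex
  assumes "\<And>n. Ck_real n F" "\<And>n. Ck_real n G" and v: "v \<noteq> 0"
    and F: "\<And>x. x \<notin> {a1..a2} \<Longrightarrow> F x = 0" and G: "\<And>x. x \<notin> {b1..b2} \<Longrightarrow> G x = 0"
    and W: "\<And>a b. a \<in> {a1..a2} \<Longrightarrow> b \<in> {b1..b2} \<Longrightarrow> z0 + v * Complex a b \<in> W"
  shows "test_fun (\<lambda>z. F (Re ((z - z0) / v)) * G (Im ((z - z0) / v))) W"
proof (rule test_funI[OF smooth_fun_product])
  let ?K = "(\<lambda>x. z0 + v * x) ` cbox (Complex a1 b1) (Complex a2 b2)"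
  show "compact ?K"
    by (intro compact_continuous_image continuous_intros compact_cbox)
  show "?K \<subseteq> W"
  proof safe
    fix x assume "x \<in> cbox (Complex a1 b1) (Complex a2 b2)"
    then have "Re x \<in> {a1..a2}" "Im x \<in> {b1..b2}" by (auto simp: in_cbox_complex_iff)
    from W[OF this] show "z0 + v * x \<in> W" by simp
  qed
  fix z assume z: "z \<notin> ?K"
  have "(z - z0) / v \<notin> cbox (Complex a1 b1) (Complex a2 b2)"
  proof
    assume "(z - z0) / v \<in> cbox (Complex a1 b1) (Complex a2 b2)"
    then have "z0 + v * ((z - z0) / v) \<in> ?K" by blast
    with z v show False by simp
  qed
  then have "Re ((z - z0) / v) \<notin> {a1..a2} \<or> Im ((z - z0) / v) \<notin> {b1..b2}"
    by (auto simp: in_cbox_complex_iff)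
  with F G show "F (Re ((z - z0) / v)) * G (Im ((z - z0) / v)) = 0" by fastforce
qed (use assms in auto)

lemma norm_mult_Complex_less:
  assumes "\<bar>a\<bar> \<le> e" "\<bar>b\<bar> \<le> e" "3 * norm v * e < d" "v \<noteq> 0"
  shows "norm (v * Complex a b) < d"
proof -
  have "norm (Complex a b) \<le> \<bar>a\<bar> + \<bar>b\<bar>" using cmod_le[of "Complex a b"] by simp
  then have "norm (v * Complex a b) \<le> norm v * (2 * e)"
    using assms by (auto simp: norm_mult intro!: mult_left_mono)
  also have "\<dots> \<le> 3 * norm v * e" using assms by (auto simp: mult.commute intro!: mult_left_mono)
  finally show ?thesis using assms by simp
qed

lemma exists_local_bump:
  assumes "open W" "z0 \<in> W"
  obtains \<psi> where "test_fun \<psi> W" "\<And>z. \<psi> z \<ge> 0" "\<psi> z0 > 0"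
proof -
  obtain d where d: "d > 0" "ball z0 d \<subseteq> W" using assms openE by blast
  define \<psi> where "\<psi> = (\<lambda>z. bump (d / 4) (Re ((z - z0) / 1)) * bump (d / 4) (Im ((z - z0) / 1)))"
  have "test_fun \<psi> W"
    unfolding \<psi>_def
  proof (rule test_fun_product[where ?a1.0 = "- (d / 4)" and ?a2.0 = "d / 4" and ?b1.0 = "- (d / 4)" and ?b2.0 = "d / 4"])
    fix a b assume "a \<in> {- (d / 4)..d / 4}" "b \<in> {- (d / 4)..d / 4}"
    then have "norm (1 * Complex a b) < d"
      using d by (intro norm_mult_Complex_less[of _ "d / 4"]) auto
    then have "z0 + 1 * Complex a b \<in> ball z0 d" by (simp add: dist_norm)
    with d show "z0 + 1 * Complex a b \<in> W" by blast
  qed (auto simp: Ck_real_bump bump_eq_0_iff abs_if split: if_splits)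
  moreover have "\<psi> z \<ge> 0" for z by (simp add: \<psi>_def bump_nonneg)
  moreover have "\<psi> z0 > 0" using d by (simp add: \<psi>_def bump_pos_iff)
  ultimately show ?thesis using that by blast
qed

lemma AE_lebesgue_not_open:
  fixes W :: "complex set"
  assumes "AE z in lebesgue. z \<notin> W" "open W"
  shows "W = {}"
proof (rule ccontr)
  assume "W \<noteq> {}"
  have "{z \<in> space lebesgue. \<not> z \<notin> W} \<in> null_sets lebesgue"
    using assms by (subst (asm) AE_iff_null_sets[symmetric]) (auto simp: AE_iff_null_sets)
  then have "negligible W" by (simp add: negligible_iff_null_sets)
  with \<open>W \<noteq> {}\<close> assms(2) show False using open_not_negligible by blast
qed

lemma dzbar_add_scale:
  assumes "smooth_fun \<psi>" "smooth_fun \<eta>"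
  shows "dzbar (\<lambda>z. \<psi> z + C * \<eta> z) z = dzbar \<psi> z + of_real C * dzbar \<eta> z"
proof -
  have "((\<lambda>z. \<psi> z + C * \<eta> z) has_derivative
      (\<lambda>v. frechet_derivative \<psi> (at z) v + C * frechet_derivative \<eta> (at z) v)) (at z)"
    by (intro derivative_intros smooth_fun_has_derivative assms)
  from frechet_derivative_at[OF this, symmetric] show ?thesis
    by (simp add: dzbar_def algebra_simps add_divide_distrib)
qed

text \<open>On the overlap zone of only two pieces the jump is \<open>b - a\<close>; testing \<open>\<Phi>\<close> against
  \<open>\<eta> * cnj v / (b - a)\<close> cancels the jump and leaves the derivative of the indicator along \<open>v\<close>.\<close>

lemma indicator_monotone_along:
  assumes D: "open D" "D \<subseteq> U" and Sigma: "\<Phi> \<in> Sigma_cls U"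
    and hol: "a holomorphic_on D" "b holomorphic_on D"
    and E: "open E" and rep: "AE z in lebesgue. z \<in> D \<longrightarrow> \<Phi> z = a z + (b z - a z) * indicator E z"
    and pos: "\<And>z. z \<in> D \<Longrightarrow> Re ((b z - a z) * v) > 0"
    and \<eta>: "test_fun \<eta> D" "\<And>z. \<eta> z \<ge> 0"
  shows "(LINT z|lebesgue. indicator E z * frechet_derivative \<eta> (at z) v) \<le> 0"
proof -
  define B where "B z = b z - a z" for z
  have B0: "B z \<noteq> 0" if "z \<in> D" for z using pos[OF that] by (auto simp: B_def)
  define h where "h z = cnj v / B z" for z
  have hh: "h holomorphic_on D"
    unfolding h_def using hol B0 by (auto simp: B_def intro!: holomorphic_intros)
  define h' where "h' = (\<lambda>z. - \<i> * h z)"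
  have hh': "h' holomorphic_on D" unfolding h'_def using hh by (intro holomorphic_intros)
  define P where "P = cut_mult D \<eta> h"
  define Q where "Q = cut_mult D \<eta> h'"
  have tP: "test_fun P D" and tQ: "test_fun Q D"
    unfolding P_def Q_def using test_fun_cut_mult[OF D(1) hh \<eta>(1)] test_fun_cut_mult[OF D(1) hh' \<eta>(1)] by auto
  have loc: "loc_integrable U \<Phi>" using Sigma by (simp add: Sigma_cls_def)
  note tU = test_fun_mono[OF _ D(2)]
  have sig: "Im (LINT z|lebesgue. \<Phi> z * dzbar \<psi> z) = 0 \<and> Re (LINT z|lebesgue. \<Phi> z * dzbar \<psi> z) \<le> 0"
    if "test_fun \<psi> D" "\<And>z. \<psi> z \<ge> 0" for \<psi>
    using Sigma tU[OF that(1)] that(2) by (auto simp: Sigma_cls_def)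
  have Re_h: "Re (h z) \<ge> 0" if "z \<in> D" for z
  proof -
    have "h z = cnj v * cnj (B z) / of_real ((norm (B z))\<^sup>2)"
      unfolding h_def by (rule complex_div_cnj)
    then have "Re (h z) = Re (B z * v) / (norm (B z))\<^sup>2"
      by (simp add: Re_divide_of_real mult.commute)
    then show ?thesis using pos[OF that] by (simp add: B_def)
  qed
  have P0: "P z \<ge> 0" for z using Re_h \<eta>(2) by (auto simp: P_def cut_mult_def)
  have K: "compact (tsupport \<eta>)" "tsupport \<eta> \<subseteq> D" using \<eta>(1) by (auto simp: test_fun_def)
  have "compact (h ` tsupport \<eta>)"
    using K hh by (meson compact_continuous_image continuous_on_subset holomorphic_on_imp_continuous_on)
  then obtain C where C: "\<And>z. z \<in> tsupport \<eta> \<Longrightarrow> norm (h z) \<le> C"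
    using compact_imp_bounded[of "h ` tsupport \<eta>"] by (auto simp: bounded_iff)
  have sm: "smooth_fun \<eta>" "smooth_fun Q" using \<eta> tQ by (auto simp: test_fun_def)
  \<comment> \<open>The weight for the imaginary part, \<open>Q\<close>, has no sign, whereas
    positivity may be tested only against nonnegative functions. Adding \<open>C * \<eta>\<close>,
    with \<open>C\<close> bounding \<open>norm h\<close> on the support of \<open>\<eta>\<close>,
    repairs this; only the vanishing of the imaginary part is extracted, and that is linear.\<close>
  have tQC: "test_fun (\<lambda>z. Q z + C * \<eta> z) D"
  proof (rule test_funI[OF _ K])
    show "smooth_fun (\<lambda>z. Q z + C * \<eta> z)"
      using sm by (intro smooth_fun_add smooth_fun_mult smooth_fun_const)
    show "Q z + C * \<eta> z = 0" if "z \<notin> tsupport \<eta>" for z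
      using that by (simp add: Q_def cut_mult_def tsupport_zero)
  qed
  have QC0: "Q z + C * \<eta> z \<ge> 0" for z
  proof (cases "z \<in> tsupport \<eta>")
    case True
    then have "\<bar>Im (h z)\<bar> \<le> C" using C abs_Im_le_cmod order_trans by blast
    then have "0 \<le> \<eta> z * (Im (h z) + C)" using \<eta>(2) by (intro mult_nonneg_nonneg) auto
    with True K(2) show ?thesis by (auto simp: Q_def cut_mult_def h'_def algebra_simps)
  qed (simp add: Q_def cut_mult_def tsupport_zero)
  note int = test_fun_integrable(3)[OF loc tU]
  have ImQ: "Im (LINT z|lebesgue. \<Phi> z * dzbar Q z) = 0"
  proof -
    have "(LINT z|lebesgue. \<Phi> z * dzbar (\<lambda>z. Q z + C * \<eta> z) z) =
        (LINT z|lebesgue. \<Phi> z * dzbar Q z + of_real C * (\<Phi> z * dzbar \<eta> z))"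
      by (simp add: dzbar_add_scale[OF sm(2,1)] algebra_simps)
    also have "\<dots> = (LINT z|lebesgue. \<Phi> z * dzbar Q z) + of_real C * (LINT z|lebesgue. \<Phi> z * dzbar \<eta> z)"
      using int[OF tQ] int[OF \<eta>(1)] by simp
    finally show ?thesis using sig[OF tQC QC0] sig[OF \<eta>] by simp
  qed
  have z0: "dzbar \<psi> z = 0" if "test_fun \<psi> D" "z \<notin> D" for \<psi> z
    using that test_fun_zero(3)[of z \<psi>] by (auto simp: test_fun_def)
  have split: "\<Phi> z * (h z * dzbar \<eta> z) = \<Phi> z * dzbar P z + \<i> * (\<Phi> z * dzbar Q z)" for z
  proof (cases "z \<in> D")
    case True
    then show ?thesis
      using dzbar_cut_mult[OF D(1) hh \<eta>(1)] unfolding P_def Q_def h'_def by (metis distrib_left mult.left_commute)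
  next
    case False
    then show ?thesis by (simp add: z0 tP tQ \<eta>(1))
  qed
  have I1: "(LINT z|lebesgue. \<Phi> z * (h z * dzbar \<eta> z)) =
      (LINT z|lebesgue. \<Phi> z * dzbar P z) + \<i> * (LINT z|lebesgue. \<Phi> z * dzbar Q z)"
    unfolding split using int[OF tP] int[OF tQ] by simp
  \<comment> \<open>The integral against \<open>Q\<close> is real, so after multiplication by
    \<open>\<i>\<close> it adds nothing to the real part; what remains is the integral against
    \<open>P >= 0\<close>.\<close>
  have Re1: "Re (LINT z|lebesgue. \<Phi> z * (h z * dzbar \<eta> z)) \<le> 0"
    unfolding I1 using ImQ sig[OF tP P0] by simp
  have ah: "(\<lambda>z. a z * h z) holomorphic_on D" using hol hh by (intro holomorphic_intros)
  have i2: "integrable lebesgue (\<lambda>z. a z * h z * dzbar \<eta> z)"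
    by (rule test_fun_integrable(3)[OF continuous_loc_integrable \<eta>(1)])
      (rule holomorphic_on_imp_continuous_on[OF ah])
  have [measurable]: "E \<in> sets borel" using E by simp
  have [measurable]: "E \<in> sets lebesgue" using E by simp
  have l1: "loc_integrable UNIV (\<lambda>_. 1)" by (simp add: continuous_loc_integrable)
  have i0: "integrable lebesgue (dzbar \<eta>)"
    using test_fun_integrable(3)[OF l1, of \<eta>] test_fun_mono[OF \<eta>(1)] by simp
  have i3: "integrable lebesgue (\<lambda>z. indicator E z * dzbar \<eta> z)"
  proof -
    have "integrable lebesgue (\<lambda>z. indicator E z *\<^sub>R dzbar \<eta> z)"
      using i0 by (intro integrable_mult_indicator) auto
    moreover have "(\<lambda>z. indicator E z *\<^sub>R dzbar \<eta> z) = (\<lambda>z. indicator E z * dzbar \<eta> z)"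
      by (auto simp: indicator_def)
    ultimately show ?thesis by simp
  qed
  \<comment> \<open>Here \<open>\<Phi>\<close> becomes \<open>a + B * indicator E\<close>. The part
    \<open>a * h\<close> is holomorphic and integrates to 0, while \<open>B * h\<close> is the
    constant \<open>cnj v\<close>.\<close>
  have "(LINT z|lebesgue. \<Phi> z * (h z * dzbar \<eta> z)) =
      (LINT z|lebesgue. a z * h z * dzbar \<eta> z + cnj v * (indicator E z * dzbar \<eta> z))"
  proof (rule integral_cong_AE)
    show "(\<lambda>z. \<Phi> z * (h z * dzbar \<eta> z)) \<in> borel_measurable lebesgue"
      unfolding split using int[OF tP] int[OF tQ] by (intro borel_measurable_integrable) simp
    show "(\<lambda>z. a z * h z * dzbar \<eta> z + cnj v * (indicator E z * dzbar \<eta> z)) \<in> borel_measurable lebesgue"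
      using i2 i3 by (intro borel_measurable_integrable) simp
    show "AE z in lebesgue. \<Phi> z * (h z * dzbar \<eta> z) =
        a z * h z * dzbar \<eta> z + cnj v * (indicator E z * dzbar \<eta> z)"
      using rep
    proof eventually_elim
      case (elim z)
      show ?case
      proof (cases "z \<in> D")
        case True
        have "B z * h z = cnj v" using B0[OF True] by (simp add: h_def)
        moreover have "\<Phi> z = a z + B z * indicator E z" using elim True by (simp add: B_def)
        ultimately show ?thesis by (simp add: algebra_simps)
      qed (simp add: z0 \<eta>(1))
    qed
  qed
  also have "\<dots> = cnj v * (LINT z|lebesgue. indicator E z * dzbar \<eta> z)"
    using i2 i3 integral_holomorphic_dzbar_zero[OF D(1) ah \<eta>(1)] by simp
  finally have "Re (cnj v * (LINT z|lebesgue. indicator E z * dzbar \<eta> z)) \<le> 0"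
    using Re1 by simp
  also have "cnj v * (LINT z|lebesgue. indicator E z * dzbar \<eta> z) = (LINT z|lebesgue. cnj v * (indicator E z * dzbar \<eta> z))"
    by simp
  also have "Re \<dots> = (LINT z|lebesgue. Re (cnj v * (indicator E z * dzbar \<eta> z)))"
    using i3 by (intro integral_Re[symmetric]) auto
  also have "(\<lambda>z. Re (cnj v * (indicator E z * dzbar \<eta> z))) = (\<lambda>z. indicator E z * frechet_derivative \<eta> (at z) v / 2)"
    by (auto simp: frechet_derivative_dzbar[OF sm(1)] indicator_def)
  finally show ?thesis by simp
qed

text \<open>Splitting \<open>a = a0 + s * t\<close> with \<open>s\<close> in [0, 1] and
  \<open>a0\<close> at most \<open>e\<close> in absolute value exhibits the point as a convex
  combination of equal offsets in the two end discs. The middle case \<open>0 < a <= t\<close>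
  occurs only for \<open>t > 0\<close>, so the division by \<open>t\<close> is safe.\<close>

lemma thick_segment_in_convex:
  assumes "convex D" "ball z e1 \<subseteq> D" "ball (z + of_real t * v) e1 \<subseteq> D" "t \<ge> 0"
    and e: "e > 0" "3 * norm v * e < e1" "v \<noteq> 0"
    and ab: "a \<in> {- e..t + e}" "b \<in> {- e..e}"
  shows "z + v * Complex a b \<in> D"
proof -
  define a0 where "a0 = (if a \<le> 0 then a else if a \<le> t then 0 else a - t)"
  define s where "s = (if a \<le> 0 then 0 else if a \<le> t then a / t else 1)"
  have s: "0 \<le> s" "s \<le> 1" "a = a0 + s * t" "\<bar>a0\<bar> \<le> e"
    using assms by (auto simp: s_def a0_def)
  define x where "x = v * Complex a0 b"
  have "norm x < e1"
    unfolding x_def using s ab e by (intro norm_mult_Complex_less[of _ e]) auto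
  then have "z + x \<in> D" "z + of_real t * v + x \<in> D"
    using assms(2,3) by (auto simp: subset_iff dist_norm)
  with s have "(1 - s) *\<^sub>R (z + x) + s *\<^sub>R (z + of_real t * v + x) \<in> D"
    using \<open>convex D\<close> by (intro convexD) auto
  also have "(1 - s) *\<^sub>R (z + x) + s *\<^sub>R (z + of_real t * v + x) = z + x + v * of_real (s * t)"
    by (simp add: algebra_simps scaleR_conv_of_real)
  also have "\<dots> = z + v * Complex a b"
    using s(3) by (simp add: x_def complex_eq_iff algebra_simps)
  finally show ?thesis .
qed

text \<open>The test function is a plateau along \<open>v\<close> times a bump across, so its
  derivative along \<open>v\<close> is \<open>\<beta> 0 - \<beta> t\<close>, a bump at
  \<open>z\<close> minus its translate at \<open>z + t v\<close>. Monotonicity says that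
  \<open>E\<close> carries at least as much of \<open>\<beta> t\<close> as of
  \<open>\<beta> 0\<close>. All of \<open>\<beta> 0\<close> lies in \<open>E\<close> and both have
  the same integral, so \<open>E\<close> has full measure where
  \<open>\<beta> t > 0\<close>.\<close>

lemma indicator_up_closed:
  assumes D: "open D" "convex D" "D \<subseteq> U" and Sigma: "\<Phi> \<in> Sigma_cls U"
    and hol: "a holomorphic_on D" "b holomorphic_on D"
    and E: "open E" and rep: "AE z in lebesgue. z \<in> D \<longrightarrow> \<Phi> z = a z + (b z - a z) * indicator E z"
    and pos: "\<And>z. z \<in> D \<Longrightarrow> Re ((b z - a z) * v) > 0"
    and z: "z \<in> E" "z \<in> D" and t: "t \<ge> 0" "z + of_real t * v \<in> D"
  shows "\<exists>N. open N \<and> z + of_real t * v \<in> N \<and> N \<subseteq> D \<and> (AE w in lebesgue. w \<in> N \<longrightarrow> w \<in> E)"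
proof -
  have v: "v \<noteq> 0" using pos[OF z(2)] by auto
  obtain e1 where e1: "e1 > 0" "ball z e1 \<subseteq> E \<inter> D"
    using z D(1) E openE[of "E \<inter> D" z] by blast
  obtain e2 where e2: "e2 > 0" "ball (z + of_real t * v) e2 \<subseteq> D"
    using t D(1) openE[of D "z + of_real t * v"] by blast
  define d where "d = min e1 e2"
  have d: "d > 0" "ball z d \<subseteq> E" "ball z d \<subseteq> D" "ball (z + of_real t * v) d \<subseteq> D"
    using e1 e2 by (auto simp: d_def)
  \<comment> \<open>Half-width in the coordinates divided by \<open>v\<close>; the 4 leaves room for
    the bound with 3 in \<open>norm_mult_Complex_less\<close>.\<close>
  define e where "e = d / (4 * norm v)"
  have e: "e > 0" "3 * norm v * e < d" using d v by (auto simp: e_def field_simps)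
  \<comment> \<open>This is \<open>step e x - step e (x - t)\<close>, spelled so that the closure
    rules for sums, products and affine substitutions match.\<close>
  define F where "F x = step e x + (- 1) * step e (1 * x + (- t))" for x
  define F' where "F' x = bump e x - bump e (x - t)" for x
  have F'D: "(F has_real_derivative F' x) (at x)" for x
    unfolding F_def F'_def
    by (auto intro!: derivative_eq_intros step_derivative DERIV_chain2[OF step_derivative])
  have CF: "Ck_real n F" for n
    unfolding F_def by (intro Ck_real_add Ck_real_mult Ck_real_const Ck_real_affine Ck_real_step)
  have F0: "F x = 0" if x: "x \<notin> {- e..t + e}" for x
  proof -
    consider "x < - e" | "x > t + e" using x by fastforce
    then show ?thesis
    proof cases
      case 1
      then show ?thesis using t by (simp add: F_def step_left)
    next
      case 2
      then have "step e x = step e (x - t)" using t by (intro step_right) auto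
      then show ?thesis by (simp add: F_def)
    qed
  qed
  define \<eta> where "\<eta> = (\<lambda>w. F (Re ((w - z) / v)) * bump e (Im ((w - z) / v)))"
  have t\<eta>: "test_fun \<eta> D"
    unfolding \<eta>_def
  proof (rule test_fun_product[where ?a1.0 = "- e" and ?a2.0 = "t + e" and ?b1.0 = "- e" and ?b2.0 = e])
    show "z + v * Complex a b \<in> D" if "a \<in> {- e..t + e}" "b \<in> {- e..e}" for a b
      by (rule thick_segment_in_convex[OF D(2) d(3,4) t(1) e v that])
  qed (use F0 v CF Ck_real_bump in \<open>auto simp: bump_eq_0_iff\<close>)
  have \<eta>0: "\<eta> w \<ge> 0" for w
    using t by (auto simp: \<eta>_def F_def bump_nonneg intro!: mult_nonneg_nonneg step_mono)
  define \<beta> where "\<beta> s w = bump e (Re ((w - z) / v) - s) * bump e (Im ((w - z) / v))" for s w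
  obtain G' where G': "\<And>x. (bump e has_real_derivative G' x) (at x)"
    using Ck_real_bump[of "Suc 0" e] by auto
  have der: "frechet_derivative \<eta> (at w) v = \<beta> 0 w - \<beta> t w" for w
    unfolding \<eta>_def product_derivative[OF F'D G'] using v by (simp add: F'_def \<beta>_def algebra_simps)
  have cb: "continuous_on A (bump e)" for A
    using Ck_real_continuous[OF Ck_real_bump] continuous_on_subset by blast
  have cont: "continuous_on UNIV (\<beta> s)" for s
    unfolding \<beta>_def using v by (intro continuous_intros continuous_on_compose2[OF cb]) auto
  have shift: "\<beta> s (of_real s * v + w) = \<beta> 0 w" for s w
  proof -
    have "(of_real s * v + w - z) / v = of_real s + (w - z) / v" using v by (simp add: field_simps)
    then show ?thesis by (simp add: \<beta>_def)
  qed
  have sup0: "w \<in> ball z d" if "\<beta> 0 w \<noteq> 0" for w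
  proof -
    have "\<bar>Re ((w - z) / v)\<bar> \<le> e" "\<bar>Im ((w - z) / v)\<bar> \<le> e"
      using that bump_eq_0_iff by (auto simp: \<beta>_def not_le[symmetric])
    then have "norm (v * Complex (Re ((w - z) / v)) (Im ((w - z) / v))) < d"
      using e v by (intro norm_mult_Complex_less[of _ e]) auto
    then show ?thesis using v by (simp add: dist_norm norm_minus_commute)
  qed
  have supt: "w \<in> ball (z + of_real t * v) d" if "\<beta> t w \<noteq> 0" for w
    using sup0[of "w - of_real t * v"] shift[of t "w - of_real t * v"] that
    by (simp add: dist_norm algebra_simps)
  have \<beta>0: "\<beta> s w \<ge> 0" for s w by (simp add: \<beta>_def bump_nonneg)
  have i: "integrable lebesgue (\<beta> s)" if "s = 0 \<or> s = t" for s
  proof -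
    have "loc_integrable UNIV (\<lambda>_. 1)" by (simp add: continuous_loc_integrable)
    from loc_integrable_mult_continuous[OF this, of "cball (z + of_real s * v) d" "\<lambda>w. complex_of_real (\<beta> s w)"]
    have "integrable lebesgue (\<lambda>w. complex_of_real (\<beta> s w))"
      using that sup0 supt cont[of s] by (force intro!: continuous_intros simp: subset_iff)
    from integrable_Re[OF this] show ?thesis by simp
  qed
  have [measurable]: "E \<in> sets lebesgue" using E by simp
  have iE: "integrable lebesgue (\<lambda>w. indicator E w * \<beta> s w)" if "s = 0 \<or> s = t" for s
    using integrable_mult_indicator[OF _ i[OF that], of E] by simp
  have "(LINT w|lebesgue. indicator E w * frechet_derivative \<eta> (at w) v) \<le> 0"
    by (rule indicator_monotone_along[OF D(1,3) Sigma hol E rep pos t\<eta> \<eta>0])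
  then have "(LINT w|lebesgue. indicator E w * \<beta> 0 w) \<le> (LINT w|lebesgue. indicator E w * \<beta> t w)"
    using iE by (simp add: der right_diff_distrib)
  also have "(\<lambda>w. indicator E w * \<beta> 0 w) = \<beta> 0"
  proof
    fix w
    have "\<beta> 0 w = 0 \<or> w \<in> E" using sup0 d(2) by blast
    then show "indicator E w * \<beta> 0 w = \<beta> 0 w" by auto
  qed
  also have "(LINT w|lebesgue. \<beta> 0 w) = (LINT w|lebesgue. \<beta> t w)"
    using integral_lebesgue_translate[OF cont, of t "of_real t * v"] by (simp add: shift)
  finally have le: "(LINT w|lebesgue. \<beta> t w - indicator E w * \<beta> t w) \<le> 0"
    using iE i by simp
  have nn: "AE w in lebesgue. 0 \<le> \<beta> t w - indicator E w * \<beta> t w"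
    using \<beta>0 by (auto simp: indicator_def)
  have "(LINT w|lebesgue. \<beta> t w - indicator E w * \<beta> t w) = 0"
    using le integral_nonneg_AE[OF nn] by linarith
  then have ae: "AE w in lebesgue. \<beta> t w - indicator E w * \<beta> t w = 0"
    using integral_nonneg_eq_0_iff_AE[OF _ nn] iE i by auto
  show ?thesis
  proof (intro exI conjI)
    show "open {w. \<beta> t w > 0}" using cont by (intro open_Collect_less continuous_intros)
    show "z + of_real t * v \<in> {w. \<beta> t w > 0}" using v e by (simp add: \<beta>_def bump_pos_iff)
    show "{w. \<beta> t w > 0} \<subseteq> D" using supt d(4) by fastforce
    show "AE w in lebesgue. w \<in> {w. \<beta> t w > 0} \<longrightarrow> w \<in> E"
      using ae by eventually_elim (auto simp: indicator_def split: if_splits)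
  qed
qed

lemma hausdorff1_zero_projection:
  assumes "hausdorff1 E = 0"
  shows "negligible ((\<lambda>z. Im (c * z)) ` E)"
  unfolding negligible_outer
proof (intro allI impI)
  fix e :: real assume e: "e > 0"
  \<comment> \<open>Chosen so that \<open>2 * norm c * e' < e\<close>; the added 1 keeps the
    denominator positive for \<open>c = 0\<close>.\<close>
  define e' where "e' = e / (4 * (norm c + 1))"
  have e': "e' > 0" using e by (auto simp: e'_def intro!: divide_pos_pos add_nonneg_pos)
  have "hausdorff1_pre 1 E \<le> hausdorff1 E"
    unfolding hausdorff1_def by (rule SUP_upper) simp
  then have "hausdorff1_pre 1 E < ennreal e'" using assms e' by simp
  then obtain C where C: "E \<subseteq> (\<Union>n. C n)" "\<And>n. bounded (C n)" "(\<Sum>n. ennreal (diameter (C n))) < ennreal e'"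
    unfolding hausdorff1_pre_def INF_less_iff by auto
  define x where "x n = (if C n = {} then 0 else Im (c * (SOME z. z \<in> C n)))" for n
  define T where "T n = {x n - norm c * diameter (C n)..x n + norm c * diameter (C n)}" for n
  have d0: "diameter (C n) \<ge> 0" for n using C(2) diameter_ge_0 by blast
  have sub: "(\<lambda>z. Im (c * z)) ` E \<subseteq> (\<Union>n. T n)"
  proof safe
    fix z assume "z \<in> E"
    then obtain n where n: "z \<in> C n" using C(1) by auto
    define y where "y = (SOME z. z \<in> C n)"
    have "y \<in> C n" unfolding y_def using n by (rule someI)
    then have "norm (z - y) \<le> diameter (C n)"
      using diameter_bounded_bound[OF C(2) n, of y] by (simp add: dist_norm)
    then have "norm (c * (z - y)) \<le> norm c * diameter (C n)"
      by (simp add: norm_mult mult_left_mono)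
    then have "\<bar>Im (c * (z - y))\<bar> \<le> norm c * diameter (C n)"
      using abs_Im_le_cmod order_trans by blast
    moreover have "x n = Im (c * y)" using n by (auto simp: x_def y_def)
    moreover have "Im (c * (z - y)) = Im (c * z) - Im (c * y)" by (simp add: algebra_simps)
    ultimately have "Im (c * z) \<in> T n" by (auto simp: T_def abs_le_iff)
    then show "Im (c * z) \<in> (\<Union>n. T n)" by blast
  qed
  have "emeasure lebesgue (\<Union>n. T n) \<le> (\<Sum>n. emeasure lebesgue (T n))"
    by (rule emeasure_subadditive_countably) (auto simp: T_def)
  also have "\<dots> = (\<Sum>n. ennreal (2 * norm c) * ennreal (diameter (C n)))"
    using d0 by (intro suminf_cong) (simp add: T_def ennreal_mult'[symmetric] algebra_simps)
  also have "\<dots> = ennreal (2 * norm c) * (\<Sum>n. ennreal (diameter (C n)))" by simp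
  also have "\<dots> \<le> ennreal (2 * norm c) * ennreal e'"
    using C(3) by (intro mult_left_mono) auto
  also have "\<dots> = ennreal (2 * norm c * e')" using e' by (simp add: ennreal_mult)
  also have "\<dots> < ennreal e"
  proof -
    have "norm c / (norm c + 1) < 2" by (simp add: divide_less_eq add_nonneg_pos)
    then have "2 * norm c * e' < e" using e by (simp add: e'_def divide_less_eq field_simps add_pos_nonneg)
    then show ?thesis using e by (simp add: ennreal_lessI)
  qed
  finally have m: "emeasure lebesgue (\<Union>n. T n) < ennreal e" .
  have "(\<Union>n. T n) \<in> sets lebesgue" by (auto simp: T_def)
  then have lm: "(\<Union>n. T n) \<in> lmeasurable" using m by (auto simp: fmeasurable_def less_top top.extremum_strict dest: less_trans[OF _ ennreal_less_top])
  have "measure lebesgue (\<Union>n. T n) < e"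
    using m lm e by (simp add: emeasure_eq_measure2 ennreal_less_iff)
  with sub lm show "\<exists>T. (\<lambda>z. Im (c * z)) ` E \<subseteq> T \<and> T \<in> lmeasurable \<and> measure lebesgue T < e" by blast
qed

section \<open>The pieces of a canonical decomposition\<close>

text \<open>Multiplying by \<open>cnj (g y)\<close> rotates the value at \<open>y\<close> onto the
  positive axis; the real part stays positive near \<open>y\<close>, and a bump supported there
  detects it.\<close>

lemma continuous_zero_of_weak_zero:
  assumes W: "open W" and g: "continuous_on W g" and weak: "\<And>\<psi>. test_fun \<psi> W \<Longrightarrow> pair g \<psi> = 0" and y: "y \<in> W"
  shows "g y = 0"
proof (rule ccontr)
  assume gy: "g y \<noteq> 0"
  define u where "u z = Re (cnj (g y) * g z)" for z
  have cu: "continuous_on W u" unfolding u_def using g by (intro continuous_intros)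
  have uy: "u y > 0" using gy by (simp add: u_def complex_neq_0 power2_eq_square)
  define W' where "W' = W \<inter> u -` {0<..}"
  have W': "open W'" "y \<in> W'" "W' \<subseteq> W"
    using continuous_open_preimage[OF cu W, of "{0<..}"] y uy by (auto simp: W'_def)
  obtain \<psi> where \<psi>: "test_fun \<psi> W'" "\<And>z. \<psi> z \<ge> 0" "\<psi> y > 0"
    using exists_local_bump[OF W'(1,2)] by metis
  have t: "test_fun \<psi> W" using test_fun_mono[OF \<psi>(1) W'(3)] .
  have i: "integrable lebesgue (\<lambda>z. g z * complex_of_real (\<psi> z))"
    using test_fun_integrable(1)[OF continuous_loc_integrable[OF g] t] .
  have i2: "integrable lebesgue (\<lambda>z. u z * \<psi> z)"
    using integrable_Re[OF integrable_mult_right[OF i, of "cnj (g y)"]] by (simp add: u_def algebra_simps)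
  have "Re (cnj (g y) * pair g \<psi>) = (LINT z|lebesgue. Re (cnj (g y) * (g z * complex_of_real (\<psi> z))))"
    unfolding pair_def using i by (subst integral_mult_right_zero[symmetric], subst integral_Re) auto
  also have "\<dots> = (LINT z|lebesgue. u z * \<psi> z)" by (simp add: u_def algebra_simps)
  finally have I0: "(LINT z|lebesgue. u z * \<psi> z) = 0" using weak[OF t] by simp
  have nn: "0 \<le> u z * \<psi> z" for z
  proof (cases "z \<in> W'")
    case True then show ?thesis using \<psi>(2)[of z] by (auto simp: W'_def)
  next
    case False
    then have "z \<notin> tsupport \<psi>" using \<psi>(1) by (auto simp: test_fun_def)
    then show ?thesis by (simp add: tsupport_zero)
  qed
  have "AE z in lebesgue. u z * \<psi> z = 0"
    using I0 integral_nonneg_eq_0_iff_AE[OF i2] nn by auto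
  then have "AE z in lebesgue. z \<notin> W' \<inter> {z. \<psi> z > 0}"
    by eventually_elim (auto simp: W'_def)
  moreover have "open (W' \<inter> {z. \<psi> z > 0})"
    using W'(1) test_fun_continuous(1)[OF \<psi>(1)] by (intro open_Int open_Collect_less continuous_intros) auto
  ultimately have "W' \<inter> {z. \<psi> z > 0} = {}" by (rule AE_lebesgue_not_open)
  with W'(2) \<psi>(3) show False by auto
qed

text \<open>Moving \<open>z\<close> by \<open>\<i> s v\<close>, across the direction
  \<open>v\<close>, shifts \<open>Im (z / v)\<close> by exactly \<open>s\<close>, so this coordinate
  fills an interval, which a null set cannot cover.\<close>

lemma generic_translate:
  fixes P :: "real set"
  assumes "negligible P" "e > 0" "v \<noteq> 0"
  obtains z' where "z' \<in> ball z e" "Im (z' / v) \<notin> P"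
proof -
  define d where "d = e / norm v"
  have d: "d > 0" using assms by (simp add: d_def)
  have "\<not> {Im (z / v) - d<..<Im (z / v) + d} \<subseteq> P"
  proof
    assume "{Im (z / v) - d<..<Im (z / v) + d} \<subseteq> P"
    then have "negligible {Im (z / v) - d<..<Im (z / v) + d}" using assms(1) negligible_subset by blast
    moreover have "{Im (z / v) - d<..<Im (z / v) + d} \<noteq> {}" using d by auto
    ultimately show False using open_not_negligible[OF open_greaterThanLessThan] by blast
  qed
  then obtain x where x: "x \<in> {Im (z / v) - d<..<Im (z / v) + d}" "x \<notin> P" by blast
  define s where "s = x - Im (z / v)"
  have "\<bar>s\<bar> < d" using x by (auto simp: s_def)
  define z' where "z' = z + \<i> * of_real s * v"
  have "norm (\<i> * of_real s * v) < e"
    using \<open>\<bar>s\<bar> < d\<close> assms by (simp add: norm_mult d_def field_simps)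
  then have "z' \<in> ball z e" by (simp add: z'_def dist_norm)
  moreover have "z' / v = z / v + \<i> * of_real s" using assms by (simp add: z'_def field_simps)
  then have "Im (z' / v) = x" by (simp add: s_def)
  ultimately show ?thesis using x(2) that by blast
qed

section \<open>Standing hypotheses and the geometry of the pieces\<close>

locale piecewise_analytic =
  fixes U :: "complex set" and \<Phi> :: "complex \<Rightarrow> complex" and r :: nat
    and A :: "nat \<Rightarrow> complex \<Rightarrow> complex" and M :: "nat \<Rightarrow> complex set"
  assumes open_U: "open U" and connected_U: "connected U"
    and canon: "canonical_data U \<Phi> r A M"
    and sum_rep: "AE z in lebesgue. z \<in> U \<longrightarrow> \<Phi> z = (\<Sum>i\<in>{1..r}. A i z * indicator (M i) z)"
    and Sigma: "\<Phi> \<in> Sigma_cls U"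
    and triple_null: "\<forall>j k l. 1 \<le> j \<and> j < k \<and> k < l \<and> l \<le> r \<longrightarrow>
                  hausdorff1 (U \<inter> frontier (M j) \<inter> frontier (M k) \<inter> frontier (M l)) = 0"
begin

lemma loc_Phi: "loc_integrable U \<Phi>"
  using canon by (simp add: canonical_data_def)

lemma A_holomorphic: "i \<in> {1..r} \<Longrightarrow> A i holomorphic_on U"
  using canon by (auto simp: canonical_data_def intro: analytic_imp_holomorphic)

lemma A_continuous: "i \<in> {1..r} \<Longrightarrow> continuous_on U (A i)"
  by (intro holomorphic_on_imp_continuous_on A_holomorphic)

lemma M_eq: "i \<in> {1..r} \<Longrightarrow> M i = {x \<in> U. \<exists>W. open W \<and> x \<in> W \<and> W \<subseteq> U \<and>
    (\<forall>\<psi>. test_fun \<psi> W \<longrightarrow> pair (\<lambda>z. \<Phi> z - A i z) \<psi> = 0)}"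
  using canon unfolding canonical_data_def dist_supp_def by blast

lemma M_subset: "i \<in> {1..r} \<Longrightarrow> M i \<subseteq> U"
  by (auto simp: M_eq)

lemma open_M:
  assumes "i \<in> {1..r}"
  shows "open (M i)"
proof (subst open_subopen, safe)
  fix x assume "x \<in> M i"
  then obtain W where W: "open W" "x \<in> W" "W \<subseteq> U" "\<forall>\<psi>. test_fun \<psi> W \<longrightarrow> pair (\<lambda>z. \<Phi> z - A i z) \<psi> = 0"
    unfolding M_eq[OF assms] by blast
  then have "W \<subseteq> M i" unfolding M_eq[OF assms] by blast
  with W show "\<exists>T. open T \<and> x \<in> T \<and> T \<subseteq> M i" by blast
qed

lemma M_superset:
  assumes i: "i \<in> {1..r}" and D: "open D" "D \<subseteq> U" and ae: "AE z in lebesgue. z \<in> D \<longrightarrow> \<Phi> z = A i z"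
  shows "D \<subseteq> M i"
proof -
  have "pair (\<lambda>z. \<Phi> z - A i z) \<psi> = 0" if "test_fun \<psi> D" for \<psi>
  proof -
    have "AE z in lebesgue. (\<Phi> z - A i z) * complex_of_real (\<psi> z) = 0"
      using ae
    proof eventually_elim
      case (elim z)
      then show ?case using that tsupport_zero[of z \<psi>] by (cases "z \<in> D") (auto simp: test_fun_def)
    qed
    then show ?thesis unfolding pair_def by (rule integral_eq_zero_AE)
  qed
  with D show ?thesis unfolding M_eq[OF i] by blast
qed

text \<open>On a common open set both branches agree weakly with \<open>\<Phi>\<close>, hence with
  each other pointwise by continuity, and then on all of \<open>U\<close> by the identity theorem;
  the branches are pairwise distinct.\<close>

lemma M_disjoint:
  assumes ij: "i \<in> {1..r}" "j \<in> {1..r}" "i \<noteq> j"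
  shows "M i \<inter> M j = {}"
proof (rule ccontr)
  assume "M i \<inter> M j \<noteq> {}"
  then obtain x where x: "x \<in> M i" "x \<in> M j" by blast
  obtain W1 where W1: "open W1" "x \<in> W1" "W1 \<subseteq> U" "\<And>\<psi>. test_fun \<psi> W1 \<Longrightarrow> pair (\<lambda>z. \<Phi> z - A i z) \<psi> = 0"
    using x(1) unfolding M_eq[OF ij(1)] by blast
  obtain W2 where W2: "open W2" "x \<in> W2" "W2 \<subseteq> U" "\<And>\<psi>. test_fun \<psi> W2 \<Longrightarrow> pair (\<lambda>z. \<Phi> z - A j z) \<psi> = 0"
    using x(2) unfolding M_eq[OF ij(2)] by blast
  define W where "W = W1 \<inter> W2"
  have W: "open W" "x \<in> W" "W \<subseteq> U" using W1 W2 by (auto simp: W_def)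
  have eq: "A i z = A j z" if "z \<in> W" for z
  proof -
    have "A i z - A j z = 0"
    proof (rule continuous_zero_of_weak_zero[OF W(1) _ _ that])
      show "continuous_on W (\<lambda>z. A i z - A j z)"
        using A_continuous[OF ij(1)] A_continuous[OF ij(2)] W(3)
        by (intro continuous_intros) (auto intro: continuous_on_subset)
      fix \<psi> assume \<psi>: "test_fun \<psi> W"
      have tU: "test_fun \<psi> U" "test_fun \<psi> W1" "test_fun \<psi> W2"
        using test_fun_mono[OF \<psi>] W(3) by (auto simp: W_def)
      have int: "integrable lebesgue (\<lambda>z. (\<Phi> z - A k z) * complex_of_real (\<psi> z))" if "k \<in> {1..r}" for k
        using test_fun_integrable(1)[OF loc_Phi tU(1)]
          test_fun_integrable(1)[OF continuous_loc_integrable[OF A_continuous[OF that]] tU(1)]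
        by (simp add: left_diff_distrib)
      have "pair (\<lambda>z. A i z - A j z) \<psi> = pair (\<lambda>z. \<Phi> z - A j z) \<psi> - pair (\<lambda>z. \<Phi> z - A i z) \<psi>"
        unfolding pair_def by (subst Bochner_Integration.integral_diff[symmetric, OF int[OF ij(2)] int[OF ij(1)]])
          (simp add: algebra_simps)
      then show "pair (\<lambda>z. A i z - A j z) \<psi> = 0" using W1(4) W2(4) tU by simp
    qed
    then show ?thesis by simp
  qed
  have "A i z = A j z" if "z \<in> U" for z
    by (rule analytic_continuation_open[OF W(1) open_U _ connected_U W(3) A_holomorphic[OF ij(1)] A_holomorphic[OF ij(2)] eq that])
      (use W(2) in auto)
  moreover have "\<exists>z\<in>U. A i z \<noteq> A j z" using canon ij unfolding canonical_data_def by blast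
  ultimately show False by blast
qed

lemma AE_Phi: "AE z in lebesgue. z \<in> U \<longrightarrow> (\<exists>i\<in>{1..r}. z \<in> M i) \<and> (\<forall>i\<in>{1..r}. z \<in> M i \<longrightarrow> \<Phi> z = A i z)"
proof -
  have "U - (\<Union>i\<in>{1..r}. M i) \<in> null_sets lebesgue"
    using canon unfolding canonical_data_def by blast
  then have "AE z in lebesgue. z \<notin> U - (\<Union>i\<in>{1..r}. M i)" by (rule AE_not_in)
  then show ?thesis using sum_rep
  proof eventually_elim
    case (elim z)
    have "\<Phi> z = A i z" if "z \<in> U" "i \<in> {1..r}" "z \<in> M i" for i
    proof -
      have "\<Phi> z = (\<Sum>j\<in>{1..r}. A j z * indicator (M j) z)" using elim that by blast
      also have "\<dots> = (\<Sum>j\<in>{1..r}. if j = i then A i z else 0)"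
      proof (intro sum.cong refl)
        fix j assume "j \<in> {1..r}"
        then have "z \<notin> M j" if "j \<noteq> i" using M_disjoint[OF _ \<open>i \<in> {1..r}\<close> that] \<open>z \<in> M i\<close> by blast
        then show "A j z * indicator (M j) z = (if j = i then A i z else 0)" using \<open>z \<in> M i\<close> by auto
      qed
      also have "\<dots> = A i z" using that by simp
      finally show ?thesis .
    qed
    with elim show ?case by blast
  qed
qed

text \<open>\<open>M i\<close> is the largest open set on which \<open>\<Phi>\<close> is represented
  by \<open>A i\<close>. This saturation turns conclusions that hold almost everywhere into honest
  membership.\<close>

lemma M_fill:
  assumes "i \<in> {1..r}" "open D" "D \<subseteq> U" "AE z in lebesgue. z \<in> D \<longrightarrow> z \<in> M i"
  shows "D \<subseteq> M i"
proof (rule M_superset[OF assms(1-3)])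
  show "AE z in lebesgue. z \<in> D \<longrightarrow> \<Phi> z = A i z"
    using AE_Phi assms(4) by eventually_elim (use assms(1,3) in blast)
qed

lemma M_fill_disjoint:
  assumes "i \<in> {1..r}" "open D" "D \<subseteq> U" "\<And>j. j \<in> {1..r} \<Longrightarrow> j \<noteq> i \<Longrightarrow> M j \<inter> D = {}"
  shows "D \<subseteq> M i"
proof (rule M_fill[OF assms(1-3)])
  show "AE z in lebesgue. z \<in> D \<longrightarrow> z \<in> M i"
    using AE_Phi by eventually_elim (use assms(3,4) in blast)
qed

text \<open>Removing the closures of the pieces not adherent at \<open>q\<close> leaves a disc
  containing almost only \<open>M k\<close> and at most one other piece \<open>M j\<close>. There
  \<open>\<Phi>\<close> is \<open>A j\<close> plus the jump times the indicator of
  \<open>M k\<close>, and \<open>indicator_up_closed\<close> applies.\<close>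

lemma local_absorbing:
  assumes k: "k \<in> {1..r}" and q: "q \<in> N" and N: "open N" "N \<subseteq> U"
    and pos: "\<forall>j\<in>{1..r} - {k}. M j \<inter> N \<noteq> {} \<longrightarrow> (\<forall>z\<in>N. Re ((A k z - A j z) * v) > 0)"
    and card: "card (Iset U r M q) \<le> 2"
  shows "\<exists>d>0. \<forall>y t. y \<in> M k \<inter> ball q d \<and> t \<ge> 0 \<and> y + of_real t * v \<in> ball q d \<longrightarrow> y + of_real t * v \<in> M k"
proof -
  let ?I = "Iset U r M q"
  have fin: "finite ?I" "?I \<subseteq> {1..r}" by (auto simp: Iset_def)
  define Q where "Q = N \<inter> (\<Inter>j\<in>{1..r} - ?I. - closure (M j))"
  have "open Q" unfolding Q_def using N by (intro open_Int open_INT) auto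
  moreover have "q \<in> Q" using q by (auto simp: Q_def Iset_def)
  ultimately obtain d where d: "d > 0" "ball q d \<subseteq> Q" using openE by blast
  define D where "D = ball q d"
  have D: "open D" "convex D" "D \<subseteq> N" "D \<subseteq> U" using d N by (auto simp: D_def Q_def)
  have out: "M j \<inter> D = {}" if "j \<in> {1..r}" "j \<notin> ?I" for j
    using d(2) that closure_subset[of "M j"] unfolding D_def Q_def by blast
  have "y + of_real t * v \<in> M k" if y: "y \<in> M k" "y \<in> D" "t \<ge> 0" "y + of_real t * v \<in> D" for y t
  proof -
    have kI: "k \<in> ?I" using out[OF k] y by blast
    show ?thesis
    proof (cases "?I = {k}")
      case True
      then have "D \<subseteq> M k" using out by (intro M_fill_disjoint[OF k D(1,4)]) auto
      then show ?thesis using y by blast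
    next
      case False
      then obtain j where j: "j \<in> ?I" "j \<noteq> k" using kI by blast
      have Ieq: "?I = {j, k}"
        using card_seteq[OF fin(1), of "{j, k}"] card j kI by auto
      have jr: "j \<in> {1..r}" using j fin by blast
      have "q \<in> closure (M j)" using j by (simp add: Iset_def)
      \<comment> \<open>The cone condition is assumed only for pieces meeting \<open>N\<close>;
        adherence at \<open>q\<close> guarantees this.\<close>
      then have "M j \<inter> N \<noteq> {}" using q N(1) by (metis Int_commute Int_emptyI disjoint_iff open_Int_closure_eq_empty)
      then have p: "Re ((A k z - A j z) * v) > 0" if "z \<in> D" for z
        using pos jr j(2) D(3) that by blast
      have hol: "A j holomorphic_on D" "A k holomorphic_on D"
        using A_holomorphic[OF jr] A_holomorphic[OF k] D(4) holomorphic_on_subset by blast+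
      have rep: "AE z in lebesgue. z \<in> D \<longrightarrow> \<Phi> z = A j z + (A k z - A j z) * indicator (M k) z"
        using AE_Phi
      proof eventually_elim
        case (elim z)
        show ?case
        proof
          assume zD: "z \<in> D"
          then obtain i where i: "i \<in> {1..r}" "z \<in> M i" "\<Phi> z = A i z" using elim D(4) by blast
          then have "i = j \<or> i = k" using out[OF i(1)] zD Ieq by blast
          moreover have "z \<notin> M k" if "i = j" using M_disjoint[OF jr k j(2)] i that by blast
          ultimately show "\<Phi> z = A j z + (A k z - A j z) * indicator (M k) z" using i by auto
        qed
      qed
      obtain N' where N': "open N'" "y + of_real t * v \<in> N'" "N' \<subseteq> D" "AE w in lebesgue. w \<in> N' \<longrightarrow> w \<in> M k"
        using indicator_up_closed[OF D(1,2,4) Sigma hol open_M[OF k] rep p y] by blast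
      then have "N' \<subseteq> M k" using D(4) by (intro M_fill[OF k]) auto
      with N' show ?thesis by blast
    qed
  qed
  with d(1) show ?thesis unfolding D_def by blast
qed

text \<open>A point adherent to two pieces lies in neither, because an open piece is disjoint from
  the closure of any other. Hence three adherent pieces mean three frontiers, and finitely many
  triples occur.\<close>

lemma triple_projection_null:
  "negligible ((\<lambda>z. Im (c * z)) ` {q \<in> U. card (Iset U r M q) > 2})"
proof -
  define X where "X = {(j, k, l). 1 \<le> j \<and> j < k \<and> k < l \<and> l \<le> r}"
  have "finite X" by (rule finite_subset[of _ "{1..r} \<times> {1..r} \<times> {1..r}"]) (auto simp: X_def)
  define T where "T = (\<lambda>(j, k, l). U \<inter> frontier (M j) \<inter> frontier (M k) \<inter> frontier (M l))"
  have sub: "{q \<in> U. card (Iset U r M q) > 2} \<subseteq> (\<Union>x\<in>X. T x)"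
  proof safe
    fix q assume q: "q \<in> U" "card (Iset U r M q) > 2"
    let ?I = "Iset U r M q"
    have fin: "finite ?I" by (simp add: Iset_def)
    have fr: "q \<in> frontier (M j)" if j: "j \<in> ?I" for j
    proof -
      have jr: "j \<in> {1..r}" "q \<in> closure (M j)" using j by (auto simp: Iset_def)
      have "q \<notin> M j"
      proof
        assume qj: "q \<in> M j"
        have "?I \<noteq> {j}" using q(2) by auto
        then obtain k where k: "k \<in> ?I" "k \<noteq> j" using j by blast
        then have kr: "k \<in> {1..r}" "q \<in> closure (M k)" by (auto simp: Iset_def)
        have "M j \<inter> closure (M k) = {}"
          using M_disjoint[OF jr(1) kr(1)] k(2) open_Int_closure_eq_empty[OF open_M[OF jr(1)]] by auto
        with qj kr show False by blast
      qed
      then show ?thesis using jr open_M[OF jr(1)] by (simp add: frontier_def interior_open)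
    qed
    obtain S where S: "S \<subseteq> ?I" "card S = 3" using obtain_subset_with_card_n[of 3 ?I] q(2) by (auto simp: Suc_le_eq)
    then obtain a b c where abc: "S = {a, b, c}" "a \<noteq> b" "b \<noteq> c" "a \<noteq> c"
      by (auto simp: card_3_iff)
    obtain j k l where jkl: "j \<in> ?I" "k \<in> ?I" "l \<in> ?I" "j < k" "k < l"
    proof -
      consider "a < b \<and> b < c" | "a < c \<and> c < b" | "b < a \<and> a < c" | "b < c \<and> c < a" | "c < a \<and> a < b" | "c < b \<and> b < a"
        using abc by linarith
      moreover have "a \<in> ?I" "b \<in> ?I" "c \<in> ?I" using S(1) abc(1) by auto
      ultimately show ?thesis using that by cases blast+
    qed
    then have "(j, k, l) \<in> X" by (auto simp: X_def Iset_def)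
    moreover have "q \<in> T (j, k, l)" using q fr jkl by (auto simp: T_def)
    ultimately show "q \<in> (\<Union>x\<in>X. T x)" by blast
  qed
  have "negligible (\<Union>x\<in>X. (\<lambda>z. Im (c * z)) ` T x)"
  proof (rule negligible_Union)
    show "finite ((\<lambda>x. (\<lambda>z. Im (c * z)) ` T x) ` X)" using \<open>finite X\<close> by simp
    fix t assume "t \<in> (\<lambda>x. (\<lambda>z. Im (c * z)) ` T x) ` X"
    then obtain j k l where "t = (\<lambda>z. Im (c * z)) ` T (j, k, l)" "(j, k, l) \<in> X" by auto
    then show "negligible t"
      using triple_null hausdorff1_zero_projection[of "T (j, k, l)" c] by (auto simp: T_def X_def)
  qed
  then show ?thesis by (rule negligible_subset) (use sub in blast)
qed

text \<open>On a line in direction \<open>v\<close> without triple points, the local statement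
  propagates along the whole segment. Lines through triple points are reached by perturbing the
  start within the open set \<open>M k\<close> and then filling the disc around
  \<open>z + v\<close>.\<close>

lemma absorbing:
  assumes k: "k \<in> {1..r}" and N: "open N" "convex N" "N \<subseteq> U"
    and pos: "\<forall>j\<in>{1..r} - {k}. M j \<inter> N \<noteq> {} \<longrightarrow> (\<forall>z\<in>N. Re ((A k z - A j z) * v) > 0)"
    and z: "z \<in> M k" "z \<in> N" "z + v \<in> N"
  shows "z + v \<in> M k"
proof (cases "v = 0")
  case v: False
  define P where "P = (\<lambda>z. Im (1 / v * z)) ` {q \<in> U. card (Iset U r M q) > 2}"
  have P: "negligible P" unfolding P_def by (rule triple_projection_null)
  obtain e1 where e1: "e1 > 0" "ball z e1 \<subseteq> M k \<inter> N"
    using z openE[of "M k \<inter> N" z] open_M[OF k] N(1) by blast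
  obtain e2 where e2: "e2 > 0" "ball (z + v) e2 \<subseteq> N" using z openE[OF N(1), of "z + v"] by blast
  define e where "e = min e1 e2"
  have e: "e > 0" "ball z e \<subseteq> M k" "ball z e \<subseteq> N" "ball (z + v) e \<subseteq> N"
    using e1 e2 by (auto simp: e_def)
  have line: "y + v \<in> M k" if y: "y \<in> ball z e" "Im (y / v) \<notin> P" for y
  proof -
    have "y + v \<in> ball (z + v) e" using y(1) by (simp add: dist_norm)
    then have yN: "y \<in> N" "y + v \<in> N" using y(1) e by blast+
    have seg: "y + of_real x * v \<in> N" if "0 \<le> x" "x \<le> 1" for x :: real
    proof -
      have "(1 - x) *\<^sub>R y + x *\<^sub>R (y + v) \<in> N" using that yN N(2) by (intro convexD) auto
      then show ?thesis by (simp add: algebra_simps scaleR_conv_of_real)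
    qed
    have "(0 :: real) \<le> 1" by simp
    then have "y + of_real 0 * v \<in> M k \<longrightarrow> y + of_real 1 * v \<in> M k"
    \<comment> \<open>The implication from parameter \<open>a\<close> to parameter \<open>b\<close>
      is transitive and holds on short intervals around every parameter, so bisection gives it from
      0 to 1.\<close>
    proof (induction rule: Bolzano[where P = "\<lambda>a b. y + of_real a * v \<in> M k \<longrightarrow> y + of_real b * v \<in> M k"])
      case (trans a b c)
      then show ?case by blast
    next
      case (local x)
      let ?q = "y + of_real x * v"
      have q: "?q \<in> N" using seg local by blast
      have "Im (1 / v * ?q) = Im (y / v)" using v by (simp add: add_divide_distrib)
      then have "Im (1 / v * ?q) \<notin> P" using y(2) by simp
      then have "card (Iset U r M ?q) \<le> 2" using q N(3) unfolding P_def by (auto simp: not_less[symmetric])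
      from local_absorbing[OF k q N(1,3) pos this]
      obtain d where d: "d > 0" "\<forall>y' t. y' \<in> M k \<inter> ball ?q d \<and> t \<ge> 0 \<and> y' + of_real t * v \<in> ball ?q d \<longrightarrow> y' + of_real t * v \<in> M k"
        by blast
      show ?case
      proof (intro exI[of _ "d / norm v"] conjI allI impI)
        show "d / norm v > 0" using d v by simp
        fix a b :: real assume ab: "a \<le> x \<and> x \<le> b \<and> b - a < d / norm v" and a: "y + of_real a * v \<in> M k"
        have nb: "y + of_real s * v \<in> ball ?q d" if "\<bar>x - s\<bar> < d / norm v" for s
        proof -
          have "norm (of_real (x - s) * v) < d" using that v by (simp add: norm_mult field_simps del: of_real_diff)
          then show ?thesis by (simp add: dist_norm algebra_simps)
        qed
        have "y + of_real a * v \<in> ball ?q d" "y + of_real b * v \<in> ball ?q d"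
          using ab by (auto intro!: nb simp del: mem_ball)
        moreover have eq: "(y + of_real a * v) + of_real (b - a) * v = y + of_real b * v" by (simp add: algebra_simps)
        ultimately show "y + of_real b * v \<in> M k"
          using d(2)[rule_format, of "y + of_real a * v" "b - a"] a ab unfolding eq by auto
      qed
    qed
    then show ?thesis using y(1) e(2) by auto
  qed
  \<comment> \<open>Only points on generic lines are known to be in \<open>M k\<close>. That
    suffices: another open piece meeting the disc would also contain a point on a generic
    line.\<close>
  have "M j \<inter> ball (z + v) e = {}" if j: "j \<in> {1..r}" "j \<noteq> k" for j
  proof (rule ccontr)
    assume "M j \<inter> ball (z + v) e \<noteq> {}"
    then obtain w where w: "w \<in> M j \<inter> ball (z + v) e" by blast
    then obtain e' where e': "e' > 0" "ball w e' \<subseteq> M j \<inter> ball (z + v) e"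
      using openE[of "M j \<inter> ball (z + v) e" w] open_M[OF j(1)] by blast
    obtain y where y: "y \<in> ball (w - v) e'" "Im (y / v) \<notin> P"
      using generic_translate[OF P e'(1) v] by blast
    have "y + v \<in> ball w e'" using y(1) by (simp add: dist_norm algebra_simps)
    then have yj: "y + v \<in> M j" "y + v \<in> ball (z + v) e" using e' by blast+
    then have "y \<in> ball z e" by (simp add: dist_norm)
    then have "y + v \<in> M k" using line y(2) by blast
    with yj(1) M_disjoint[OF j(1) k j(2)] show False by blast
  qed
  then have "ball (z + v) e \<subseteq> M k" using e N(3) by (intro M_fill_disjoint[OF k]) auto
  then show ?thesis using e(1) by auto
qed (use z in simp)

end

section \<open>Mollified potentials\<close>

text \<open>Dominated convergence for the normalised first-order remainder along sequences. The mean
  value bound for \<open>H w\<close> and the bound for its derivative each contribute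
  \<open>L\<close>, which gives the dominating function
  \<open>2 * L * \<bar>g w\<bar>\<close>.\<close>

lemma has_derivative_integral_parameter:
  fixes g :: "complex \<Rightarrow> real" and H :: "complex \<Rightarrow> complex \<Rightarrow> real"
  assumes g: "integrable lebesgue g"
    and H: "\<And>z. (\<lambda>w. H w z) \<in> borel_measurable lebesgue" "\<And>w z. \<bar>H w z\<bar> \<le> C"
    and der: "\<And>w z. (H w has_derivative H' w z) (at z)"
    and bnd: "\<And>w z h. \<bar>H' w z h\<bar> \<le> L * norm h"
    and meas: "\<And>z h. (\<lambda>w. H' w z h) \<in> borel_measurable lebesgue"
  shows "((\<lambda>z. LINT w|lebesgue. g w * H w z) has_derivative (\<lambda>h. LINT w|lebesgue. g w * H' w z h)) (at z)"
proof -
  have gm: "g \<in> borel_measurable lebesgue" using g by auto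
  have iB: "integrable lebesgue (\<lambda>w. g w * k w)"
    if "k \<in> borel_measurable lebesgue" "\<And>w. \<bar>k w\<bar> \<le> B" for k B
  proof (rule Bochner_Integration.integrable_bound)
    show "integrable lebesgue (\<lambda>w. B * g w)" using g by simp
    show "AE w in lebesgue. norm (g w * k w) \<le> norm (B * g w)"
    proof (intro AE_I2)
      fix w
      have "\<bar>k w\<bar> * \<bar>g w\<bar> \<le> \<bar>B\<bar> * \<bar>g w\<bar>" using that(2)[of w] by (intro mult_right_mono) auto
      then show "norm (g w * k w) \<le> norm (B * g w)" by (simp add: abs_mult mult.commute)
    qed
  qed (use gm that(1) in auto)
  have iH: "integrable lebesgue (\<lambda>w. g w * H w z)" for z by (rule iB[OF H])
  have iH': "integrable lebesgue (\<lambda>w. g w * H' w z h)" for z h by (rule iB[OF meas bnd])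
  have lin: "linear (H' w z)" for w z using der has_derivative_linear by blast
  have bl: "bounded_linear (\<lambda>h. LINT w|lebesgue. g w * H' w z h)"
  proof (rule bounded_linear_intro)
    show "(LINT w|lebesgue. g w * H' w z (x + y)) =
        (LINT w|lebesgue. g w * H' w z x) + (LINT w|lebesgue. g w * H' w z y)" for x y
      by (simp add: linear_add[OF lin] distrib_left iH')
    show "(LINT w|lebesgue. g w * H' w z (s *\<^sub>R x)) = s *\<^sub>R (LINT w|lebesgue. g w * H' w z x)" for s x
      by (simp add: linear_cmul[OF lin] mult.left_commute)
    show "norm (LINT w|lebesgue. g w * H' w z x) \<le> norm x * (\<bar>L\<bar> * (LINT w|lebesgue. \<bar>g w\<bar>))" for x
    proof -
      have "norm (LINT w|lebesgue. g w * H' w z x) \<le> (LINT w|lebesgue. norm (g w * H' w z x))"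
        by (rule integral_norm_bound)
      also have "\<dots> \<le> (LINT w|lebesgue. (\<bar>L\<bar> * norm x) * \<bar>g w\<bar>)"
      proof (rule integral_mono)
        show "norm (g w * H' w z x) \<le> (\<bar>L\<bar> * norm x) * \<bar>g w\<bar>" for w
        proof -
          have "\<bar>H' w z x\<bar> \<le> \<bar>L\<bar> * norm x"
            using bnd[of w z x] mult_right_mono[OF abs_ge_self[of L] norm_ge_zero[of x]] by linarith
          then show ?thesis by (simp add: abs_mult mult.commute mult_left_mono)
        qed
      qed (use iH' g in auto)
      finally show ?thesis by (simp add: mult_ac)
    qed
  qed
  have "((\<lambda>y. norm ((LINT w|lebesgue. g w * H w y) - (LINT w|lebesgue. g w * H w z)
      - (LINT w|lebesgue. g w * H' w z (y - z))) / norm (y - z)) \<longlongrightarrow> 0) (at z)"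
    unfolding tendsto_at_iff_sequentially comp_def
  proof (intro allI impI)
    fix X :: "nat \<Rightarrow> complex" assume X: "\<forall>i. X i \<in> UNIV - {z}" "X \<longlonglongrightarrow> z"
    define q where "q n w = g w * ((H w (X n) - H w z - H' w z (X n - z)) / norm (X n - z))" for n w
    have "(\<lambda>n. LINT w|lebesgue. q n w) \<longlonglongrightarrow> integral\<^sup>L lebesgue (\<lambda>w :: complex. 0 :: real)"
    proof (rule integral_dominated_convergence[where w = "\<lambda>w. (2 * L) * \<bar>g w\<bar>"])
      show "q n \<in> borel_measurable lebesgue" for n
        unfolding q_def using gm H(1) meas by measurable
      show "integrable lebesgue (\<lambda>w. 2 * L * \<bar>g w\<bar>)" using g by simp
      show "AE w in lebesgue. norm (q n w) \<le> 2 * L * \<bar>g w\<bar>" for n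
      proof (intro AE_I2)
        fix w
        have "norm (H w (X n) - H w z) \<le> L * norm (X n - z)"
          by (rule differentiable_bound[of UNIV "H w" "H' w"])
            (use der bnd in \<open>auto intro!: onorm_le\<close>)
        with bnd[of w z "X n - z"] have "\<bar>H w (X n) - H w z - H' w z (X n - z)\<bar> \<le> 2 * L * norm (X n - z)"
          by simp
        moreover have "norm (X n - z) > 0" using X(1) by simp
        ultimately have "\<bar>(H w (X n) - H w z - H' w z (X n - z)) / norm (X n - z)\<bar> \<le> 2 * L"
          by (simp add: divide_le_eq)
        then have "\<bar>g w\<bar> * \<bar>(H w (X n) - H w z - H' w z (X n - z)) / norm (X n - z)\<bar> \<le> \<bar>g w\<bar> * (2 * L)"
          by (rule mult_left_mono) simp
        then show "norm (q n w) \<le> 2 * L * \<bar>g w\<bar>" unfolding q_def real_norm_def abs_mult[of "g w"] by (simp only: mult.commute)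
      qed
      show "AE w in lebesgue. (\<lambda>n. q n w) \<longlonglongrightarrow> 0"
      proof (intro AE_I2)
        fix w
        have "((\<lambda>y. norm (H w y - H w z - H' w z (y - z)) / norm (y - z)) \<longlongrightarrow> 0) (at z)"
          using der[of w z] unfolding has_derivative_iff_norm by blast
        then have "(\<lambda>n. norm (H w (X n) - H w z - H' w z (X n - z)) / norm (X n - z)) \<longlonglongrightarrow> 0"
          using X unfolding tendsto_at_iff_sequentially comp_def by blast
        then have "(\<lambda>n. (H w (X n) - H w z - H' w z (X n - z)) / norm (X n - z)) \<longlonglongrightarrow> 0"
          by (intro tendsto_norm_zero_cancel[of "\<lambda>n. (H w (X n) - H w z - H' w z (X n - z)) / norm (X n - z)"]) simp
        from tendsto_mult_left[OF this, of "g w"] show "(\<lambda>n. q n w) \<longlonglongrightarrow> 0" by (simp add: q_def)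
      qed
    qed simp
    then have "(\<lambda>n. LINT w|lebesgue. q n w) \<longlonglongrightarrow> 0" by simp
    then have "(\<lambda>n. norm (LINT w|lebesgue. q n w)) \<longlonglongrightarrow> 0" by (rule tendsto_norm_zero)
    moreover have "(LINT w|lebesgue. q n w) = ((LINT w|lebesgue. g w * H w (X n)) - (LINT w|lebesgue. g w * H w z)
      - (LINT w|lebesgue. g w * H' w z (X n - z))) / norm (X n - z)" for n
      unfolding q_def using iH iH' by (simp add: right_diff_distrib diff_divide_distrib)
    ultimately show "(\<lambda>n. norm ((LINT w|lebesgue. g w * H w (X n)) - (LINT w|lebesgue. g w * H w z)
      - (LINT w|lebesgue. g w * H' w z (X n - z))) / norm (X n - z)) \<longlonglongrightarrow> 0"
      by (simp add: norm_divide)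
  qed
  with bl show ?thesis unfolding has_derivative_iff_norm by blast
qed

lemma bump_derivative_bounded:
  "\<exists>\<beta>' B. (\<forall>x. (bump e has_real_derivative \<beta>' x) (at x)) \<and> continuous_on UNIV \<beta>' \<and>
    (\<forall>x. \<bar>\<beta>' x\<bar> \<le> B) \<and> (\<forall>x. \<bar>x\<bar> > e \<longrightarrow> \<beta>' x = 0)"
proof -
  obtain \<beta>' where b: "\<And>x. (bump e has_real_derivative \<beta>' x) (at x)" "Ck_real 1 \<beta>'"
    using Ck_real_bump[of "Suc 1" e] unfolding Ck_real.simps(2) by blast
  have c: "continuous_on A \<beta>'" for A using Ck_real_continuous[OF b(2)] continuous_on_subset by blast
  have z: "\<beta>' x = 0" if x: "\<bar>x\<bar> > e" for x
  proof -
    have "\<forall>\<^sub>F y in nhds x. (\<lambda>_. 0) y = bump e y"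
      using eventually_nhds_in_open[of "{y. \<bar>y\<bar> > e}" x] x
      by (auto simp: open_Collect_less continuous_intros bump_eq_0_iff elim!: eventually_mono)
    then have "(bump e has_real_derivative 0) (at x)"
      using DERIV_cong_ev[OF refl _ refl, of "\<lambda>_. 0" "bump e" x] DERIV_const by blast
    then show ?thesis using b(1) DERIV_unique by blast
  qed
  have "compact (\<beta>' ` {- e..e})" by (intro compact_continuous_image c) simp
  then obtain B where B: "\<And>x. x \<in> {- e..e} \<Longrightarrow> \<bar>\<beta>' x\<bar> \<le> B"
    using compact_imp_bounded bounded_iff by (metis imageI real_norm_def)
  have "\<bar>\<beta>' x\<bar> \<le> \<bar>B\<bar>" for x
  proof (cases "x \<in> {- e..e}")
    case False
    then have "\<bar>x\<bar> > e" by auto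
    then show ?thesis using z by simp
  qed (use B in fastforce)
  then show ?thesis using b(1) c z by blast
qed


lemma integrable_complex_iff:
  fixes u :: "complex \<Rightarrow> complex"
  shows "integrable M u \<longleftrightarrow> integrable M (\<lambda>w. Re (u w)) \<and> integrable M (\<lambda>w. Im (u w))"
proof
  assume "integrable M (\<lambda>w. Re (u w)) \<and> integrable M (\<lambda>w. Im (u w))"
  then have "integrable M (\<lambda>w. complex_of_real (Re (u w)) + \<i> * complex_of_real (Im (u w)))" by simp
  then show "integrable M u" by (simp flip: complex_eq)
qed simp

lemma step_bounded: "\<bar>step e x\<bar> \<le> \<bar>step e e\<bar>"
proof -
  have nn: "step e y \<ge> 0" for y
    using step_mono[of "min y (- e)" y e] step_left[of "min y (- e)" e] by auto
  have "step e x \<le> step e e"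
    by (cases "x \<le> e") (use step_mono step_right[of e x e] in auto)
  then show ?thesis using nn[of x] by auto
qed

lemma continuous_on_real_Re_Im:
  fixes F G :: "real \<Rightarrow> real"
  assumes "continuous_on UNIV F" "continuous_on UNIV G"
  shows "continuous_on UNIV (\<lambda>w. F (Re w - x) * G (Im w - y))"
  by (intro continuous_intros continuous_on_compose2[OF assms(1)] continuous_on_compose2[OF assms(2)]) auto

text \<open>The mollifier is a product of one-dimensional bumps, so the path integral of the mollified
  function along a horizontal and a vertical segment is explicit; the vanishing of
  \<open>Im (d\<Phi>/d zbar)\<close> on the product test function below is the path independence.\<close>

lemma mollified_closed:
  assumes Sigma: "\<Phi> \<in> Sigma_cls U" and b: "\<And>x. (bump e has_real_derivative \<beta>' x) (at x)"
    and U: "\<And>w. \<bar>Re w - x\<bar> \<le> e \<Longrightarrow> Im w \<in> {min y1 y2 - e..max y1 y2 + e} \<Longrightarrow> w \<in> U"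
  shows "Im (LINT w|lebesgue. \<Phi> w * Complex (\<beta>' (Re w - x) * (step e (Im w - y1) - step e (Im w - y2)))
    (bump e (Re w - x) * (bump e (Im w - y1) - bump e (Im w - y2)))) = 0"
  using U
\<comment> \<open>Only for \<open>y1 <= y2\<close> is the plateau \<open>G\<close> nonnegative, as
  positivity testing demands; exchanging the two merely flips the sign of the integrand. The
  displayed \<open>Complex\<close> factor is \<open>2 * dzbar \<psi>\<close>.\<close>
proof (induction y1 y2 rule: linorder_wlog)
  case (le y1 y2)
  define F where "F t = bump e (1 * t + (- x))" for t
  define G where "G t = step e (1 * t + (- y1)) + (- 1) * step e (1 * t + (- y2))" for t
  have CF: "Ck_real n F" for n
    unfolding F_def by (intro Ck_real_affine Ck_real_bump)
  have CG: "Ck_real n G" for n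
    unfolding G_def by (intro Ck_real_add Ck_real_mult Ck_real_const Ck_real_affine Ck_real_step)
  have DF: "(F has_real_derivative \<beta>' (t - x)) (at t)" for t
  proof -
    have "((\<lambda>t. 1 * t + (- x)) has_real_derivative 1) (at t)" by (auto intro!: derivative_eq_intros)
    from DERIV_chain2[OF b this] show ?thesis by (simp add: F_def[abs_def])
  qed
  have DG: "(G has_real_derivative bump e (t - y1) - bump e (t - y2)) (at t)" for t
    unfolding G_def by (auto intro!: derivative_eq_intros DERIV_chain2[OF step_derivative])
  define \<psi> where "\<psi> = (\<lambda>w. F (Re ((w - 0) / 1)) * G (Im ((w - 0) / 1)))"
  have t: "test_fun \<psi> U"
    unfolding \<psi>_def
  proof (rule test_fun_product[OF CF CG, where ?a1.0 = "x - e" and ?a2.0 = "x + e" and ?b1.0 = "y1 - e" and ?b2.0 = "y2 + e"])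
    show "F t = 0" if "t \<notin> {x - e..x + e}" for t
      using that by (auto simp: F_def bump_eq_0_iff)
    show "G t = 0" if t: "t \<notin> {y1 - e..y2 + e}" for t
    proof -
      consider "t < y1 - e" | "t > y2 + e" using t by fastforce
      then show ?thesis
      proof cases
        case 1
        then show ?thesis using le by (simp add: G_def step_left)
      next
        case 2
        then have "step e (t - y1) = step e (t - y2)" using le by (intro step_right) auto
        then show ?thesis by (simp add: G_def)
      qed
    qed
    show "0 + 1 * Complex a b \<in> U" if "a \<in> {x - e..x + e}" "b \<in> {y1 - e..y2 + e}" for a b
      using that le by (intro le(2)) auto
  qed simp
  have nn: "\<psi> w \<ge> 0" for w
    using le by (auto simp: \<psi>_def F_def G_def bump_nonneg intro!: mult_nonneg_nonneg step_mono)
  have dz: "dzbar \<psi> w = Complex (\<beta>' (Re w - x) * (step e (Im w - y1) - step e (Im w - y2)))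
    (bump e (Re w - x) * (bump e (Im w - y1) - bump e (Im w - y2))) / 2" for w
    unfolding \<psi>_def dzbar_def product_derivative[OF DF DG] by (simp add: F_def G_def complex_eq_iff)
  have "Im (LINT w|lebesgue. \<Phi> w * dzbar \<psi> w) = 0"
    using Sigma t nn by (auto simp: Sigma_cls_def)
  then show ?case by (simp add: dz)
next
  case (sym y1 y2)
  have "\<Phi> w * Complex (\<beta>' (Re w - x) * (step e (Im w - y2) - step e (Im w - y1)))
      (bump e (Re w - x) * (bump e (Im w - y2) - bump e (Im w - y1))) =
    - (\<Phi> w * Complex (\<beta>' (Re w - x) * (step e (Im w - y1) - step e (Im w - y2)))
      (bump e (Re w - x) * (bump e (Im w - y1) - bump e (Im w - y2))))" for w
    by (simp add: complex_eq_iff algebra_simps)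
  then show ?case using sym by (simp add: min.commute max.commute)
qed

text \<open>\<open>G\<close> is the mollification of \<open>\<Phi>\<close>, and
  \<open>\<phi>\<close> a primitive of \<open>Re (G dz)\<close>. The last clause says that an
  average obeys every half-plane bound satisfied almost everywhere by the averaged function; it is
  all that is used of \<open>G\<close> later.\<close>

lemma mollified_potential:
  assumes Sigma: "\<Phi> \<in> Sigma_cls U" and U: "cball p (3 * R) \<subseteq> U" and e: "0 < e" "e \<le> R"
  shows "\<exists>\<phi> G. \<forall>z\<in>ball p R. (\<phi> has_derivative (\<lambda>h. Re (G z * h))) (at z) \<and>
    (\<forall>c b. (AE w in lebesgue. w \<in> ball z (2 * e) \<longrightarrow> Re (c * \<Phi> w) \<le> b) \<longrightarrow> Re (c * G z) \<le> b)"
proof -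
  obtain \<beta>' B where b: "\<And>x. (bump e has_real_derivative \<beta>' x) (at x)" "continuous_on UNIV \<beta>'"
    "\<And>x. \<bar>\<beta>' x\<bar> \<le> B" "\<And>x. \<bar>x\<bar> > e \<Longrightarrow> \<beta>' x = 0"
    using bump_derivative_bounded[of e] by auto
  define \<beta> where "\<beta> = bump e"
  define S where "S = step e"
  define Sm where "Sm = \<bar>step e e\<bar>"
  have c\<beta>: "continuous_on UNIV \<beta>" and cS: "continuous_on UNIV S"
    unfolding \<beta>_def S_def using Ck_real_continuous[OF Ck_real_bump[of 0]] Ck_real_continuous[OF Ck_real_step[of 0]] by auto
  have \<beta>1: "\<bar>\<beta> x\<bar> \<le> 1" "\<beta> x \<ge> 0" for x using bump_nonneg[of e x] bump_le_1[of e x] by (auto simp: \<beta>_def)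
  have Sb: "\<bar>S x\<bar> \<le> Sm" for x unfolding S_def Sm_def by (rule step_bounded)
  have \<beta>0: "\<beta> x = 0" if "\<bar>x\<bar> \<ge> e" for x using that by (simp add: \<beta>_def bump_eq_0_iff)
  have D\<beta>: "(\<beta> has_real_derivative \<beta>' x) (at x)" and DS: "(S has_real_derivative \<beta> x) (at x)" for x
    unfolding \<beta>_def S_def using b(1) step_derivative by auto
  note cont = continuous_on_real_Re_Im
  define x0 where "x0 = Re p"
  define y0 where "y0 = Im p"
  define Q where "Q = cball p (3 * R)"
  have Q: "compact Q" "Q \<subseteq> U" using U by (auto simp: Q_def)
  have loc: "loc_integrable U \<Phi>" using Sigma by (simp add: Sigma_cls_def)
  \<comment> \<open>Cutting \<open>\<Phi>\<close> to a compact set makes it integrable over the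
    plane. For \<open>z\<close> in \<open>ball p R\<close> every combination of kernels that is
    needed vanishes off \<open>Q\<close>, so the cut is invisible there.\<close>
  define g where "g w = indicator Q w *\<^sub>R \<Phi> w" for w
  have g: "integrable lebesgue g"
    using loc Q unfolding g_def[abs_def] loc_integrable_def set_integrable_def by blast
  have gR: "integrable lebesgue (\<lambda>w. Re (g w))" and gI: "integrable lebesgue (\<lambda>w. Im (g w))"
    using g by auto
  have int: "integrable lebesgue (\<lambda>w. u w * k w)"
    if u: "integrable lebesgue u" and k: "continuous_on UNIV k" "\<And>w. \<bar>k w\<bar> \<le> C" for u k :: "complex \<Rightarrow> real" and C
  proof (rule Bochner_Integration.integrable_bound)
    show "integrable lebesgue (\<lambda>w. C * u w)" using u by simp
    show "(\<lambda>w. u w * k w) \<in> borel_measurable lebesgue"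
      using borel_measurable_integrable[OF u] continuous_lebesgue_measurable[OF k(1)] by (rule borel_measurable_times)
    show "AE w in lebesgue. norm (u w * k w) \<le> norm (C * u w)"
    proof (intro AE_I2)
      fix w
      have "\<bar>k w\<bar> * \<bar>u w\<bar> \<le> \<bar>C\<bar> * \<bar>u w\<bar>" using k(2)[of w] by (intro mult_right_mono) auto
      then show "norm (u w * k w) \<le> norm (C * u w)" by (simp add: abs_mult mult.commute)
    qed
  qed
  define \<rho> where "\<rho> z w = \<beta> (Re w - Re z) * \<beta> (Im w - Im z)" for z w :: complex
  have c\<rho>: "continuous_on UNIV (\<rho> z)" for z unfolding \<rho>_def by (rule cont[OF c\<beta> c\<beta>])
  have \<rho>1: "\<bar>\<rho> z w\<bar> \<le> 1" "\<rho> z w \<ge> 0" for z w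
    unfolding \<rho>_def abs_mult using \<beta>1 by (auto intro!: mult_le_one)
  have \<rho>sup: "w \<in> ball z (2 * e)" if "\<rho> z w \<noteq> 0" for z w
  proof -
    have "\<bar>Re w - Re z\<bar> < e" "\<bar>Im w - Im z\<bar> < e"
      using that \<beta>0[of "Re w - Re z"] \<beta>0[of "Im w - Im z"] by (auto simp: \<rho>_def not_le[symmetric])
    then show ?thesis using cmod_le[of "w - z"] by (simp add: dist_norm norm_minus_commute)
  qed
  define c where "c = (LINT w|lebesgue. \<rho> 0 w)"
  have c\<rho>z: "(LINT w|lebesgue. \<rho> z w) = c" for z
    using integral_lebesgue_translate[OF c\<rho>, of z z] by (simp add: c_def \<rho>_def)
  have i\<rho>: "integrable lebesgue (\<rho> z)" for z
  proof -
    have "loc_integrable UNIV (\<lambda>_. 1)" by (simp add: continuous_loc_integrable)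
    from loc_integrable_mult_continuous[OF this, of "cball z (2 * e)" "\<lambda>w. complex_of_real (\<rho> z w)"]
    have "integrable lebesgue (\<lambda>w. complex_of_real (\<rho> z w))"
      using \<rho>sup[of z] c\<rho>[of z] by (force intro!: continuous_intros)
    from integrable_Re[OF this] show ?thesis by simp
  qed
  have c0: "c > 0"
  proof -
    have "c \<ge> 0" unfolding c_def using \<rho>1 by (simp add: integral_nonneg_AE)
    moreover have "c \<noteq> 0"
    proof
      assume "c = 0"
      then have "AE w in lebesgue. \<rho> 0 w = 0"
        using integral_nonneg_eq_0_iff_AE[OF i\<rho>[of 0]] \<rho>1 unfolding c_def by auto
      then have "AE w in lebesgue. w \<notin> {w. \<rho> 0 w > 0}" by eventually_elim simp
      moreover have "open {w. \<rho> 0 w > 0}" using c\<rho> by (intro open_Collect_less continuous_intros)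
      ultimately have "{w. \<rho> 0 w > 0} = {}" by (rule AE_lebesgue_not_open)
      moreover have "\<rho> 0 0 > 0" using e by (simp add: \<rho>_def \<beta>_def bump_pos_iff)
      ultimately show False by blast
    qed
    ultimately show ?thesis by simp
  qed
  \<comment> \<open>Each coordinate of \<open>w - p\<close> is at most \<open>R + e <= 2 R\<close>,
    and the square root of 8 is below 3: this is the origin of the radius
    \<open>3 * R\<close>.\<close>
  have inQ: "w \<in> Q" if "z \<in> ball p R" "\<bar>Re w - Re z\<bar> \<le> e" "Im w \<in> {min y0 (Im z) - e..max y0 (Im z) + e}" for z w
  proof -
    have "\<bar>Re z - x0\<bar> < R" "\<bar>Im z - y0\<bar> < R"
      using that(1) abs_Re_le_cmod[of "z - p"] abs_Im_le_cmod[of "z - p"]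
      by (auto simp: x0_def y0_def dist_norm norm_minus_commute)
    then have "\<bar>Re (w - p)\<bar> \<le> 2 * R" "\<bar>Im (w - p)\<bar> \<le> 2 * R"
      using that(2,3) e by (auto simp: x0_def y0_def)
    then have "(Re (w - p))\<^sup>2 \<le> (2 * R)\<^sup>2" "(Im (w - p))\<^sup>2 \<le> (2 * R)\<^sup>2"
      by (metis abs_le_square_iff abs_of_nonneg e(1,2) less_imp_le mult_nonneg_nonneg order_trans zero_le_numeral)+
    then have "(norm (w - p))\<^sup>2 \<le> (3 * R)\<^sup>2"
      unfolding cmod_power2 power_mult_distrib by simp (use zero_le_power2[of R] in linarith)
    then have "norm (w - p) \<le> 3 * R" by (rule power2_le_imp_le) (use e in simp)
    then show ?thesis by (simp add: Q_def dist_norm norm_minus_commute)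
  qed
  \<comment> \<open>\<open>H1\<close> and \<open>H2\<close> are the kernel integrated in closed form
    along the horizontal leg from \<open>p\<close> and then the vertical leg up to \<open>z\<close>,
    so \<open>\<phi>\<close> is the integral of \<open>Re G dx - Im G dy\<close> along this path.
    The vertical derivative is immediate; the horizontal one needs closedness.\<close>
  define H1 where "H1 w z = (S (Re w - x0) - S (Re w - Re z)) * \<beta> (Im w - y0)" for w z :: complex
  define H1' where "H1' w z h = \<beta> (Re w - Re z) * \<beta> (Im w - y0) * Re h" for w z h :: complex
  define H2 where "H2 w z = \<beta> (Re w - Re z) * (S (Im w - y0) - S (Im w - Im z))" for w z :: complex
  define H2' where "H2' w z h = \<beta> (Re w - Re z) * \<beta> (Im w - Im z) * Im h
    - \<beta>' (Re w - Re z) * (S (Im w - y0) - S (Im w - Im z)) * Re h" for w z h :: complex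
  have dRe: "((\<lambda>z. Re w - Re z) has_derivative (\<lambda>h. - Re h)) (at z)"
    and dIm: "((\<lambda>z. Im w - Im z) has_derivative (\<lambda>h. - Im h)) (at z)" for w z
    by (auto intro!: derivative_eq_intros)
  note comp = has_derivative_compose[OF _ has_field_derivative_imp_has_derivative]
  note c1 = comp[OF dRe DS] and c2 = comp[OF dRe D\<beta>] and c3 = comp[OF dIm DS]
  have dH1: "(H1 w has_derivative H1' w z) (at z)" for w z
    unfolding H1_def[abs_def] H1'_def[abs_def]
    by (rule derivative_eq_intros c1 refl)+ (auto simp: fun_eq_iff algebra_simps)
  have dH2: "(H2 w has_derivative H2' w z) (at z)" for w z
    unfolding H2_def[abs_def] H2'_def[abs_def]
    by (rule derivative_eq_intros c2 c3 refl)+ (auto simp: fun_eq_iff algebra_simps)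
  have SS: "\<bar>S x - S y\<bar> \<le> 2 * Sm" for x y using Sb[of x] Sb[of y] by linarith
  have Sm0: "Sm \<ge> 0" by (simp add: Sm_def)
  have B0: "B \<ge> 0" using b(3)[of 0] by linarith
  have cH1: "continuous_on UNIV (\<lambda>w. H1 w z)" and cH2: "continuous_on UNIV (\<lambda>w. H2 w z)"
    and cH1': "continuous_on UNIV (\<lambda>w. H1' w z h)" and cH2': "continuous_on UNIV (\<lambda>w. H2' w z h)" for z h
    unfolding H1_def H2_def H1'_def H2'_def
    by (intro continuous_intros continuous_on_compose2[OF cS] continuous_on_compose2[OF c\<beta>] continuous_on_compose2[OF b(2)]; simp)+
  have bH1: "\<bar>H1 w z\<bar> \<le> 2 * Sm * 1" for w z
    unfolding H1_def abs_mult using SS \<beta>1 Sm0 by (intro mult_mono) auto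
  have bH2: "\<bar>H2 w z\<bar> \<le> 1 * (2 * Sm)" for w z
    unfolding H2_def abs_mult using SS \<beta>1 Sm0 by (intro mult_mono) auto
  have bH1': "\<bar>H1' w z h\<bar> \<le> 1 * norm h" for w z h
    unfolding H1'_def abs_mult using \<beta>1 abs_Re_le_cmod by (intro mult_mono mult_le_one) auto
  have bH2': "\<bar>H2' w z h\<bar> \<le> (1 + B * (2 * Sm)) * norm h" for w z h
  proof -
    have "\<bar>\<beta> (Re w - Re z) * \<beta> (Im w - Im z) * Im h\<bar> \<le> 1 * norm h"
      unfolding abs_mult using \<beta>1 abs_Im_le_cmod by (intro mult_mono mult_le_one) auto
    moreover have "\<bar>\<beta>' (Re w - Re z) * (S (Im w - y0) - S (Im w - Im z)) * Re h\<bar> \<le> (B * (2 * Sm)) * norm h"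
      unfolding abs_mult using b(3) SS Sm0 B0 abs_Re_le_cmod by (intro mult_mono) auto
    ultimately show ?thesis unfolding H2'_def by (simp add: distrib_right)
  qed
  define \<phi> where "\<phi> z = ((LINT w|lebesgue. Re (g w) * H1 w z) - (LINT w|lebesgue. Im (g w) * H2 w z)) / c" for z
  define G where "G z = (LINT w|lebesgue. g w * complex_of_real (\<rho> z w)) / of_real c" for z
  have i\<rho>R: "integrable lebesgue (\<lambda>w. Re (g w) * \<rho> z w)" and i\<rho>I: "integrable lebesgue (\<lambda>w. Im (g w) * \<rho> z w)" for z
    using int[OF gR c\<rho> \<rho>1(1)] int[OF gI c\<rho> \<rho>1(1)] by auto
  have i\<rho>: "integrable lebesgue (\<lambda>w. g w * complex_of_real (\<rho> z w))" for z
    using i\<rho>R[of z] i\<rho>I[of z] unfolding integrable_complex_iff by simp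
  have ReG: "Re (G z) = (LINT w|lebesgue. Re (g w) * \<rho> z w) / c"
    and ImG: "Im (G z) = (LINT w|lebesgue. Im (g w) * \<rho> z w) / c" for z
    unfolding G_def using integral_Re[OF i\<rho>[of z]] integral_Im[OF i\<rho>[of z]] by (auto simp: Re_divide_of_real Im_divide_of_real)
  have "(\<phi> has_derivative (\<lambda>h. Re (G z * h))) (at z) \<and>
    (\<forall>c b. (AE w in lebesgue. w \<in> ball z (2 * e) \<longrightarrow> Re (c * \<Phi> w) \<le> b) \<longrightarrow> Re (c * G z) \<le> b)"
    if z: "z \<in> ball p R" for z
  proof
    have ballQ: "w \<in> Q" if "\<rho> z w \<noteq> 0" for w
    proof (rule inQ[OF z])
      have "\<bar>Re w - Re z\<bar> < e" "\<bar>Im w - Im z\<bar> < e"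
        using that \<beta>0[of "Re w - Re z"] \<beta>0[of "Im w - Im z"] by (auto simp: \<rho>_def not_le[symmetric])
      then show "\<bar>Re w - Re z\<bar> \<le> e" "Im w \<in> {min y0 (Im z) - e..max y0 (Im z) + e}" by auto
    qed
    have "(\<phi> has_derivative (\<lambda>h. ((LINT w|lebesgue. Re (g w) * H1' w z h) - (LINT w|lebesgue. Im (g w) * H2' w z h)) / c)) (at z)"
      unfolding \<phi>_def[abs_def] divide_inverse
      by (intro has_derivative_mult_left has_derivative_diff
          has_derivative_integral_parameter[OF gR continuous_lebesgue_measurable[OF cH1] bH1 dH1 bH1' continuous_lebesgue_measurable[OF cH1']]
          has_derivative_integral_parameter[OF gI continuous_lebesgue_measurable[OF cH2] bH2 dH2 bH2' continuous_lebesgue_measurable[OF cH2']])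
    moreover have "((LINT w|lebesgue. Re (g w) * H1' w z h) - (LINT w|lebesgue. Im (g w) * H2' w z h)) / c = Re (G z * h)" for h
    proof -
      define k1 where "k1 w = \<beta> (Re w - Re z) * \<beta> (Im w - y0)" for w
      define k2 where "k2 w = \<beta>' (Re w - Re z) * (S (Im w - y0) - S (Im w - Im z))" for w
      have i1: "integrable lebesgue (\<lambda>w. Re (g w) * k1 w)"
        using int[OF gR cH1'[of z 1] bH1'[of _ z 1]] by (simp add: H1'_def k1_def)
      have i2: "integrable lebesgue (\<lambda>w. Im (g w) * k2 w)"
        using int[OF gI cH2'[of z "- 1"] bH2'[of _ z "- 1"]] by (simp add: H2'_def k2_def)
      have k20: "k2 w = 0" if "w \<notin> Q" for w
      proof (rule ccontr)
        assume k: "k2 w \<noteq> 0"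
        then have 1: "\<bar>Re w - Re z\<bar> \<le> e" using b(4)[of "Re w - Re z"] by (auto simp: k2_def not_le[symmetric])
        have "Im w \<in> {min y0 (Im z) - e..max y0 (Im z) + e}"
        proof (rule ccontr)
          assume "\<not> ?thesis"
          then consider "Im w < min y0 (Im z) - e" | "Im w > max y0 (Im z) + e" by fastforce
          then have "S (Im w - y0) = S (Im w - Im z)"
          proof cases
            case 1
            then show ?thesis unfolding S_def by (subst (1 2) step_left) auto
          next
            case 2
            then show ?thesis unfolding S_def by (intro step_right) auto
          qed
          with k show False by (simp add: k2_def)
        qed
        from inQ[OF z 1 this] that show False by simp
      qed
      have k10: "k1 w = 0" if "w \<notin> Q" for w
      proof (rule ccontr)
        assume "k1 w \<noteq> 0"
        then have "\<bar>Re w - Re z\<bar> < e" "\<bar>Im w - y0\<bar> < e"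
          using \<beta>0[of "Re w - Re z"] \<beta>0[of "Im w - y0"] by (auto simp: k1_def not_le[symmetric])
        then have "w \<in> Q" by (intro inQ[OF z]) auto
        with that show False by simp
      qed
      \<comment> \<open>Moving the vertical leg sideways leaves \<open>k1\<close>, the kernel at its
        foot, and the term \<open>k2\<close>. Closedness replaces their joint contribution by that
        of the kernel at \<open>z\<close>.\<close>
      have "Im (LINT w|lebesgue. \<Phi> w * Complex (k2 w) (k1 w - \<rho> z w)) = 0"
      proof -
        have eq: "Complex (k2 w) (k1 w - \<rho> z w) = Complex (\<beta>' (Re w - Re z) * (step e (Im w - y0) - step e (Im w - Im z)))
          (bump e (Re w - Re z) * (bump e (Im w - y0) - bump e (Im w - Im z)))" for w
          by (simp add: k2_def k1_def \<rho>_def \<beta>_def S_def algebra_simps)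
        show ?thesis unfolding eq
          by (rule mollified_closed[OF Sigma b(1)]) (use inQ[OF z] Q(2) in blast)
      qed
      also have "(\<lambda>w. \<Phi> w * Complex (k2 w) (k1 w - \<rho> z w)) = (\<lambda>w. g w * Complex (k2 w) (k1 w - \<rho> z w))"
      proof
        fix w
        show "\<Phi> w * Complex (k2 w) (k1 w - \<rho> z w) = g w * Complex (k2 w) (k1 w - \<rho> z w)"
        proof (cases "w \<in> Q")
          case False
          then have "Complex (k2 w) (k1 w - \<rho> z w) = 0" using k10 k20 ballQ by (auto simp: complex_eq_iff)
          then show ?thesis by simp
        qed (simp add: g_def)
      qed
      also have "Im (LINT w|lebesgue. g w * Complex (k2 w) (k1 w - \<rho> z w)) =
          (LINT w|lebesgue. Im (g w * Complex (k2 w) (k1 w - \<rho> z w)))"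
      proof (rule integral_Im[symmetric])
        have i1': "integrable lebesgue (\<lambda>w. Im (g w) * k1 w)"
          using int[OF gI cH1'[of z 1] bH1'[of _ z 1]] by (simp add: H1'_def k1_def)
        have i2': "integrable lebesgue (\<lambda>w. Re (g w) * k2 w)"
          using int[OF gR cH2'[of z "- 1"] bH2'[of _ z "- 1"]] by (simp add: H2'_def k2_def)
        show "integrable lebesgue (\<lambda>w. g w * Complex (k2 w) (k1 w - \<rho> z w))"
          unfolding integrable_complex_iff using i1 i2 i1' i2' i\<rho>R[of z] i\<rho>I[of z]
          by (simp add: right_diff_distrib)
      qed
      also have "\<dots> = (LINT w|lebesgue. Re (g w) * k1 w - Re (g w) * \<rho> z w + Im (g w) * k2 w)"
        by (simp add: algebra_simps)
      also have "\<dots> = (LINT w|lebesgue. Re (g w) * k1 w) - (LINT w|lebesgue. Re (g w) * \<rho> z w) + (LINT w|lebesgue. Im (g w) * k2 w)"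
        using i1 i2 i\<rho>R[of z] by simp
      finally have key: "(LINT w|lebesgue. Re (g w) * \<rho> z w) = (LINT w|lebesgue. Re (g w) * k1 w) + (LINT w|lebesgue. Im (g w) * k2 w)"
        by simp
      have "(LINT w|lebesgue. Re (g w) * H1' w z h) = (LINT w|lebesgue. Re h * (Re (g w) * k1 w))"
        by (simp add: H1'_def k1_def mult_ac)
      moreover have "(LINT w|lebesgue. Im (g w) * H2' w z h) = (LINT w|lebesgue. Im h * (Im (g w) * \<rho> z w) - Re h * (Im (g w) * k2 w))"
        by (simp add: H2'_def k2_def \<rho>_def algebra_simps)
      ultimately have "(LINT w|lebesgue. Re (g w) * H1' w z h) - (LINT w|lebesgue. Im (g w) * H2' w z h) =
        Re h * (LINT w|lebesgue. Re (g w) * \<rho> z w) - Im h * (LINT w|lebesgue. Im (g w) * \<rho> z w)"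
        using i2 i\<rho>I[of z] by (simp add: key algebra_simps)
      then show ?thesis using c0 by (simp add: ReG ImG field_simps)
    qed
    ultimately show "(\<phi> has_derivative (\<lambda>h. Re (G z * h))) (at z)" by simp
    show "\<forall>c b. (AE w in lebesgue. w \<in> ball z (2 * e) \<longrightarrow> Re (c * \<Phi> w) \<le> b) \<longrightarrow> Re (c * G z) \<le> b"
    proof (intro allI impI)
      fix a :: complex and b :: real
      assume ae: "AE w in lebesgue. w \<in> ball z (2 * e) \<longrightarrow> Re (a * \<Phi> w) \<le> b"
      have "Re (a * G z) = (LINT w|lebesgue. Re (a * g w) * \<rho> z w) / c"
        using i\<rho>R[of z] i\<rho>I[of z] by (simp add: ReG ImG left_diff_distrib mult.assoc diff_divide_distrib)
      also have "(LINT w|lebesgue. Re (a * g w) * \<rho> z w) \<le> (LINT w|lebesgue. b * \<rho> z w)"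
      proof (rule integral_mono_AE)
        show "integrable lebesgue (\<lambda>w. Re (a * g w) * \<rho> z w)"
          using i\<rho>R[of z] i\<rho>I[of z] by (simp add: left_diff_distrib mult.assoc)
        show "integrable lebesgue (\<lambda>w. b * \<rho> z w)" using \<open>\<And>z. integrable lebesgue (\<rho> z)\<close> by simp
        show "AE w in lebesgue. Re (a * g w) * \<rho> z w \<le> b * \<rho> z w"
          using ae
        proof eventually_elim
          case (elim w)
          show ?case
          proof (cases "\<rho> z w = 0")
            case False
            then have "w \<in> ball z (2 * e)" "w \<in> Q" using \<rho>sup ballQ by blast+
            then have "Re (a * g w) \<le> b" using elim by (simp add: g_def del: mem_ball)
            then show ?thesis using \<rho>1 by (intro mult_right_mono)
          qed simp
        qed
      qed
      also have "(LINT w|lebesgue. b * \<rho> z w) = b * c" by (simp add: c\<rho>z)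
      finally show "Re (a * G z) \<le> b" using c0 by (simp add: divide_right_mono)
    qed
  qed
  then show ?thesis by blast
qed

section \<open>The maximum formula\<close>

text \<open>Mean value theorem for \<open>\<phi> - Re f\<close> along the segment, whose parameter
  derivative is \<open>Re ((y - x) * (G - a))\<close>. \<open>B\<close> bounds the whole increment,
  so it already includes the length of the segment.\<close>

lemma segment_increment:
  fixes \<phi> :: "complex \<Rightarrow> real" and f :: "complex \<Rightarrow> complex"
  assumes \<phi>: "\<And>w. w \<in> closed_segment x y \<Longrightarrow> (\<phi> has_derivative (\<lambda>h. Re (G w * h))) (at w)"
    and f: "\<And>w. w \<in> closed_segment x y \<Longrightarrow> (f has_field_derivative a w) (at w)"
    and le: "\<And>w. w \<in> closed_segment x y \<Longrightarrow> Re ((y - x) * G w) \<le> Re ((y - x) * a w) + B"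
  shows "(\<phi> y - Re (f y)) \<le> (\<phi> x - Re (f x)) + B"
proof -
  define l where "l t = x + of_real t * (y - x)" for t :: real
  have l: "l t \<in> closed_segment x y" if "0 \<le> t" "t \<le> 1" for t
  proof -
    have "l t = (1 - t) *\<^sub>R x + t *\<^sub>R y" by (simp add: l_def scaleR_conv_of_real algebra_simps)
    with that show ?thesis unfolding closed_segment_def by blast
  qed
  have dl: "(l has_derivative (\<lambda>s. of_real s * (y - x))) (at t)" for t
    unfolding l_def by (auto intro!: derivative_eq_intros)
  have D: "((\<lambda>t. \<phi> (l t) - Re (f (l t))) has_real_derivative Re ((y - x) * G (l t)) - Re ((y - x) * a (l t))) (at t)"
    if "0 \<le> t" "t \<le> 1" for t
  proof -
    have 1: "((\<lambda>t. \<phi> (l t)) has_derivative (\<lambda>s. Re (G (l t) * (of_real s * (y - x))))) (at t)"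
      by (rule has_derivative_compose[OF dl \<phi>[OF l[OF that]]])
    have 2: "((\<lambda>t. f (l t)) has_derivative (\<lambda>s. a (l t) * (of_real s * (y - x)))) (at t)"
      by (rule has_derivative_compose[OF dl f[OF l[OF that], unfolded has_field_derivative_def]])
    have "((\<lambda>t. \<phi> (l t) - Re (f (l t))) has_derivative
      (\<lambda>s. Re (G (l t) * (of_real s * (y - x))) - Re (a (l t) * (of_real s * (y - x))))) (at t)"
      by (rule has_derivative_diff[OF 1 has_derivative_Re[OF 2]])
    moreover have "(\<lambda>s. Re (G (l t) * (of_real s * (y - x))) - Re (a (l t) * (of_real s * (y - x)))) =
      (*) (Re ((y - x) * G (l t)) - Re ((y - x) * a (l t)))"
      by (simp add: fun_eq_iff algebra_simps)
    ultimately show ?thesis unfolding has_field_derivative_def by simp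
  qed
  obtain s where s: "0 < s" "s < 1"
    "(\<phi> (l 1) - Re (f (l 1))) - (\<phi> (l 0) - Re (f (l 0))) = (1 - 0) * (Re ((y - x) * G (l s)) - Re ((y - x) * a (l s)))"
    using MVT2[of 0 1 "\<lambda>t. \<phi> (l t) - Re (f (l t))" "\<lambda>t. Re ((y - x) * G (l t)) - Re ((y - x) * a (l t))"] D by auto
  have "l 1 = y" "l 0 = x" by (simp_all add: l_def)
  with s le[OF l[of s]] show ?thesis by simp
qed

text \<open>With total weight normalised to 1, the hypothesis says that 0 is outside the compact
  convex hull of the \<open>d j\<close>. The conjugate of the unit normal of a strictly separating
  line is the required \<open>v\<close>, since \<open>Re (d * cnj a)\<close> is the inner
  product.\<close>

lemma separating_direction:
  fixes d :: "nat \<Rightarrow> complex"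
  assumes J: "finite J"
    and nz: "\<And>\<theta>. (\<forall>j\<in>J. \<theta> j \<ge> 0) \<Longrightarrow> (\<Sum>j\<in>J. \<theta> j) > 0 \<Longrightarrow> (\<Sum>j\<in>J. complex_of_real (\<theta> j) * d j) \<noteq> 0"
  shows "\<exists>v. norm v = 1 \<and> (\<forall>j\<in>J. Re (d j * v) > 0)"
proof -
  define C where "C = {x. \<exists>\<theta>. (\<forall>j\<in>J. \<theta> j \<ge> 0) \<and> (\<Sum>j\<in>J. \<theta> j) = 1 \<and> x = (\<Sum>j\<in>J. complex_of_real (\<theta> j) * d j)}"
  have "convex C"
  proof (rule convexI)
    fix x y u v assume x: "x \<in> C" and y: "y \<in> C" and uv: "0 \<le> u" "0 \<le> v" "u + v = (1 :: real)"
    obtain \<theta> where \<theta>: "\<forall>j\<in>J. \<theta> j \<ge> 0" "(\<Sum>j\<in>J. \<theta> j) = 1" "x = (\<Sum>j\<in>J. complex_of_real (\<theta> j) * d j)"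
      using x unfolding C_def by blast
    obtain \<tau> where \<tau>: "\<forall>j\<in>J. \<tau> j \<ge> 0" "(\<Sum>j\<in>J. \<tau> j) = 1" "y = (\<Sum>j\<in>J. complex_of_real (\<tau> j) * d j)"
      using y unfolding C_def by blast
    have "u *\<^sub>R x + v *\<^sub>R y = (\<Sum>j\<in>J. complex_of_real (u * \<theta> j + v * \<tau> j) * d j)"
      by (simp add: \<theta> \<tau> scaleR_conv_of_real sum_distrib_left sum.distrib algebra_simps)
    moreover have "(\<Sum>j\<in>J. u * \<theta> j + v * \<tau> j) = 1"
      using uv \<theta>(2) \<tau>(2) by (simp add: sum.distrib flip: sum_distrib_left)
    moreover have "\<forall>j\<in>J. u * \<theta> j + v * \<tau> j \<ge> 0" using uv \<theta>(1) \<tau>(1) by simp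
    ultimately show "u *\<^sub>R x + v *\<^sub>R y \<in> C"
      unfolding C_def by (intro CollectI exI[of _ "\<lambda>j. u * \<theta> j + v * \<tau> j"] conjI)
  qed
  moreover have "d ` J \<subseteq> C"
  proof safe
    fix j assume j: "j \<in> J"
    have "d j = (\<Sum>i\<in>J. complex_of_real (if i = j then 1 else 0) * d i)"
      using j J by (simp add: if_distrib[of complex_of_real] if_distrib[of "\<lambda>x. x * _"] cong: if_cong)
    moreover have "(\<Sum>i\<in>J. (if i = j then 1 else 0 :: real)) = 1" using j J by simp
    ultimately show "d j \<in> C" unfolding C_def by (intro CollectI exI[of _ "\<lambda>i. if i = j then 1 else 0"]) auto
  qed
  ultimately have "convex hull (d ` J) \<subseteq> C" by (rule hull_minimal[rotated])
  moreover have "0 \<notin> C"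
  proof
    assume "0 \<in> C"
    then obtain \<theta> where "\<forall>j\<in>J. \<theta> j \<ge> 0" "(\<Sum>j\<in>J. \<theta> j) = 1" "0 = (\<Sum>j\<in>J. complex_of_real (\<theta> j) * d j)"
      unfolding C_def by blast
    then show False using nz[of \<theta>] by simp
  qed
  ultimately have "0 \<notin> convex hull (d ` J)" by blast
  moreover have "closed (convex hull (d ` J))"
    using J by (intro compact_imp_closed compact_convex_hull finite_imp_compact) simp
  ultimately obtain a b where a: "a \<noteq> 0" "0 < b" "\<forall>x\<in>convex hull (d ` J). inner a x > b"
    using separating_hyperplane_closed_0[OF convex_convex_hull, of "d ` J"] by blast
  have "Re (d j * (cnj a / of_real (norm a))) > 0" if "j \<in> J" for j
  proof -
    have "d j \<in> convex hull (d ` J)" using that by (intro hull_inc) simp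
    then have "inner a (d j) > 0" using a by fastforce
    then have "Re (d j * cnj a) > 0" by (simp add: inner_complex_def mult.commute)
    then have "Re (d j * cnj a) / norm a > 0" using a(1) by simp
    moreover have "d j * (cnj a / of_real (norm a)) = d j * cnj a / of_real (norm a)" by simp
    ultimately show ?thesis by (simp only: Re_divide_of_real)
  qed
  moreover have "norm (cnj a / of_real (norm a)) = 1" using a(1) by (simp add: norm_divide)
  ultimately show ?thesis by blast
qed

text \<open>Joint continuity of \<open>Re (a z * w)\<close> at \<open>(p, v)\<close>. Phrasing it as
  holding for all small positive \<open>e\<close> lets finitely many such conditions share one
  \<open>e\<close>.\<close>

lemma positive_near:
  fixes a :: "complex \<Rightarrow> complex"
  assumes "isCont a p" "Re (a p * v) > 0"
  shows "\<forall>\<^sub>F e in at_right 0. \<forall>z w. dist z p < e \<longrightarrow> dist w v < e \<longrightarrow> Re (a z * w) > 0"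
proof -
  have f: "((\<lambda>x. a (fst x)) \<longlongrightarrow> a p) (nhds (p, v))"
    using isCont_tendsto_compose[OF assms(1), of fst "nhds (p, v)"] tendsto_fst[OF filterlim_ident[of "nhds (p, v)"]]
    by simp
  have s: "(snd \<longlongrightarrow> v) (nhds (p, v))"
    using tendsto_snd[OF filterlim_ident[of "nhds (p, v)"]] by simp
  have "((\<lambda>x. Re (a (fst x) * snd x)) \<longlongrightarrow> Re (a p * v)) (nhds (p, v))"
    by (intro tendsto_intros f s)
  from order_tendstoD(1)[OF this assms(2)]
  obtain d where d: "d > 0" "\<And>x. dist x (p, v) < d \<Longrightarrow> Re (a (fst x) * snd x) > 0"
    unfolding eventually_nhds_metric by blast
  have "Re (a z * w) > 0" if "dist z p < e" "dist w v < e" "e < d / 2" for z w e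
  proof -
    have "dist (z, w) (p, v) \<le> dist z p + dist w v"
      unfolding dist_Pair_Pair by (rule sqrt_sum_squares_le_sum) auto
    then have "dist (z, w) (p, v) < d" using that by linarith
    from d(2)[OF this] show ?thesis by simp
  qed
  moreover have "\<forall>\<^sub>F e in at_right 0. e < d / 2"
    using d(1) eventually_at_right_real[of 0 "d / 2"] by (auto elim!: eventually_mono)
  ultimately show ?thesis by (auto elim!: eventually_mono)
qed

lemma closed_segment_neighbourhood:
  fixes x y :: complex
  assumes "closed_segment x y \<subseteq> S" "open S"
  shows "\<exists>d>0. \<forall>w\<in>closed_segment x y. ball w d \<subseteq> S"
proof -
  obtain d where "d > 0" "(\<Union>w\<in>closed_segment x y. ball w d) \<subseteq> S"
    using compact_subset_open_imp_ball_epsilon_subset[OF compact_segment assms(2,1)] by metis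
  then show ?thesis by blast
qed

section \<open>Comparison of the branches near a point\<close>

context piecewise_analytic
begin

text \<open>A single \<open>e\<close> serves as the radius of a disc meeting only adherent pieces
  and as the aperture of every cone of directions.\<close>

lemma good_neighbourhood:
  assumes p: "p \<in> U"
    and prim: "\<forall>i\<in>{1..r}. f i holomorphic_on U \<and> (\<forall>z\<in>U. (f i has_field_derivative A i z) (at z))"
    and hyp: "\<forall>p\<in>U. card (Iset U r M p) > 1 \<longrightarrow> (\<forall>k\<in>Iset U r M p. 0 \<notin> Vset (Iset U r M p) f p k)"
  shows "\<exists>v e. (\<forall>k\<in>Iset U r M p. norm (v k) = 1) \<and> 0 < e \<and> e < 1 \<and> ball p e \<subseteq> U \<and>
    (\<forall>j\<in>{1..r} - Iset U r M p. M j \<inter> ball p e = {}) \<and>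
    (\<forall>k\<in>Iset U r M p. \<forall>j\<in>Iset U r M p - {k}. \<forall>z w. dist z p < e \<longrightarrow> dist w (v k) < e \<longrightarrow> Re ((A k z - A j z) * w) > 0)"
proof -
  let ?I = "Iset U r M p"
  have I: "finite ?I" "?I \<subseteq> {1..r}" by (auto simp: Iset_def)
  have "\<forall>k\<in>?I. \<exists>v. norm v = 1 \<and> (\<forall>j\<in>?I - {k}. Re ((A k p - A j p) * v) > 0)"
  proof
    fix k assume k: "k \<in> ?I"
    have dv: "deriv (f i) p = A i p" if "i \<in> ?I" for i
      using prim p I that by (blast intro: DERIV_imp_deriv)
    show "\<exists>v. norm v = 1 \<and> (\<forall>j\<in>?I - {k}. Re ((A k p - A j p) * v) > 0)"
    proof (rule separating_direction)
      fix \<theta> :: "nat \<Rightarrow> real" assume \<theta>: "\<forall>j\<in>?I - {k}. \<theta> j \<ge> 0" "(\<Sum>j\<in>?I - {k}. \<theta> j) > 0"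
      \<comment> \<open>Condition (ii) speaks only when at least two pieces are adherent. A positive
        sum of weights forces this, so a lone piece leaves nothing to separate.\<close>
      have "?I - {k} \<noteq> {}"
      proof
        assume "?I - {k} = {}"
        with \<theta>(2) show False by (metis less_irrefl sum.empty)
      qed
      then obtain j where "j \<in> ?I" "j \<noteq> k" by blast
      then have "card {j, k} \<le> card ?I" using k I by (intro card_mono) auto
      then have "card ?I > 1" using \<open>j \<noteq> k\<close> by simp
      then have "0 \<notin> Vset ?I f p k" using hyp p k by blast
      then have "(\<Sum>j\<in>?I - {k}. complex_of_real (\<theta> j) * (deriv (f k) p - deriv (f j) p)) \<noteq> 0"
        unfolding Vset_def using \<theta> by force
      also have "(\<Sum>j\<in>?I - {k}. complex_of_real (\<theta> j) * (deriv (f k) p - deriv (f j) p)) =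
          (\<Sum>j\<in>?I - {k}. complex_of_real (\<theta> j) * (A k p - A j p))"
        using dv k by (intro sum.cong) auto
      finally show "(\<Sum>j\<in>?I - {k}. complex_of_real (\<theta> j) * (A k p - A j p)) \<noteq> 0" .
    qed (use I in simp)
  qed
  then obtain v where v: "\<And>k. k \<in> ?I \<Longrightarrow> norm (v k) = 1"
    "\<And>k j. k \<in> ?I \<Longrightarrow> j \<in> ?I - {k} \<Longrightarrow> Re ((A k p - A j p) * v k) > 0"
    by metis
  have cA: "isCont (A i) p" if "i \<in> ?I" for i
    using A_continuous[of i] I that p open_U continuous_on_eq_continuous_at by blast
  have ev1: "\<forall>\<^sub>F e in at_right 0. \<forall>k\<in>?I. \<forall>j\<in>?I - {k}. \<forall>z w. dist z p < e \<longrightarrow> dist w (v k) < e \<longrightarrow> Re ((A k z - A j z) * w) > 0"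
    using I v cA by (intro eventually_ball_finite ballI positive_near[where a = "\<lambda>z. A _ z - A _ z"]) auto
  define Q where "Q = U \<inter> (\<Inter>j\<in>{1..r} - ?I. - closure (M j))"
  have "open Q" unfolding Q_def using open_U by (intro open_Int open_INT) auto
  moreover have "p \<in> Q" using p by (auto simp: Q_def Iset_def)
  ultimately obtain d where d: "d > 0" "ball p d \<subseteq> Q" using openE by blast
  have ev2: "\<forall>\<^sub>F e in at_right 0. 0 < e \<and> e < min 1 d"
    using d(1) eventually_at_right_real[of 0 "min 1 d"] by (auto elim!: eventually_mono)
  from eventually_happens[OF eventually_conj[OF ev1 ev2]]
  obtain e where e: "\<forall>k\<in>?I. \<forall>j\<in>?I - {k}. \<forall>z w. dist z p < e \<longrightarrow> dist w (v k) < e \<longrightarrow> Re ((A k z - A j z) * w) > 0"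
    "0 < e" "e < 1" "e < d" by (auto simp: trivial_limit_at_right_real)
  have "ball p e \<subseteq> Q" using d(2) e(4) by (meson less_imp_le order_trans subset_ball)
  then have "ball p e \<subseteq> U" "\<forall>j\<in>{1..r} - ?I. M j \<inter> ball p e = {}"
    unfolding Q_def using closure_subset by blast+
  with e v show ?thesis by blast
qed

lemma dominant_piece:
  assumes p: "p \<in> U"
    and prim: "\<forall>i\<in>{1..r}. f i holomorphic_on U \<and> (\<forall>z\<in>U. (f i has_field_derivative A i z) (at z))"
    and hyp: "\<forall>p\<in>U. card (Iset U r M p) > 1 \<longrightarrow> (\<forall>k\<in>Iset U r M p. 0 \<notin> Vset (Iset U r M p) f p k)"
  shows "\<exists>\<delta>>0. ball p \<delta> \<subseteq> U \<and> (\<forall>j\<in>{1..r} - Iset U r M p. M j \<inter> ball p \<delta> = {}) \<and>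
    (\<forall>k\<in>Iset U r M p. \<forall>j\<in>Iset U r M p. \<forall>z\<in>M k \<inter> ball p \<delta>. Re (f j z - f j p) \<le> Re (f k z - f k p))"
proof -
  let ?I = "Iset U r M p"
  have I: "finite ?I" "\<And>j. j \<in> ?I \<Longrightarrow> j \<in> {1..r}" "\<And>j. j \<in> ?I \<Longrightarrow> p \<in> closure (M j)" by (auto simp: Iset_def)
  obtain v e where v: "\<forall>k\<in>?I. norm (v k) = 1" and e: "0 < e" "e < 1" and N: "ball p e \<subseteq> U"
    and out: "\<forall>j\<in>{1..r} - ?I. M j \<inter> ball p e = {}"
    and pos: "\<forall>k\<in>?I. \<forall>j\<in>?I - {k}. \<forall>z w. dist z p < e \<longrightarrow> dist w (v k) < e \<longrightarrow> Re ((A k z - A j z) * w) > 0"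
    using good_neighbourhood[OF assms] by metis
  \<comment> \<open>\<open>3 * R < e\<close> keeps the mollified potential inside the good disc, and
    \<open>T < R\<close> puts \<open>q k\<close> into \<open>ball p R\<close>. With
    \<open>\<delta> = e * T\<close>, the vector \<open>(q k - z) / T\<close> differs from
    \<open>v k\<close> by less than \<open>e\<close>, so it stays in the cone for every
    \<open>z\<close> in \<open>ball p \<delta>\<close>; \<open>e < 1\<close> gives
    \<open>\<delta> < T\<close>.\<close>
  define R where "R = e / 4"
  define T where "T = R / 2"
  define \<delta> where "\<delta> = e * T"
  define q where "q k = p + of_real T * v k" for k
  have RT: "0 < R" "R < 1 / 4" "0 < T" "T < R" "3 * R < e" "\<delta> > 0" "\<delta> < T" "\<delta> < e"
    using e by (auto simp: R_def T_def \<delta>_def)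
  have Q: "cball p (3 * R) \<subseteq> U" "cball p (3 * R) \<subseteq> ball p e" using N RT by auto
  have qp: "norm (q k - p) = T" if "k \<in> ?I" for k
    using v that RT by (simp add: q_def norm_mult)
  have qR: "q k \<in> ball p R" if "k \<in> ?I" for k
    using qp[OF that] RT by (simp add: dist_norm norm_minus_commute)
  have dR: "z \<in> ball p R" if "z \<in> ball p \<delta>" for z using that RT by auto
  have q1: "norm (q k - z) \<le> 1" if "k \<in> ?I" "z \<in> ball p \<delta>" for k z
  proof -
    have "norm (q k - z) \<le> norm (q k - p) + norm (p - z)" using norm_triangle_ineq[of "q k - p" "p - z"] by simp
    then show ?thesis using qp[OF that(1)] that(2) RT by (simp add: dist_norm)
  qed
  have dir: "Re ((A k y - A j y) * (q k - z)) > 0"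
    if k: "k \<in> ?I" and z: "z \<in> ball p \<delta>" and j: "j \<in> ?I - {k}" and y: "y \<in> ball p e" for k j z y
  proof -
    define w where "w = (q k - z) / of_real T"
    have w: "q k - z = of_real T * w" using RT by (simp add: w_def)
    have "w - v k = (p - z) / of_real T" using RT by (simp add: w_def q_def field_simps)
    then have "dist w (v k) = norm (p - z) / T" using RT by (simp add: dist_norm norm_divide)
    also have "\<dots> < e" using z RT by (simp add: dist_norm \<delta>_def divide_less_eq)
    finally have "Re ((A k y - A j y) * w) > 0" using pos k j y by (simp add: dist_commute)
    then have "T * Re ((A k y - A j y) * w) > 0" using RT by simp
    also have "T * Re ((A k y - A j y) * w) = Re ((A k y - A j y) * (q k - z))" by (simp add: w algebra_simps)
    finally show ?thesis .
  qed
  have seg: "closed_segment z (q k) \<subseteq> M k" if k: "k \<in> ?I" and z: "z \<in> M k" "z \<in> ball p \<delta>" for k z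
  proof
    fix x assume "x \<in> closed_segment z (q k)"
    then obtain s where s: "0 \<le> s" "s \<le> 1" "x = (1 - s) *\<^sub>R z + s *\<^sub>R q k" unfolding closed_segment_def by blast
    then have x: "x = z + of_real s * (q k - z)" by (simp add: scaleR_conv_of_real algebra_simps)
    have zN: "z \<in> ball p e" "q k \<in> ball p e" using z(2) qR[OF k] RT by auto
    show "x \<in> M k"
    proof (cases "s = 0")
      case False
      show ?thesis unfolding x
      proof (rule absorbing[OF I(2)[OF k], of "ball p e"])
        show "z + of_real s * (q k - z) \<in> ball p e"
          using zN s convexD[OF convex_ball zN, of "1 - s" s] unfolding x[symmetric] by simp
        show "\<forall>j\<in>{1..r} - {k}. M j \<inter> ball p e \<noteq> {} \<longrightarrow> (\<forall>y\<in>ball p e. 0 < Re ((A k y - A j y) * (of_real s * (q k - z))))"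
        proof (intro ballI impI)
          fix j y assume j: "j \<in> {1..r} - {k}" "M j \<inter> ball p e \<noteq> {}" and y: "y \<in> ball p e"
          then have "j \<in> ?I - {k}" using out by blast
          from dir[OF k z(2) this y] have "s * Re ((A k y - A j y) * (q k - z)) > 0" using s False by simp
          also have "s * Re ((A k y - A j y) * (q k - z)) = Re ((A k y - A j y) * (of_real s * (q k - z)))"
            by (simp add: algebra_simps)
          finally show "0 < Re ((A k y - A j y) * (of_real s * (q k - z)))" .
        qed
      qed (use z zN N in auto)
    qed (use x z in simp)
  qed
  have AEN: "AE w in lebesgue. w \<in> ball p e \<longrightarrow> (\<exists>j\<in>?I. w \<in> M j \<and> \<Phi> w = A j w)"
    using AE_Phi
  proof eventually_elim
    case (elim w)
    show ?case
    proof
      assume w: "w \<in> ball p e"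
      then obtain i where i: "i \<in> {1..r}" "w \<in> M i" "\<Phi> w = A i w" using elim N by blast
      then have "i \<in> ?I" using out w by blast
      with i show "\<exists>j\<in>?I. w \<in> M j \<and> \<Phi> w = A j w" by blast
    qed
  qed
  have cA: "continuous_on (cball p (3 * R)) (A j)" if "j \<in> ?I" for j
    using A_continuous[OF I(2)[OF that]] Q(1) continuous_on_subset by blast
  have "bounded (\<Union>j\<in>?I. A j ` cball p (3 * R))"
    using I(1) cA by (intro bounded_UN ballI compact_imp_bounded compact_continuous_image) auto
  then obtain C where C: "\<And>j w. j \<in> ?I \<Longrightarrow> w \<in> cball p (3 * R) \<Longrightarrow> norm (A j w) \<le> C"
    unfolding bounded_iff by blast
  have "C \<ge> 0" if "?I \<noteq> {}"
  proof -
    from that obtain j where "j \<in> ?I" by blast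
    from C[OF this, of p] RT have "norm (A j p) \<le> C" by simp
    then show ?thesis using norm_ge_zero[of "A j p"] by linarith
  qed
  have fd: "(f i has_field_derivative A i w) (at w)" if "i \<in> ?I" "w \<in> U" for i w
    using prim I(2)[OF that(1)] that(2) by blast
  have main: "Re (f j z - f j p) \<le> Re (f k z - f k p)"
    if k: "k \<in> ?I" and j: "j \<in> ?I" and z: "z \<in> M k" "z \<in> ball p \<delta>" for k j z
  proof -
    have C0: "C \<ge> 0" using k \<open>?I \<noteq> {} \<Longrightarrow> C \<ge> 0\<close> by blast
    have le: "Re (f j z - f j p) \<le> Re (f k z - f k p) + (2 * C + 6) * \<eta>" if \<eta>: "\<eta> > 0" for \<eta>
    proof -
      \<comment> \<open>\<open>p\<close> may lie on the frontier of \<open>M i\<close>, so a point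
        of \<open>M i\<close> close to it stands in for it, at the price of one
        \<open>\<eta>\<close>.\<close>
      have near: "\<exists>x\<in>M i. x \<in> ball p \<delta> \<and> norm (x - p) < \<eta> \<and> \<bar>Re (f i x - f i p)\<bar> < \<eta>" if i: "i \<in> ?I" for i
      proof -
        have "isCont (f i) p" using fd[OF i p] DERIV_isCont by blast
        then obtain s where s: "s > 0" "\<And>x. dist x p < s \<Longrightarrow> dist (f i x) (f i p) < \<eta>"
          using \<eta> unfolding continuous_at_eps_delta by blast
        have "min s (min \<delta> \<eta>) > 0" using s \<eta> RT by simp
        then obtain x where x: "x \<in> M i" "dist x p < min s (min \<delta> \<eta>)"
          using I(3)[OF i] unfolding closure_approachable by blast
        have "\<bar>Re (f i x - f i p)\<bar> < \<eta>"
          using s(2)[of x] x(2) abs_Re_le_cmod[of "f i x - f i p"] by (simp add: dist_norm)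
        with x show ?thesis by (auto simp: dist_norm norm_minus_commute)
      qed
      obtain pk where pk: "pk \<in> M k" "pk \<in> ball p \<delta>" "norm (pk - p) < \<eta>" "\<bar>Re (f k pk - f k p)\<bar> < \<eta>"
        using near[OF k] by blast
      obtain pj where pj: "pj \<in> M j" "pj \<in> ball p \<delta>" "norm (pj - p) < \<eta>" "\<bar>Re (f j pj - f j p)\<bar> < \<eta>"
        using near[OF j] by blast
      have uc: "\<exists>d>0. \<forall>x\<in>cball p (3 * R). \<forall>w\<in>cball p (3 * R). dist w x < d \<longrightarrow> norm (A i w - A i x) < \<eta>" if "i \<in> ?I" for i
        using compact_uniformly_continuous[OF cA[OF that] compact_cball] \<eta>
        unfolding uniformly_continuous_on_def dist_norm by blast
      obtain d1 where d1: "d1 > 0" "\<forall>x\<in>cball p (3 * R). \<forall>w\<in>cball p (3 * R). dist w x < d1 \<longrightarrow> norm (A k w - A k x) < \<eta>"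
        using uc[OF k] by blast
      obtain d2 where d2: "d2 > 0" "\<forall>x\<in>cball p (3 * R). \<forall>w\<in>cball p (3 * R). dist w x < d2 \<longrightarrow> norm (A j w - A j x) < \<eta>"
        using uc[OF j] by blast
      obtain d3 where d3: "d3 > 0" "\<forall>w\<in>closed_segment z (q k). ball w d3 \<subseteq> M k"
        using closed_segment_neighbourhood[OF seg[OF k z] open_M[OF I(2)[OF k]]] by blast
      obtain d4 where d4: "d4 > 0" "\<forall>w\<in>closed_segment pj (q j). ball w d4 \<subseteq> M j"
        using closed_segment_neighbourhood[OF seg[OF j pj(1,2)] open_M[OF I(2)[OF j]]] by blast
      \<comment> \<open>The averaging discs of radius \<open>2 * e'\<close> must fit the moduli of
        continuity of both branches and the tubes around both segments inside their pieces;
        \<open>R\<close> is the cap imposed by the potential.\<close>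
      define e' where "e' = min R (min (min d1 d2) (min d3 d4) / 2)"
      have e': "0 < e'" "e' \<le> R" "2 * e' \<le> d1" "2 * e' \<le> d2" "2 * e' \<le> d3" "2 * e' \<le> d4"
        using RT d1(1) d2(1) d3(1) d4(1) by (auto simp: e'_def)
      obtain \<phi> G where \<phi>: "\<And>w. w \<in> ball p R \<Longrightarrow> (\<phi> has_derivative (\<lambda>h. Re (G w * h))) (at w)"
        and G: "\<And>w c b. w \<in> ball p R \<Longrightarrow> (AE x in lebesgue. x \<in> ball w (2 * e') \<longrightarrow> Re (c * \<Phi> x) \<le> b) \<Longrightarrow> Re (c * G w) \<le> b"
        using mollified_potential[OF Sigma Q(1) e'(1,2)] by metis
      have in3R: "x \<in> cball p (3 * R)" if "w \<in> ball p R" "x \<in> ball w (2 * e')" for w x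
      proof -
        have "dist p x \<le> dist p w + dist w x" by (rule dist_triangle)
        with that e'(2) show ?thesis by simp
      qed
      have est: "Re (c * G w) \<le> Re (c * A i w) + norm c * \<eta>"
        if i: "i = k \<or> i = j" and w: "w \<in> ball p R"
          and ae: "AE x in lebesgue. x \<in> ball w (2 * e') \<longrightarrow> Re (c * \<Phi> x) \<le> Re (c * A i x)" for i w c
      proof (rule G[OF w])
        show "AE x in lebesgue. x \<in> ball w (2 * e') \<longrightarrow> Re (c * \<Phi> x) \<le> Re (c * A i w) + norm c * \<eta>"
          using ae
        proof eventually_elim
          case (elim x)
          show ?case
          proof
            assume x: "x \<in> ball w (2 * e')"
            have "w \<in> cball p (3 * R)" using w RT by auto
            moreover have "dist x w < 2 * e'" using x by (simp add: dist_commute)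
            ultimately have "norm (A i x - A i w) < \<eta>"
              using i d1(2) d2(2) in3R[OF w x] e' by fastforce
            then have "norm (c * (A i x - A i w)) \<le> norm c * \<eta>"
              by (simp add: norm_mult mult_left_mono)
            then have "Re (c * (A i x - A i w)) \<le> norm c * \<eta>" using complex_Re_le_cmod order_trans by blast
            then show "Re (c * \<Phi> x) \<le> Re (c * A i w) + norm c * \<eta>" using elim x by (simp add: algebra_simps)
          qed
        qed
      qed
      have sR: "closed_segment x y \<subseteq> ball p R" if "x \<in> ball p R" "y \<in> ball p R" for x y
        using that by (intro closed_segment_subset) auto
      have RU: "ball p R \<subseteq> U" using Q RT by auto
      \<comment> \<open>\<open>x\<close> need not lie in \<open>M i\<close>: every other adherent
        branch has a smaller real part in direction \<open>q i - x\<close>, so \<open>\<Phi>\<close>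
        never exceeds \<open>A i\<close> there.\<close>
      have down: "\<phi> (q i) - Re (f i (q i)) \<le> \<phi> x - Re (f i x) + \<eta>"
        if i: "i = k \<or> i = j" and x: "x \<in> ball p \<delta>" for i x
      proof -
        have iI: "i \<in> ?I" using i k j by blast
        have "\<phi> (q i) - Re (f i (q i)) \<le> \<phi> x - Re (f i x) + norm (q i - x) * \<eta>"
        proof (rule segment_increment)
          fix w assume "w \<in> closed_segment x (q i)"
          then have w: "w \<in> ball p R" using sR[OF dR[OF x] qR[OF iI]] by blast
          show "(\<phi> has_derivative (\<lambda>h. Re (G w * h))) (at w)" by (rule \<phi>[OF w])
          show "(f i has_field_derivative A i w) (at w)" using fd[OF iI] w RU by blast
          show "Re ((q i - x) * G w) \<le> Re ((q i - x) * A i w) + norm (q i - x) * \<eta>"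
          proof (rule est[OF i w])
            show "AE y in lebesgue. y \<in> ball w (2 * e') \<longrightarrow> Re ((q i - x) * \<Phi> y) \<le> Re ((q i - x) * A i y)"
              using AEN
            proof eventually_elim
              case (elim y)
              show ?case
              proof
                assume "y \<in> ball w (2 * e')"
                then have y: "y \<in> ball p e" using in3R[OF w] Q(2) by blast
                then obtain l where l: "l \<in> ?I" "\<Phi> y = A l y" using elim by blast
                show "Re ((q i - x) * \<Phi> y) \<le> Re ((q i - x) * A i y)"
                proof (cases "l = i")
                  case False
                  then have "Re ((A i y - A l y) * (q i - x)) > 0" using dir[OF iI x _ y] l(1) by blast
                  then show ?thesis by (simp add: l(2) algebra_simps)
                qed (simp add: l(2))
              qed
            qed
          qed
        qed
        also have "norm (q i - x) * \<eta> \<le> 1 * \<eta>" using q1[OF iI x] \<eta> by (intro mult_right_mono) auto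
        finally show ?thesis by simp
      qed
      \<comment> \<open>The reverse inequality needs \<open>\<Phi> = A i\<close> almost everywhere
        around the segment, hence the tube inside \<open>M i\<close>.\<close>
      have up: "\<phi> x - Re (f i x) \<le> \<phi> (q i) - Re (f i (q i)) + \<eta>"
        if i: "i = k \<or> i = j" and x: "x \<in> ball p \<delta>" and nb: "\<forall>w\<in>closed_segment x (q i). ball w (2 * e') \<subseteq> M i" for i x
      proof -
        have iI: "i \<in> ?I" using i k j by blast
        have "\<phi> x - Re (f i x) \<le> \<phi> (q i) - Re (f i (q i)) + norm (x - q i) * \<eta>"
        proof (rule segment_increment)
          fix w assume "w \<in> closed_segment (q i) x"
          then have ws: "w \<in> closed_segment x (q i)" by (simp add: closed_segment_commute)
          then have w: "w \<in> ball p R" using sR[OF dR[OF x] qR[OF iI]] by blast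
          show "(\<phi> has_derivative (\<lambda>h. Re (G w * h))) (at w)" by (rule \<phi>[OF w])
          show "(f i has_field_derivative A i w) (at w)" using fd[OF iI] w RU by blast
          show "Re ((x - q i) * G w) \<le> Re ((x - q i) * A i w) + norm (x - q i) * \<eta>"
          proof (rule est[OF i w])
            show "AE y in lebesgue. y \<in> ball w (2 * e') \<longrightarrow> Re ((x - q i) * \<Phi> y) \<le> Re ((x - q i) * A i y)"
              using AE_Phi
            proof eventually_elim
              case (elim y)
              show ?case
              proof
                assume "y \<in> ball w (2 * e')"
                then have "y \<in> M i" using nb ws by blast
                then have "\<Phi> y = A i y" using elim M_subset[OF I(2)[OF iI]] I(2)[OF iI] by blast
                then show "Re ((x - q i) * \<Phi> y) \<le> Re ((x - q i) * A i y)" by simp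
              qed
            qed
          qed
        qed
        also have "norm (x - q i) * \<eta> \<le> 1 * \<eta>" using q1[OF iI x] \<eta> by (intro mult_right_mono) (auto simp: norm_minus_commute)
        finally show ?thesis by simp
      qed
      have s1: "\<phi> z - Re (f k z) \<le> \<phi> (q k) - Re (f k (q k)) + \<eta>"
        using d3(2) e'(5) z by (intro up) (auto dest!: bspec simp: subset_iff)
      have s2: "\<phi> (q k) - Re (f k (q k)) \<le> \<phi> pk - Re (f k pk) + \<eta>" by (rule down) (use pk in auto)
      have s3: "\<phi> (q j) - Re (f j (q j)) \<le> \<phi> z - Re (f j z) + \<eta>" by (rule down) (use z in auto)
      have s4: "\<phi> pj - Re (f j pj) \<le> \<phi> (q j) - Re (f j (q j)) + \<eta>"
        using d4(2) e'(6) pj by (intro up) (auto dest!: bspec simp: subset_iff)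
      \<comment> \<open>Near \<open>p\<close> no branch is involved: the bound \<open>C\<close> on
        \<open>\<Phi>\<close> alone makes the potential nearly equal at the two substitutes for
        \<open>p\<close>.\<close>
      have "\<phi> pk - Re 0 \<le> \<phi> pj - Re 0 + norm (pk - pj) * C"
      proof (rule segment_increment[where f = "\<lambda>_. 0" and a = "\<lambda>_. 0"])
        fix w assume "w \<in> closed_segment pj pk"
        then have w: "w \<in> ball p R" using sR[OF dR[OF pj(2)] dR[OF pk(2)]] by blast
        show "(\<phi> has_derivative (\<lambda>h. Re (G w * h))) (at w)" by (rule \<phi>[OF w])
        have "Re ((pk - pj) * G w) \<le> norm (pk - pj) * C"
        proof (rule G[OF w])
          show "AE y in lebesgue. y \<in> ball w (2 * e') \<longrightarrow> Re ((pk - pj) * \<Phi> y) \<le> norm (pk - pj) * C"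
            using AEN
          proof eventually_elim
            case (elim y)
            show ?case
            proof
              assume "y \<in> ball w (2 * e')"
              then have y: "y \<in> cball p (3 * R)" using in3R[OF w] by blast
              then obtain l where l: "l \<in> ?I" "\<Phi> y = A l y" using elim Q(2) by blast
              have "Re ((pk - pj) * \<Phi> y) \<le> norm ((pk - pj) * \<Phi> y)" by (rule complex_Re_le_cmod)
              also have "\<dots> \<le> norm (pk - pj) * C" using C[OF l(1) y] l(2) by (simp add: norm_mult mult_left_mono)
              finally show "Re ((pk - pj) * \<Phi> y) \<le> norm (pk - pj) * C" .
            qed
          qed
        qed
        then show "Re ((pk - pj) * G w) \<le> Re ((pk - pj) * 0) + norm (pk - pj) * C" by simp
      qed simp
      moreover have "norm (pk - pj) * C \<le> (2 * \<eta>) * C"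
      proof (rule mult_right_mono[OF _ C0])
        show "norm (pk - pj) \<le> 2 * \<eta>"
          using norm_triangle_ineq4[of "pk - p" "pj - p"] pk(3) pj(3) by simp
      qed
      ultimately have s5: "\<phi> pk \<le> \<phi> pj + 2 * C * \<eta>" by (simp add: algebra_simps)
      \<comment> \<open>The four cone estimates cost \<open>4 * \<eta>\<close>, replacing
        \<open>pk\<close> and \<open>pj\<close> by \<open>p\<close> inside the branches costs
        \<open>2 * \<eta>\<close>, and the potential between them \<open>2 * C * \<eta>\<close>;
        this is the constant \<open>2 * C + 6\<close>.\<close>
      show ?thesis using s1 s2 s3 s4 s5 pk(4) pj(4) by (simp add: algebra_simps)
    qed
    show ?thesis
    proof (rule field_le_epsilon)
      fix x :: real assume "x > 0"
      with C0 have "x / (2 * C + 6) > 0" by simp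
      from le[OF this] C0 show "Re (f j z - f j p) \<le> Re (f k z - f k p) + x" by simp
    qed
  qed
  have "ball p \<delta> \<subseteq> ball p e" using RT by auto
  then show ?thesis using RT(6) N out main by (intro exI[of _ \<delta>]) blast
qed


text \<open>Otherwise no piece would meet the disc, although almost every point of \<open>U\<close>
  lies in a piece. It makes the maximum meaningful.\<close>

lemma Iset_nonempty:
  assumes "p \<in> U" "\<delta> > 0" "ball p \<delta> \<subseteq> U" "\<forall>j\<in>{1..r} - Iset U r M p. M j \<inter> ball p \<delta> = {}"
  shows "Iset U r M p \<noteq> {}"
proof
  assume "Iset U r M p = {}"
  with assms(4) have no: "\<forall>j\<in>{1..r}. M j \<inter> ball p \<delta> = {}" by simp
  have "AE z in lebesgue. z \<notin> ball p \<delta>"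
    using AE_Phi by eventually_elim (use no assms(3) in blast)
  then have "ball p \<delta> = {}" by (rule AE_lebesgue_not_open) simp
  with assms(2) show False by simp
qed

text \<open>The maximum \<open>m\<close> is Lipschitz, and on each open set \<open>M k\<close>
  inside the disc it coincides with branch \<open>k\<close>, so its derivative along
  \<open>v\<close> is \<open>Re (v * \<Phi>)\<close> almost everywhere. Integration by parts for
  \<open>v = 1\<close> and \<open>v = \<i>\<close> gives the real and imaginary parts of the
  claim.\<close>

lemma two_dz_Max:
  assumes prim: "\<forall>i\<in>{1..r}. f i holomorphic_on U \<and> (\<forall>z\<in>U. (f i has_field_derivative A i z) (at z))"
    and I: "finite I" "I \<subseteq> {1..r}" "I \<noteq> {}" and \<delta>: "\<delta> > 0" "cball p \<delta> \<subseteq> U"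
    and out: "\<forall>j\<in>{1..r} - I. M j \<inter> ball p \<delta> = {}"
    and dom: "\<forall>k\<in>I. \<forall>j\<in>I. \<forall>z\<in>M k \<inter> ball p \<delta>. Re (f j z - f j p) \<le> Re (f k z - f k p)"
  shows "two_dz_eq_on (ball p \<delta>) (\<lambda>z. Max ((\<lambda>j. Re (f j z - f j p)) ` I)) \<Phi>"
  unfolding two_dz_eq_on_def
proof (intro allI impI)
  fix \<psi> assume \<psi>: "test_fun \<psi> (ball p \<delta>)"
  define W where "W = ball p \<delta>"
  define u where "u j z = Re (f j z - f j p)" for j z
  define m where "m z = Max ((\<lambda>j. u j z) ` I)" for z
  have WU: "W \<subseteq> U" "open W" "convex W" using \<delta> by (auto simp: W_def)
  have cA: "continuous_on (cball p \<delta>) (A j)" if "j \<in> I" for j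
    using A_continuous[of j] I(2) that \<delta>(2) continuous_on_subset by blast
  have "bounded (\<Union>j\<in>I. A j ` cball p \<delta>)"
    using I(1) cA by (intro bounded_UN ballI compact_imp_bounded compact_continuous_image) auto
  then obtain C0 where C0: "\<And>j w. j \<in> I \<Longrightarrow> w \<in> cball p \<delta> \<Longrightarrow> norm (A j w) \<le> C0"
    unfolding bounded_iff by blast
  define C where "C = \<bar>C0\<bar>"
  have C: "C \<ge> 0" by (simp add: C_def)
  have AC: "norm (A j w) \<le> C" if "j \<in> I" "w \<in> W" for j w
    using C0[of j w] that by (auto simp: C_def W_def)
  have fd: "(f j has_field_derivative A j w) (at w)" if "j \<in> I" "w \<in> W" for j w
    using prim I(2) WU(1) that by blast
  have lu: "u j x \<le> u j y + C * norm (x - y)" if "j \<in> I" "x \<in> W" "y \<in> W" for j x y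
  proof -
    have "norm (f j x - f j y) \<le> C * norm (x - y)"
      using fd[OF that(1)] AC[OF that(1)] that WU(3)
      by (intro field_differentiable_bound[of W "f j" "A j"]) (auto intro: has_field_derivative_at_within)
    moreover have "Re (f j x - f j y) \<le> norm (f j x - f j y)" by (rule complex_Re_le_cmod)
    ultimately show ?thesis by (simp add: u_def)
  qed
  have lm1: "m x \<le> m y + C * norm (x - y)" if "x \<in> W" "y \<in> W" for x y
  proof -
    have "u j x \<le> m y + C * norm (x - y)" if j: "j \<in> I" for j
    proof -
      have "u j y \<le> m y" unfolding m_def using I(1) j by (intro Max_ge) auto
      then show ?thesis using lu[OF j \<open>x \<in> W\<close> \<open>y \<in> W\<close>] by linarith
    qed
    then show ?thesis unfolding m_def[of x] using I by (intro Max.boundedI) auto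
  qed
  have lm: "\<bar>m x - m y\<bar> \<le> C * norm (x - y)" if "x \<in> W" "y \<in> W" for x y
    using lm1[OF that] lm1[OF that(2,1)] by (simp add: norm_minus_commute abs_le_iff)
  have pW: "p \<in> W" using \<delta> by (simp add: W_def)
  \<comment> \<open>Normalising the branches at \<open>p\<close> bounds \<open>m\<close> by
    \<open>C * \<delta>\<close>, which enters the Lipschitz constant of the product
    \<open>m * \<psi>\<close>.\<close>
  have "m p = 0" unfolding m_def u_def using I by simp
  then have mb: "\<bar>m x\<bar> \<le> C * \<delta>" if "x \<in> W" for x
    using lm[OF that pW] mult_left_mono[OF _ C, of "norm (x - p)" \<delta>] that
    by (simp add: W_def dist_norm norm_minus_commute)
  have cm: "continuous_on W m"
  proof -
    have "C-lipschitz_on W m" using lm C by (intro lipschitz_onI) (auto simp: dist_norm)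
    then show ?thesis by (rule lipschitz_on_continuous_on)
  qed
  have m_eq: "m z = u k z" if "k \<in> I" "z \<in> M k" "z \<in> W" for k z
    unfolding m_def using I(1) that dom by (intro Max_eqI) (auto simp: u_def W_def)
  obtain L where L: "L \<ge> 0" "\<And>x y. \<bar>\<psi> x - \<psi> y\<bar> \<le> L * norm (x - y)"
    using test_fun_lipschitz[OF \<psi>] by auto
  have K: "compact (tsupport \<psi>)" "tsupport \<psi> \<subseteq> W" "smooth_fun \<psi>" using \<psi> by (auto simp: test_fun_def W_def)
  obtain B where B: "B > 0" "\<And>z. norm (\<psi> z) \<le> B"
    using compact_support_bounded[OF test_fun_continuous(1)[OF \<psi>] K(1)] tsupport_zero by blast
  have \<psi>0: "\<psi> z = 0" if "z \<notin> W" for z using that K(2) tsupport_zero by blast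
  define H where "H z = m z * \<psi> z" for z
  have lip: "\<bar>H x - H y\<bar> \<le> (C * \<delta> * L + B * C) * norm (x - y)" for x y
  proof -
    have one: "\<bar>H x - H y\<bar> \<le> (C * \<delta> * L + B * C) * norm (x - y)" if x: "x \<in> W" for x y
    proof -
      have 1: "\<bar>m x * (\<psi> x - \<psi> y)\<bar> \<le> (C * \<delta>) * (L * norm (x - y))"
        unfolding abs_mult using mb[OF x] L(2) C \<delta>(1) by (intro mult_mono) auto
      have 2: "\<bar>\<psi> y * (m x - m y)\<bar> \<le> B * (C * norm (x - y))"
      proof (cases "y \<in> W")
        case True
        then show ?thesis unfolding abs_mult using B lm[OF x True] by (intro mult_mono) auto
      next
        case False
        then show ?thesis using \<psi>0 B(1) C by simp
      qed
      have "H x - H y = m x * (\<psi> x - \<psi> y) + \<psi> y * (m x - m y)" by (simp add: H_def algebra_simps)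
      then show ?thesis using 1 2 by (simp add: algebra_simps)
    qed
    show ?thesis
    proof (cases "x \<in> W")
      case False
      show ?thesis
      proof (cases "y \<in> W")
        case True
        from one[OF this, of x] show ?thesis by (simp add: abs_minus_commute norm_minus_commute)
      next
        case False
        then show ?thesis using \<open>x \<notin> W\<close> \<psi>0 B(1) C L(1) \<delta>(1) by (simp add: H_def)
      qed
    qed (rule one)
  qed
  have t: "test_fun \<psi> W" "test_fun \<psi> U" using \<psi> test_fun_mono[OF \<psi>] WU(1) by (auto simp: W_def)
  have im: "integrable lebesgue (\<lambda>z. complex_of_real (m z) * complex_of_real (frechet_derivative \<psi> (at z) v))" for v
    using cm by (intro test_fun_integrable(2)[OF continuous_loc_integrable t(1)] continuous_intros)
  have imR: "integrable lebesgue (\<lambda>z. m z * frechet_derivative \<psi> (at z) v)" for v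
    using integrable_Re[OF im[of v]] by simp
  have i\<Phi>: "integrable lebesgue (\<lambda>z. \<Phi> z * complex_of_real (\<psi> z))"
    by (rule test_fun_integrable(1)[OF loc_Phi t(2)])
  have i\<Phi>R: "integrable lebesgue (\<lambda>z. Re (v * \<Phi> z) * \<psi> z)" for v
    using integrable_Re[OF integrable_mult_right[OF i\<Phi>, of v]] by (simp add: algebra_simps)
  have parts: "(LINT z|lebesgue. m z * frechet_derivative \<psi> (at z) v) = - (LINT z|lebesgue. Re (v * \<Phi> z) * \<psi> z)" for v
  proof -
    have "(LINT z|lebesgue. m z * frechet_derivative \<psi> (at z) v + Re (v * \<Phi> z) * \<psi> z) = 0"
    proof (rule integral_directional_derivative_zero[OF lip, of "tsupport \<psi>"])
      show "bounded (tsupport \<psi>)" using K(1) by (rule compact_imp_bounded)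
      show "H z = 0" if "z \<notin> tsupport \<psi>" for z using that by (simp add: H_def tsupport_zero)
      show "(\<lambda>z. m z * frechet_derivative \<psi> (at z) v + Re (v * \<Phi> z) * \<psi> z) \<in> borel_measurable lebesgue"
        using imR i\<Phi>R by (intro borel_measurable_add borel_measurable_integrable)
      \<comment> \<open>Outside the support of \<open>\<psi>\<close> everything vanishes; inside it
        almost every point belongs to some piece, so ties on the frontiers need no
        derivative.\<close>
      show "AE z in lebesgue. \<exists>D. (H has_derivative D) (at z) \<and> D v = m z * frechet_derivative \<psi> (at z) v + Re (v * \<Phi> z) * \<psi> z"
        using AE_Phi
      proof eventually_elim
        case (elim z)
        show ?case
        proof (cases "z \<in> tsupport \<psi>")
          case False
          have "((\<lambda>_. 0) has_derivative (\<lambda>_. 0)) (at z)" by simp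
          moreover have "open (- tsupport \<psi>)" "z \<in> - tsupport \<psi>" using False K(1) by (auto simp: compact_imp_closed)
          ultimately have "(H has_derivative (\<lambda>_. 0)) (at z)"
            by (rule has_derivative_transform_within_open) (simp add: H_def tsupport_zero)
          moreover have "\<psi> z = 0" "frechet_derivative \<psi> (at z) v = 0" using test_fun_zero[OF False] by auto
          ultimately show ?thesis by (intro exI[of _ "\<lambda>_. 0"]) simp
        next
          case True
          then have zW: "z \<in> W" using K(2) by blast
          then obtain k where k: "k \<in> {1..r}" "z \<in> M k" "\<Phi> z = A k z" using elim WU(1) by blast
          then have kI: "k \<in> I" using out zW unfolding W_def by blast
          have "(f k has_derivative (\<lambda>h. A k z * h)) (at z)"
            using fd[OF kI zW] by (simp add: has_field_derivative_def)
          then have "(u k has_derivative (\<lambda>h. Re (A k z * h))) (at z)"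
            unfolding u_def by (auto intro!: derivative_eq_intros)
          then have "((\<lambda>z. u k z * \<psi> z) has_derivative (\<lambda>h. u k z * frechet_derivative \<psi> (at z) h + Re (A k z * h) * \<psi> z)) (at z)"
            by (intro has_derivative_mult smooth_fun_has_derivative K(3))
          moreover have "open (M k \<inter> W)" "z \<in> M k \<inter> W" using open_M[OF k(1)] WU(2) k(2) zW by auto
          ultimately have "(H has_derivative (\<lambda>h. u k z * frechet_derivative \<psi> (at z) h + Re (A k z * h) * \<psi> z)) (at z)"
            by (rule has_derivative_transform_within_open) (simp add: H_def m_eq[OF kI])
          then show ?thesis using m_eq[OF kI k(2) zW] k(3) by (intro exI conjI) (auto simp: mult.commute)
        qed
      qed
    qed
    then show ?thesis using imR i\<Phi>R by simp
  qed
  have "(LINT z|lebesgue. complex_of_real (m z) * dz \<psi> z) =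
    (LINT z|lebesgue. (complex_of_real (m z) * complex_of_real (frechet_derivative \<psi> (at z) 1)
      - \<i> * (complex_of_real (m z) * complex_of_real (frechet_derivative \<psi> (at z) \<i>))) / 2)"
    by (simp add: dz_def algebra_simps)
  also have "\<dots> = ((LINT z|lebesgue. complex_of_real (m z) * complex_of_real (frechet_derivative \<psi> (at z) 1))
      - \<i> * (LINT z|lebesgue. complex_of_real (m z) * complex_of_real (frechet_derivative \<psi> (at z) \<i>))) / 2"
    using im by simp
  also have "\<dots> = (complex_of_real (LINT z|lebesgue. m z * frechet_derivative \<psi> (at z) 1)
      - \<i> * complex_of_real (LINT z|lebesgue. m z * frechet_derivative \<psi> (at z) \<i>)) / 2"
    by (simp flip: of_real_mult)
  finally have 1: "- 2 * (LINT z|lebesgue. complex_of_real (m z) * dz \<psi> z) =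
      complex_of_real (LINT z|lebesgue. Re (1 * \<Phi> z) * \<psi> z) - \<i> * complex_of_real (LINT z|lebesgue. Re (\<i> * \<Phi> z) * \<psi> z)"
    unfolding parts by (simp only:) simp
  have "Re (pair \<Phi> \<psi>) = (LINT z|lebesgue. Re (1 * \<Phi> z) * \<psi> z)"
    unfolding pair_def by (subst integral_Re[OF i\<Phi>, symmetric]) simp
  moreover have "Im (pair \<Phi> \<psi>) = - (LINT z|lebesgue. Re (\<i> * \<Phi> z) * \<psi> z)"
    unfolding pair_def by (subst integral_Im[OF i\<Phi>, symmetric]) simp
  ultimately have "- 2 * (LINT z|lebesgue. complex_of_real (m z) * dz \<psi> z) = pair \<Phi> \<psi>"
    unfolding 1 by (simp add: complex_eq_iff)
  then show "- 2 * (LINT z|lebesgue. complex_of_real (Max ((\<lambda>j. Re (f j z - f j p)) ` I)) * dz \<psi> z) = pair \<Phi> \<psi>"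
    unfolding m_def u_def .
qed

end

theorem theorem3:
  fixes U :: "complex set" and \<Phi> :: "complex \<Rightarrow> complex" and r :: nat
    and A :: "nat \<Rightarrow> complex \<Rightarrow> complex" and M :: "nat \<Rightarrow> complex set"
    and f :: "nat \<Rightarrow> complex \<Rightarrow> complex"
  assumes "open U" and "connected U" and "simply_connected U"
    and canon: "canonical_data U \<Phi> r A M"
    and sum_rep: "AE z in lebesgue. z \<in> U \<longrightarrow> \<Phi> z = (\<Sum>i\<in>{1..r}. A i z * indicator (M i) z)"
    and Sigma: "\<Phi> \<in> Sigma_cls U"
    and prim: "\<forall>i\<in>{1..r}. f i holomorphic_on U \<and> (\<forall>z\<in>U. (f i has_field_derivative A i z) (at z))"
    and hyp_i: "\<forall>j k l. 1 \<le> j \<and> j < k \<and> k < l \<and> l \<le> r \<longrightarrow>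
                  hausdorff1 (U \<inter> frontier (M j) \<inter> frontier (M k) \<inter> frontier (M l)) = 0"
    and hyp_ii: "\<forall>p\<in>U. card (Iset U r M p) > 1 \<longrightarrow>
                  (\<forall>k\<in>Iset U r M p. 0 \<notin> Vset (Iset U r M p) f p k)"
  shows "\<forall>p\<in>U. \<exists>W. open W \<and> p \<in> W \<and> W \<subseteq> U \<and>
           two_dz_eq_on W (\<lambda>z. Max ((\<lambda>j. Re (f j z - f j p)) ` Iset U r M p)) \<Phi>"
proof
  interpret piecewise_analytic U \<Phi> r A M
    by standard (fact assms)+
  fix p assume p: "p \<in> U"
  let ?I = "Iset U r M p"
  obtain d where d: "d > 0" "ball p d \<subseteq> U" "\<forall>j\<in>{1..r} - ?I. M j \<inter> ball p d = {}"
    "\<forall>k\<in>?I. \<forall>j\<in>?I. \<forall>z\<in>M k \<inter> ball p d. Re (f j z - f j p) \<le> Re (f k z - f k p)"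
    using dominant_piece[OF p prim hyp_ii] by blast
  \<comment> \<open>Halving the radius provides a closed disc inside \<open>U\<close>, on which
    compactness bounds the branches \<open>A j\<close>.\<close>
  have sub: "ball p (d / 2) \<subseteq> ball p d" "cball p (d / 2) \<subseteq> U" using d(1,2) by auto
  have "two_dz_eq_on (ball p (d / 2)) (\<lambda>z. Max ((\<lambda>j. Re (f j z - f j p)) ` ?I)) \<Phi>"
  proof (rule two_dz_Max[OF prim])
    show "?I \<noteq> {}" by (rule Iset_nonempty[OF p d(1-3)])
    show "\<forall>j\<in>{1..r} - ?I. M j \<inter> ball p (d / 2) = {}" using d(3) sub(1) by blast
    show "\<forall>k\<in>?I. \<forall>j\<in>?I. \<forall>z\<in>M k \<inter> ball p (d / 2). Re (f j z - f j p) \<le> Re (f k z - f k p)"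
      using d(4) sub(1) by blast
  qed (use d(1) sub in \<open>auto simp: Iset_def\<close>)
  moreover have "p \<in> ball p (d / 2)" using d(1) by simp
  ultimately show "\<exists>W. open W \<and> p \<in> W \<and> W \<subseteq> U \<and>
      two_dz_eq_on W (\<lambda>z. Max ((\<lambda>j. Re (f j z - f j p)) ` ?I)) \<Phi>"
    using sub(1) d(2) by (intro exI[of _ "ball p (d / 2)"]) auto
qed

end
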